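(* Let $n\in\omega=\{0,1,2,\dots\}$ and let $X$ be a $T_0$-space. Then $X$ is (homeomorphic to) a subspace of an Eberlein compact (respectively, of a Corson compact; of a uniform Eberlein compact; of an $n$-uniform Eberlein compact) iff $X$ is an E-space (respectively, a C-space; a UE-space; an $n$-UE-space).
   Context: "Space" means topological $T_0$-space. $\mathbb N=\{1,2,\dots\}$, $\mathbb I=[0,1]$. For a space $X$, a zero-set is $f^{-1}(0)$ and a cozero-set is $X\setminus f^{-1}(0)$ for a continuous $f:X\to\mathbb I$; $Z(X)$ and $Coz(X)$ are the collections of all zero-sets and all cozero-sets. Compacta. An Eberlein compact is a compact Hausdorff space homeomorphic to a weakly compact subset of a Banach space. A uniform Eberlein compact is a compact Hausdorff space homeomorphic to a weakly compact subset of a Hilbert space. A Corson compact is a compact space homeomorphic to a subspace of $\Sigma(\mathbb I,\Gamma)=\{x\in\mathbb I^\Gamma : |\{\gamma\in\Gamma: x(\gamma)>0\}|\le\aleph_0\}$ (product topology) for some set $\Gamma$. For $n\in\omega$, an $n$-uniform Eberlein compact is a compact Hausdorff space having a $\sigma$-$(n+1)$-boundedly point-finite family $\gamma$ of cozero-sets that is $T_0$-separating (for all $x\ne y$ there is $U\in\gamma$ with $|U\cap\{x,y\}|=1$). Families of subsets of a set $X$. A family is strongly point-finite (respectively, strongly point-countable) if every subfamily of cardinality $\aleph_0$ (respectively, $\aleph_1$) contains a finite subfamily with empty intersection. For $m\in\mathbb N$, a family is $m$-boundedly point-finite if each point of $X$ is in at most $m$ of its members; it is boundedly point-finite if it is $m$-boundedly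 point-finite for some $m\in\mathbb N$. A family is $\sigma$-P, for such a property P, if it is a union of countably many families each having P (for $\sigma$-$m$-boundedly, with the same $m$; for $\sigma$-boundedly, the bounds may vary). Almost subbases. A U-representation of a subset $V$ of a space $X$ is a collection $U(V)=\{U_k(V): k\in\mathbb N\}$ with $V=\bigcup_k U_k(V)$ and, for all $k\in\mathbb N$, $U_k(V)\subseteq U_{k+1}(V)$, $U_{2k-1}(V)\in Z(X)$, $U_{2k}(V)\in Coz(X)$. A family $\alpha$ of subsets of $X$ is an almost subbase of $X$ if one can choose for each $V\in\alpha$ a U-representation $U(V)$ such that $\alpha\cup\{X\setminus U_{2k-1}(V): V\in\alpha, k\in\mathbb N\}$ is a subbase of $X$. A space is an E-space (respectively, C-space, UE-space, $n$-UE-space) if it has an almost subbase which is $\sigma$-strongly point-finite (respectively, strongly point-countable, $\sigma$-boundedly point-finite, $\sigma$-$(n+1)$-boundedly point-finite). *)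

theory Defs
  imports "HOL-Analysis.Analysis" "HOL-Probability.Discrete_Topology"
begin

unbundle cardinal_syntax

definition zero_sets :: "'a topology \<Rightarrow> 'a set set" where
  "zero_sets X = {{x \<in> topspace X. f x = 0} | f. continuous_map X (top_of_set {0..1::real}) f}"

definition cozero_sets :: "'a topology \<Rightarrow> 'a set set" where
  "cozero_sets X =
    {topspace X - {x \<in> topspace X. f x = 0} | f. continuous_map X (top_of_set {0..1::real}) f}"

text \<open>Families are sets of sets. The intersection of the empty subfamily is the whole type, hence
  nonempty; in a nonempty space this agrees with reading it as the whole space, and an empty space
  has no infinite families of subsets.\<close>

definition strongly_point_finite :: "'a set set \<Rightarrow> bool" where
  "strongly_point_finite \<F> \<longleftrightarrow>
    (\<forall>\<G>\<subseteq>\<F>. |\<G>| =o natLeq \<longrightarrow> (\<exists>\<H>\<subseteq>\<G>. finite \<H> \<and> \<Inter>\<H> = {}))"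

text \<open>The cardinal \<open>\<aleph>\<^sub>1\<close> is \<^term>\<open>cardSuc natLeq\<close>.\<close>

definition strongly_point_countable :: "'a set set \<Rightarrow> bool" where
  "strongly_point_countable \<F> \<longleftrightarrow>
    (\<forall>\<G>\<subseteq>\<F>. |\<G>| =o cardSuc natLeq \<longrightarrow> (\<exists>\<H>\<subseteq>\<G>. finite \<H> \<and> \<Inter>\<H> = {}))"

definition m_boundedly_point_finite :: "nat \<Rightarrow> 'a set set \<Rightarrow> bool" where
  "m_boundedly_point_finite m \<F> \<longleftrightarrow> (\<forall>x. finite {U \<in> \<F>. x \<in> U} \<and> card {U \<in> \<F>. x \<in> U} \<le> m)"

definition boundedly_point_finite :: "'a set set \<Rightarrow> bool" where
  "boundedly_point_finite \<F> \<longleftrightarrow> (\<exists>m\<ge>1. m_boundedly_point_finite m \<F>)"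

definition sigma_family :: "('a set set \<Rightarrow> bool) \<Rightarrow> 'a set set \<Rightarrow> bool" where
  "sigma_family P \<F> \<longleftrightarrow> (\<exists>\<G> :: nat \<Rightarrow> 'a set set. \<F> = (\<Union>i. \<G> i) \<and> (\<forall>i. P (\<G> i)))"

definition T0_separating :: "'a topology \<Rightarrow> 'a set set \<Rightarrow> bool" where
  "T0_separating X \<gamma> \<longleftrightarrow>
    (\<forall>x\<in>topspace X. \<forall>y\<in>topspace X. x \<noteq> y \<longrightarrow> (\<exists>U\<in>\<gamma>. card (U \<inter> {x, y}) = 1))"

text \<open>The intersection of zero members of a subbase is the whole space, so a subbase need not
  cover it.\<close>

definition is_subbase :: "'a topology \<Rightarrow> 'a set set \<Rightarrow> bool" where
  "is_subbase X \<S> \<longleftrightarrow> \<S> \<subseteq> Pow (topspace X) \<and>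
    X = topology (arbitrary union_of (finite intersection_of (\<lambda>U. U \<in> \<S>) relative_to topspace X))"

text \<open>Only the values \<open>U k\<close> with \<open>k \<ge> 1\<close> are relevant.\<close>

definition U_representation :: "'a topology \<Rightarrow> 'a set \<Rightarrow> (nat \<Rightarrow> 'a set) \<Rightarrow> bool" where
  "U_representation X V U \<longleftrightarrow> V = (\<Union>k\<in>{1..}. U k) \<and>
    (\<forall>k\<ge>1. U k \<subseteq> U (k + 1) \<and> U (2 * k - 1) \<in> zero_sets X \<and> U (2 * k) \<in> cozero_sets X)"

definition almost_subbase :: "'a topology \<Rightarrow> 'a set set \<Rightarrow> bool" where
  "almost_subbase X \<alpha> \<longleftrightarrow> \<alpha> \<subseteq> Pow (topspace X) \<and>
    (\<exists>U :: 'a set \<Rightarrow> nat \<Rightarrow> 'a set. (\<forall>V\<in>\<alpha>. U_representation X V (U V)) \<and>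
      is_subbase X (\<alpha> \<union> {topspace X - U V (2 * k - 1) | V k. V \<in> \<alpha> \<and> k \<ge> 1}))"

definition E_space :: "'a topology \<Rightarrow> bool" where
  "E_space X \<longleftrightarrow> t0_space X \<and>
    (\<exists>\<alpha>. almost_subbase X \<alpha> \<and> sigma_family strongly_point_finite \<alpha>)"

definition C_space :: "'a topology \<Rightarrow> bool" where
  "C_space X \<longleftrightarrow> t0_space X \<and> (\<exists>\<alpha>. almost_subbase X \<alpha> \<and> strongly_point_countable \<alpha>)"

definition UE_space :: "'a topology \<Rightarrow> bool" where
  "UE_space X \<longleftrightarrow> t0_space X \<and>
    (\<exists>\<alpha>. almost_subbase X \<alpha> \<and> sigma_family boundedly_point_finite \<alpha>)"

definition n_UE_space :: "nat \<Rightarrow> 'a topology \<Rightarrow> bool" where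
  "n_UE_space n X \<longleftrightarrow> t0_space X \<and>
    (\<exists>\<alpha>. almost_subbase X \<alpha> \<and> sigma_family (m_boundedly_point_finite (n + 1)) \<alpha>)"

definition weak_topology :: "'v::real_normed_vector topology" where
  "weak_topology = topology_generated_by {f -` W | f W. bounded_linear (f :: 'v \<Rightarrow> real) \<and> open W}"

text \<open>HOL cannot quantify existentially over types, so the type of the Banach space, of the Hilbert
  space, and of the index set \<open>\<Gamma>\<close>, is a parameter of the following notions. To assume one of
  them in full generality, leave that type arbitrary; to conclude one, name a specific type. A
  family of subsets of a space over \<^typ>\<open>'a\<close> has at most as many members as \<^typ>\<open>'a set\<close>, so
  spaces of functions on \<^typ>\<open>'a set \<times> nat\<close> provide countably many coordinates for each member of
  an almost subbase. Real scalars lose nothing: a complex Banach space has the same weak topology as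
  its underlying real space.\<close>

definition eberlein_compact :: "'v::banach itself \<Rightarrow> 'k topology \<Rightarrow> bool" where
  "eberlein_compact _ K \<longleftrightarrow> compact_space K \<and> Hausdorff_space K \<and>
    (\<exists>S :: 'v set. compactin weak_topology S \<and> K homeomorphic_space subtopology weak_topology S)"

definition uniform_eberlein_compact ::
    "'h::{real_inner, complete_space} itself \<Rightarrow> 'k topology \<Rightarrow> bool" where
  "uniform_eberlein_compact _ K \<longleftrightarrow> compact_space K \<and> Hausdorff_space K \<and>
    (\<exists>S :: 'h set. compactin weak_topology S \<and> K homeomorphic_space subtopology weak_topology S)"

definition Sigma_product :: "'g set \<Rightarrow> ('g \<Rightarrow> real) topology" where
  "Sigma_product \<Gamma> =
    subtopology (product_topology (\<lambda>_. top_of_set {0..1}) \<Gamma>) {x. countable {\<gamma> \<in> \<Gamma>. x \<gamma> > 0}}"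

definition corson_compact :: "'g itself \<Rightarrow> 'k topology \<Rightarrow> bool" where
  "corson_compact _ K \<longleftrightarrow> compact_space K \<and>
    (\<exists>(\<Gamma> :: 'g set) S. K homeomorphic_space subtopology (Sigma_product \<Gamma>) S)"

definition n_uniform_eberlein_compact :: "nat \<Rightarrow> 'k topology \<Rightarrow> bool" where
  "n_uniform_eberlein_compact n K \<longleftrightarrow> compact_space K \<and> Hausdorff_space K \<and>
    (\<exists>\<gamma>\<subseteq>cozero_sets K. sigma_family (m_boundedly_point_finite (n + 1)) \<gamma> \<and> T0_separating K \<gamma>)"

definition embeds_in :: "'a topology \<Rightarrow> 'k topology \<Rightarrow> bool" where
  "embeds_in X K \<longleftrightarrow> (\<exists>S\<subseteq>topspace K. X homeomorphic_space subtopology K S)"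

instance bcontfun :: (metric_space, banach) banach ..

text \<open>The Banach space of bounded real functions on an arbitrary set: for a discrete domain
  continuity is no restriction. It contains \<open>c\<^sub>0\<close> of that set.\<close>

type_synonym 'g linf = "'g discrete \<Rightarrow>\<^sub>C real"

text \<open>The real Hilbert space of square-summable functions.\<close>

typedef 'g ell2 = "{f :: 'g \<Rightarrow> real. (\<lambda>i. (f i)\<^sup>2) summable_on UNIV}"
  morphisms ell2_fun Abs_ell2
  by (rule exI[of _ "\<lambda>_. 0"]) simp

setup_lifting type_definition_ell2

lemma square_summable_add:
  fixes f g :: "'g \<Rightarrow> real"
  assumes "(\<lambda>i. (f i)\<^sup>2) summable_on A" "(\<lambda>i. (g i)\<^sup>2) summable_on A"
  shows "(\<lambda>i. (f i + g i)\<^sup>2) summable_on A"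
proof (rule summable_on_comparison_test)
  show "(\<lambda>i. 2 * (f i)\<^sup>2 + 2 * (g i)\<^sup>2) summable_on A"
    by (intro summable_on_add summable_on_cmult_right assms)
  show "(f i + g i)\<^sup>2 \<le> 2 * (f i)\<^sup>2 + 2 * (g i)\<^sup>2" for i
    using sum_squares_bound[of "f i" "g i"] by (simp add: power2_sum)
qed simp

lemma square_summable_scale:
  fixes f :: "'g \<Rightarrow> real"
  assumes "(\<lambda>i. (f i)\<^sup>2) summable_on A"
  shows "(\<lambda>i. (c * f i)\<^sup>2) summable_on A"
  using summable_on_cmult_right[OF assms, of "c\<^sup>2"] by (simp add: power_mult_distrib)

lemma square_summable_mult:
  fixes f g :: "'g \<Rightarrow> real"
  assumes "(\<lambda>i. (f i)\<^sup>2) summable_on A" "(\<lambda>i. (g i)\<^sup>2) summable_on A"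
  shows "(\<lambda>i. f i * g i) summable_on A"
proof -
  have "(\<lambda>i. norm (f i * g i)) summable_on A"
  proof (rule summable_on_comparison_test)
    show "(\<lambda>i. (f i)\<^sup>2 + (g i)\<^sup>2) summable_on A"
      using assms by (rule summable_on_add)
    show "norm (f i * g i) \<le> (f i)\<^sup>2 + (g i)\<^sup>2" for i
    proof -
      have "2 * (\<bar>f i\<bar> * \<bar>g i\<bar>) \<le> (f i)\<^sup>2 + (g i)\<^sup>2" "0 \<le> \<bar>f i\<bar> * \<bar>g i\<bar>"
        using sum_squares_bound[of "\<bar>f i\<bar>" "\<bar>g i\<bar>"] by (simp_all add: mult.assoc)
      then show ?thesis unfolding real_norm_def abs_mult by linarith
    qed
  qed simp
  then show ?thesis
    by (rule abs_summable_summable)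
qed

instantiation ell2 :: (type) real_inner
begin

lift_definition zero_ell2 :: "'a ell2" is "\<lambda>_. 0" by simp

lift_definition plus_ell2 :: "'a ell2 \<Rightarrow> 'a ell2 \<Rightarrow> 'a ell2" is "\<lambda>f g i. f i + g i"
  by (rule square_summable_add)

lift_definition uminus_ell2 :: "'a ell2 \<Rightarrow> 'a ell2" is "\<lambda>f i. - f i" by simp

lift_definition minus_ell2 :: "'a ell2 \<Rightarrow> 'a ell2 \<Rightarrow> 'a ell2" is "\<lambda>f g i. f i - g i"
proof -
  fix f g :: "'a \<Rightarrow> real"
  assume "(\<lambda>i. (f i)\<^sup>2) summable_on UNIV" "(\<lambda>i. (g i)\<^sup>2) summable_on UNIV"
  then show "(\<lambda>i. (f i - g i)\<^sup>2) summable_on UNIV"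
    using square_summable_add[of f UNIV "\<lambda>i. - g i"] by simp
qed

lift_definition scaleR_ell2 :: "real \<Rightarrow> 'a ell2 \<Rightarrow> 'a ell2" is "\<lambda>c f i. c * f i"
  by (rule square_summable_scale)

lift_definition inner_ell2 :: "'a ell2 \<Rightarrow> 'a ell2 \<Rightarrow> real" is
  "\<lambda>f g. \<Sum>\<^sub>\<infinity>i. f i * g i" .

definition norm_ell2 :: "'a ell2 \<Rightarrow> real" where
  "norm_ell2 x = sqrt (inner x x)"

definition dist_ell2 :: "'a ell2 \<Rightarrow> 'a ell2 \<Rightarrow> real" where
  "dist_ell2 x y = norm (x - y)"

definition sgn_ell2 :: "'a ell2 \<Rightarrow> 'a ell2" where
  "sgn_ell2 x = scaleR (inverse (norm x)) x"

definition uniformity_ell2 :: "('a ell2 \<times> 'a ell2) filter" where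
  "uniformity_ell2 = (INF e\<in>{0 <..}. principal {(x, y). dist x y < e})"

definition open_ell2 :: "'a ell2 set \<Rightarrow> bool" where
  "open_ell2 S \<longleftrightarrow> (\<forall>x\<in>S. \<forall>\<^sub>F (x', y) in uniformity. x' = x \<longrightarrow> y \<in> S)"

instance
proof
  fix x y z :: "'a ell2" and a b :: real
  show "x + y + z = x + (y + z)" by transfer (simp add: add.assoc)
  show "x + y = y + x" by transfer (simp add: add.commute)
  show "0 + x = x" by transfer simp
  show "- x + x = 0" by transfer simp
  show "x - y = x + - y" by transfer simp
  show "a *\<^sub>R (x + y) = a *\<^sub>R x + a *\<^sub>R y" by transfer (simp add: algebra_simps)
  show "(a + b) *\<^sub>R x = a *\<^sub>R x + b *\<^sub>R x" by transfer (simp add: algebra_simps)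
  show "a *\<^sub>R b *\<^sub>R x = (a * b) *\<^sub>R x" by transfer (simp add: algebra_simps)
  show "1 *\<^sub>R x = x" by transfer simp
  show "inner x y = inner y x" by transfer (simp add: mult.commute)
  show "inner (x + y) z = inner x z + inner y z"
    by transfer (simp add: distrib_right infsum_add square_summable_mult)
  show "inner (a *\<^sub>R x) y = a * inner x y"
    by transfer (simp add: mult.assoc infsum_cmult_right')
  show "0 \<le> inner x x" by transfer (simp add: infsum_nonneg)
  show "inner x x = 0 \<longleftrightarrow> x = 0"
  proof
    assume "inner x x = 0"
    then show "x = 0"
    proof transfer
      fix f :: "'a \<Rightarrow> real"
      assume "(\<lambda>i. (f i)\<^sup>2) summable_on UNIV" "(\<Sum>\<^sub>\<infinity>i. f i * f i) = 0"
      then have "f i * f i = 0" for i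
        using nonneg_infsum_le_0D[of "\<lambda>i. f i * f i" UNIV i] by (simp add: power2_eq_square)
      then show "f = (\<lambda>_. 0)" by (intro ext) simp
    qed
  qed (transfer, simp)
qed (rule norm_ell2_def dist_ell2_def sgn_ell2_def uniformity_ell2_def open_ell2_def)+

end

lemma ell2_norm_square: "(norm x)\<^sup>2 = (\<Sum>\<^sub>\<infinity>i. (ell2_fun x i)\<^sup>2)"
proof -
  have "inner x x = (\<Sum>\<^sub>\<infinity>i. (ell2_fun x i)\<^sup>2)"
    by transfer (simp add: power2_eq_square)
  then show ?thesis by (simp add: power2_norm_eq_inner)
qed

lemma ell2_finite_sum_le: "finite F \<Longrightarrow> (\<Sum>i\<in>F. (ell2_fun x i)\<^sup>2) \<le> (norm x)\<^sup>2"
  unfolding ell2_norm_square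
  using ell2_fun[of x] by (intro finite_sum_le_infsum) auto

lemma ell2_norm_leI:
  assumes "\<And>F. finite F \<Longrightarrow> (\<Sum>i\<in>F. (ell2_fun x i)\<^sup>2) \<le> e\<^sup>2" "0 \<le> e"
  shows "norm x \<le> e"
proof -
  have "(norm x)\<^sup>2 \<le> e\<^sup>2"
    unfolding ell2_norm_square
    using ell2_fun[of x] assms(1) by (intro infsum_le_finite_sums) auto
  then show ?thesis using assms(2) by (rule power2_le_imp_le)
qed

instance ell2 :: (type) complete_space
proof
  fix X :: "nat \<Rightarrow> 'a ell2"
  assume "Cauchy X"
  have coord: "\<bar>ell2_fun x i - ell2_fun y i\<bar> \<le> dist x y" for x y :: "'a ell2" and i
  proof -
    have "(ell2_fun (x - y) i)\<^sup>2 \<le> (norm (x - y))\<^sup>2"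
      using ell2_finite_sum_le[of "{i}" "x - y"] by simp
    then have "\<bar>ell2_fun (x - y) i\<bar> \<le> norm (x - y)"
      by (simp add: abs_le_square_iff[symmetric])
    then show ?thesis by (simp add: minus_ell2.rep_eq dist_norm)
  qed
  have "Cauchy (\<lambda>n. ell2_fun (X n) i)" for i
  proof (rule metric_CauchyI)
    fix e :: real assume "0 < e"
    then obtain N where "\<forall>m\<ge>N. \<forall>n\<ge>N. dist (X m) (X n) < e"
      using metric_CauchyD[OF \<open>Cauchy X\<close>] by blast
    then have "\<forall>m\<ge>N. \<forall>n\<ge>N. dist (ell2_fun (X m) i) (ell2_fun (X n) i) < e"
      unfolding dist_real_def by (meson coord le_less_trans)
    then show "\<exists>N. \<forall>m\<ge>N. \<forall>n\<ge>N. dist (ell2_fun (X m) i) (ell2_fun (X n) i) < e" by blast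
  qed
  then have "\<exists>h. \<forall>i. (\<lambda>n. ell2_fun (X n) i) \<longlonglongrightarrow> h i"
    unfolding Cauchy_convergent_iff convergent_def by (intro choice allI)
  then obtain h where h: "\<And>i. (\<lambda>n. ell2_fun (X n) i) \<longlonglongrightarrow> h i"
    by blast
  have tail: "\<exists>N. \<forall>m\<ge>N. \<forall>F. finite F \<longrightarrow> (\<Sum>i\<in>F. (h i - ell2_fun (X m) i)\<^sup>2) \<le> e\<^sup>2"
    if "0 < e" for e :: real
  proof -
    obtain N where N: "\<And>m n. m \<ge> N \<Longrightarrow> n \<ge> N \<Longrightarrow> dist (X m) (X n) < e"
      using metric_CauchyD[OF \<open>Cauchy X\<close> \<open>0 < e\<close>] by blast
    have "(\<Sum>i\<in>F. (h i - ell2_fun (X m) i)\<^sup>2) \<le> e\<^sup>2" if "m \<ge> N" "finite F" for m F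
    proof (rule LIMSEQ_le_const2)
      show "(\<lambda>n. \<Sum>i\<in>F. (ell2_fun (X n) i - ell2_fun (X m) i)\<^sup>2)
          \<longlonglongrightarrow> (\<Sum>i\<in>F. (h i - ell2_fun (X m) i)\<^sup>2)"
        by (intro tendsto_intros h)
      have "(\<Sum>i\<in>F. (ell2_fun (X n) i - ell2_fun (X m) i)\<^sup>2) \<le> e\<^sup>2" if "n \<ge> N" for n
      proof -
        have "(\<Sum>i\<in>F. (ell2_fun (X n - X m) i)\<^sup>2) \<le> (norm (X n - X m))\<^sup>2"
          using \<open>finite F\<close> by (rule ell2_finite_sum_le)
        also have "\<dots> \<le> e\<^sup>2"
          using N[OF \<open>n \<ge> N\<close> \<open>m \<ge> N\<close>] by (intro power_mono) (auto simp: dist_norm)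
        finally show ?thesis by (simp add: minus_ell2.rep_eq)
      qed
      then show "\<exists>N. \<forall>n\<ge>N. (\<Sum>i\<in>F. (ell2_fun (X n) i - ell2_fun (X m) i)\<^sup>2) \<le> e\<^sup>2"
        by blast
    qed
    then show ?thesis by blast
  qed
  obtain M where M: "\<And>F. finite F \<Longrightarrow> (\<Sum>i\<in>F. (h i - ell2_fun (X M) i)\<^sup>2) \<le> 1"
    using tail[of 1] by auto
  have "(\<lambda>i. (h i - ell2_fun (X M) i)\<^sup>2) summable_on UNIV"
    by (rule nonneg_bdd_above_summable_on) (use M in \<open>auto intro!: bdd_aboveI2\<close>)
  from square_summable_add[OF this, of "ell2_fun (X M)"]
  have h_mem: "(\<lambda>i. (h i)\<^sup>2) summable_on UNIV"
    using ell2_fun[of "X M"] by simp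
  define H where "H = Abs_ell2 h"
  have H: "ell2_fun H = h"
    unfolding H_def using h_mem by (simp add: Abs_ell2_inverse)
  have "X \<longlonglongrightarrow> H"
  proof (rule metric_LIMSEQ_I)
    fix e :: real assume "0 < e"
    then obtain N where N: "\<And>m F. m \<ge> N \<Longrightarrow> finite F \<Longrightarrow>
        (\<Sum>i\<in>F. (h i - ell2_fun (X m) i)\<^sup>2) \<le> (e / 2)\<^sup>2"
      using tail[of "e / 2"] by auto
    have "dist (X m) H < e" if "m \<ge> N" for m
    proof -
      have "norm (H - X m) \<le> e / 2"
        using N[OF that] \<open>0 < e\<close>
        by (intro ell2_norm_leI) (auto simp: minus_ell2.rep_eq H)
      then show ?thesis using \<open>0 < e\<close> by (simp add: dist_norm norm_minus_commute)
    qed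
    then show "\<exists>N. \<forall>m\<ge>N. dist (X m) H < e" by blast
  qed
  then show "convergent X" by (auto simp: convergent_def)
qed

end

theory Submission
  imports Defs "HOL-Library.Countable_Set_Type"
begin

text \<open>A family of continuous functions on a compact space that separates points yields an almost
  subbase consisting of the sets \<open>{f > q}\<close>, with compactness turning point-finiteness into strong
  point-finiteness. Conversely, the U-representations of an almost subbase embed the space into a
  cube; a finite intersection of sets \<open>{y\<^sub>V > 0}\<close> that meets the closure of the image also meets
  the image, so every point of the closure satisfies the finiteness condition of the family, and
  after rescaling the coordinates the closure is a weakly compact subset of \<open>c\<^sub>0\<close> or \<open>\<ell>\<^sub>2\<close>.

  For an Eberlein compact \<open>X\<close> the required functions are a version of the Amir--Lindenstrauss theorem.
  Following Gul'ko, let \<open>\<phi>\<close> be the separately continuous pairing of \<open>X\<close> with the dual unit ball \<open>Y\<close>.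
  Sets \<open>A \<subseteq> X\<close> and \<open>B \<subseteq> Y\<close> are conjugate if \<open>A\<close> is dense in \<open>X\<close> for the topology of pointwise
  convergence on \<open>B\<close>, and vice versa. Then there is a retraction \<open>r\<close> of \<open>X\<close> onto the closure of
  \<open>A\<close> with \<open>\<phi> (r x) b = \<phi> x b\<close> for \<open>b \<in> B\<close>. Conjugacy is a finitary closure condition with
  countable witnesses, so an uncountable conjugate pair is a continuous increasing union of smaller
  ones. The functions are constructed by induction on the cardinality: if \<open>r\<^sub>a\<^sup>+\<close> and \<open>r\<^sub>a\<^sup>-\<close> are
  the retractions for the pairs generated up to and below \<open>a\<close>, then the increments of
  \<open>r\<^sub>a\<^sup>+ x\<close> over \<open>r\<^sub>a\<^sup>- x\<close> exceed any \<open>e > 0\<close> for finitely many \<open>a\<close> only, and the functions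
  \<open>(\<mu> \<circ> r\<^sub>a\<^sup>+ - \<mu> \<circ> r\<^sub>a\<^sup>-) / 2\<close> work, where \<open>\<mu>\<close> runs through the functions for the smaller pairs.\<close>

section \<open>Cardinalities and compactness\<close>

text \<open>The Amir--Lindenstrauss theorem enters for Eberlein compacta alone: Corson and n-uniform
  Eberlein compacta carry suitable functions by definition, and in a Hilbert space the coordinates
  along a maximal orthonormal set serve. A general Banach space offers no such coordinates, and they
  have to be manufactured from the pairing. The obstacle is to exhaust a pair by strictly smaller
  ones. A finite set of constraints is a box in a finite-dimensional space, which is second
  countable; so countably many witnesses per finite set suffice for density, and generating a pair
  from an infinite set does not raise the cardinality. Rational thresholds keep the almost subbase a
  countable union of one-threshold families, and the weights of the rescaling are built from powers
  of 1/2 because each combination of a family and a level is already finite, or bounded, at every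
  point of the closure.\<close>

lemma card_of_finite_subsets_ordLeq:
  assumes P: "infinite P" and T: "|T| \<le>o |P|"
  shows "|{F. finite F \<and> F \<subseteq> T}| \<le>o |P|"
proof -
  define N where "N n = {F. finite F \<and> F \<subseteq> T \<and> card F = n}" for n :: nat
  have N: "|N n| \<le>o |P|" for n
  proof (induction n)
    case 0
    have "N 0 = {{}}" unfolding N_def by auto
    then show ?case using P by (simp add: card_of_singl_ordLeq infinite_imp_nonempty)
  next
    case (Suc n)
    have "N (Suc n) \<subseteq> (\<lambda>(x, F). insert x F) ` (T \<times> N n)"
    proof
      fix F assume "F \<in> N (Suc n)"
      then obtain x G where "F = insert x G" "x \<notin> G" "card G = n" "finite F" "F \<subseteq> T"
        unfolding N_def by (auto simp: card_Suc_eq)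
      then show "F \<in> (\<lambda>(x, F). insert x F) ` (T \<times> N n)"
        unfolding N_def by (intro image_eqI[of _ _ "(x, G)"]) auto
    qed
    then have "|N (Suc n)| \<le>o |T \<times> N n|"
      by (meson card_of_image card_of_mono1 ordLeq_transitive)
    also have "|T \<times> N n| \<le>o |P|"
      using P T Suc by (intro card_of_Times_ordLeq_infinite_Field) (simp_all add: Field_card_of card_of_card_order_on)
    finally show ?case .
  qed
  have "{F. finite F \<and> F \<subseteq> T} = (\<Union>n. N n)" unfolding N_def by auto
  moreover have "|\<Union>n. N n| \<le>o |P|"
    using N P by (intro card_of_UNION_ordLeq_infinite) (auto simp: infinite_iff_card_of_nat)
  ultimately show ?thesis by simp
qed

text \<open>Conjugacy as such is not inherited by intersections, so there is in general no least
  conjugate pair above a given set. Fixing for each finite \<open>F\<close> a set \<open>W F\<close>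
  that has to be present replaces it by a closure system, which has hulls and is stable under unions
  of chains.\<close>

definition finitely_closed :: "('z set \<Rightarrow> 'z set) \<Rightarrow> 'z set \<Rightarrow> bool" where
  "finitely_closed W S \<longleftrightarrow> (\<forall>F. finite F \<longrightarrow> F \<subseteq> S \<longrightarrow> W F \<subseteq> S)"

lemma finitely_closed_hull: "finitely_closed W (finitely_closed W hull T)"
  by (rule hull_in) (unfold finitely_closed_def, blast)

lemma finitely_closed_chain_Union:
  assumes "\<D> \<noteq> {}" "\<And>S. S \<in> \<D> \<Longrightarrow> finitely_closed W S" "\<And>S T. S \<in> \<D> \<Longrightarrow> T \<in> \<D> \<Longrightarrow> S \<subseteq> T \<or> T \<subseteq> S"
  shows "finitely_closed W (\<Union>\<D>)"
  unfolding finitely_closed_def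
proof (intro allI impI)
  fix F assume "finite F" "F \<subseteq> \<Union>\<D>"
  then obtain S where "S \<in> \<D>" "F \<subseteq> S"
    using finite_subset_Union_chain[of F \<D> UNIV] assms(1,3) by (auto simp: subset_chain_def)
  then show "W F \<subseteq> \<Union>\<D>"
    using assms(2) \<open>finite F\<close> unfolding finitely_closed_def by blast
qed

text \<open>The downward Loewenheim-Skolem argument: iterate \<open>step\<close> countably often.
  Each round adds a countable set for every finite subset, which does not exceed the size of
  \<open>P\<close>, and a finite subset of the union lies in one round. Comparing with an arbitrary
  infinite \<open>P\<close> covers finite \<open>T\<close> too.\<close>

lemma card_of_finitely_closed_hull:
  assumes P: "infinite P" and T: "|T| \<le>o |P|" and W: "\<And>F. countable (W F)"
  shows "|finitely_closed W hull T| \<le>o |P|"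
proof -
  define step where "step S = S \<union> (\<Union>F\<in>{F. finite F \<and> F \<subseteq> S}. W F)" for S
  have W': "|W F| \<le>o |P|" for F
    using W[of F] P by (meson countable_card_of_nat infinite_iff_card_of_nat ordLeq_transitive)
  have iter: "|(step ^^ n) T| \<le>o |P|" for n
  proof (induction n)
    case (Suc n)
    have "|\<Union>F\<in>{F. finite F \<and> F \<subseteq> (step ^^ n) T}. W F| \<le>o |P|"
      using P Suc W' by (intro card_of_UNION_ordLeq_infinite card_of_finite_subsets_ordLeq) auto
    then show ?case
      using P Suc unfolding funpow.simps comp_def step_def[of "(step ^^ n) T"]
      by (intro card_of_Un_ordLeq_infinite_Field) (simp_all add: Field_card_of card_of_card_order_on)
  qed (use T in simp)
  define S where "S = (\<Union>n. (step ^^ n) T)"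
  have "|S| \<le>o |P|"
    unfolding S_def using iter P by (intro card_of_UNION_ordLeq_infinite) (auto simp: infinite_iff_card_of_nat)
  have "(step ^^ n) T \<subseteq> (step ^^ Suc n) T" for n
    unfolding funpow.simps comp_def step_def[of "(step ^^ n) T"] by blast
  then have mono: "(step ^^ m) T \<subseteq> (step ^^ n) T" if "m \<le> n" for m n
    using lift_Suc_mono_le[of "\<lambda>n. (step ^^ n) T" m n] that by blast
  have "(step ^^ m) T \<subseteq> (step ^^ n) T \<or> (step ^^ n) T \<subseteq> (step ^^ m) T" for m n
    by (meson mono nat_le_linear)
  then have chain: "subset.chain UNIV (range (\<lambda>n. (step ^^ n) T))"
    unfolding subset_chain_def by blast
  have "finitely_closed W S"
    unfolding finitely_closed_def
  proof (intro allI impI)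
    fix F assume F: "finite F" "F \<subseteq> S"
    then obtain n where "F \<subseteq> (step ^^ n) T"
      using finite_subset_Union_chain[OF F(1) _ _ chain] unfolding S_def by blast
    then have "W F \<subseteq> (step ^^ Suc n) T"
      using F(1) by (auto simp: step_def)
    then show "W F \<subseteq> S" unfolding S_def by blast
  qed
  moreover have "T \<subseteq> S" unfolding S_def by (metis UN_upper UNIV_I funpow_0)
  ultimately have "finitely_closed W hull T \<subseteq> S" by (simp add: hull_minimal)
  then show ?thesis using \<open>|S| \<le>o |P|\<close> by (meson card_of_mono1 ordLeq_transitive)
qed

text \<open>The invariant \<open>Q\<close> asks for infinitely many elements of \<open>E\<close>
  above the current one. The least element of that infinite tail inherits it, since the rest of the
  tail lies above it; dependent choice then yields the sequence.\<close>

lemma well_order_infinite_imp_sequence: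
  assumes r: "Well_order r" and E: "infinite E" "E \<subseteq> Field r"
  shows "\<exists>a :: nat \<Rightarrow> 'a. \<forall>n. a n \<in> E \<and> (a n, a (Suc n)) \<in> r \<and> a n \<noteq> a (Suc n)"
proof -
  interpret wo_rel r using r by (simp add: wo_rel_def)
  define Q where "Q x \<longleftrightarrow> x \<in> E \<and> infinite {z \<in> E. (x, z) \<in> r \<and> x \<noteq> z}" for x
  have least: "\<exists>m\<in>G. \<forall>z\<in>G. (m, z) \<in> r" if "G \<subseteq> E" "infinite G" for G
  proof -
    have "G \<subseteq> Field r" "G \<noteq> {}" using that E by auto
    then show ?thesis using minim_in minim_least by blast
  qed
  have "\<exists>x. Q x"
  proof -
    obtain m where m: "m \<in> E" "\<And>z. z \<in> E \<Longrightarrow> (m, z) \<in> r" using least[of E] E by auto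
    have "E - {m} \<subseteq> {z \<in> E. (m, z) \<in> r \<and> m \<noteq> z}" using m by auto
    then show ?thesis unfolding Q_def using m E by (meson finite_subset infinite_remove)
  qed
  moreover have "\<exists>y. Q y \<and> (x, y) \<in> r \<and> x \<noteq> y" if "Q x" for x
  proof -
    define G where "G = {z \<in> E. (x, z) \<in> r \<and> x \<noteq> z}"
    have "infinite G" "G \<subseteq> E" using that unfolding G_def Q_def by auto
    then obtain m where m: "m \<in> G" "\<And>z. z \<in> G \<Longrightarrow> (m, z) \<in> r" using least[of G] by auto
    have "G - {m} \<subseteq> {z \<in> E. (m, z) \<in> r \<and> m \<noteq> z}" using m \<open>G \<subseteq> E\<close> by auto
    then have "Q m" unfolding Q_def using m \<open>G \<subseteq> E\<close> \<open>infinite G\<close>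
      by (meson finite_subset infinite_remove subsetD)
    then show ?thesis using m unfolding G_def by auto
  qed
  ultimately obtain a where "\<And>n. Q (a n) \<and> (a n, a (Suc n)) \<in> r \<and> a n \<noteq> a (Suc n)"
    using dependent_nat_choice[of "\<lambda>_. Q" "\<lambda>_ x y. (x, y) \<in> r \<and> x \<noteq> y"] by metis
  then show ?thesis unfolding Q_def by blast
qed

section \<open>Compactness arguments for families of real functions\<close>

lemma closedin_Collect_eq_zero:
  assumes "\<And>i. i \<in> I \<Longrightarrow> continuous_map X euclideanreal (f i)"
  shows "closedin X {x \<in> topspace X. \<forall>i\<in>I. f i x = 0}"
proof (cases "I = {}")
  case False
  have "{x \<in> topspace X. \<forall>i\<in>I. f i x = 0} = (\<Inter>i\<in>I. {x \<in> topspace X. f i x \<in> {0}})"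
    using False by auto
  moreover have "closedin X \<dots>"
    using False assms by (intro closedin_INT closedin_continuous_map_preimage[where Y = euclideanreal]) auto
  ultimately show ?thesis by simp
qed simp

text \<open>Compactness turns approximate into exact solutions: the closed conditions
  \<open>\<bar>f b a - t b\<bar> \<le> e\<close> have the finite intersection property on the
  closure of \<open>A\<close>. The existence of the retractions, of their dual points and of
  neighbourhoods given by finitely many functions all rest on this.\<close>

lemma closure_of_realizes:
  assumes X: "compact_space X" and cont: "\<And>b. b \<in> B \<Longrightarrow> continuous_map X euclideanreal (f b)"
    and A: "A \<subseteq> topspace X"
    and dense: "\<And>F e. finite F \<Longrightarrow> F \<subseteq> B \<Longrightarrow> 0 < e \<Longrightarrow> \<exists>a\<in>A. \<forall>b\<in>F. \<bar>f b a - t b\<bar> < (e::real)"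
  shows "\<exists>a\<in>X closure_of A. \<forall>b\<in>B. f b a = t b"
proof -
  define C where "C = (\<lambda>(b, e). {x \<in> topspace X. f b x \<in> cball (t b) e})"
  define I where "I = B \<times> {0::real<..}"
  have cpt: "compactin X (X closure_of A)"
    using X by (simp add: closedin_compact_space)
  have "closedin X (C p)" if "p \<in> I" for p
    using closedin_continuous_map_preimage[OF cont[of "fst p"], of "cball (t (fst p)) (snd p)"] that
    unfolding C_def I_def by (cases p) auto
  then have "\<forall>D\<in>C ` I. closedin X D" by blast
  moreover have "X closure_of A \<inter> \<Inter>\<F> \<noteq> {}" if \<F>: "finite \<F>" "\<F> \<subseteq> C ` I" for \<F>
  proof -
    obtain J where J: "finite J" "J \<subseteq> I" "\<F> = C ` J" using finite_subset_image[OF \<F>] by blast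
    \<comment> \<open>One accuracy for all finitely many constraints; the 1 keeps the minimum
      defined for empty \<open>J\<close>.\<close>
    define e where "e = Min (insert 1 (snd ` J))"
    have "e > 0" unfolding e_def using J unfolding I_def by (subst Min_gr_iff) auto
    moreover have "finite (fst ` J)" "fst ` J \<subseteq> B" using J unfolding I_def by auto
    ultimately obtain a where a: "a \<in> A" "\<And>b. b \<in> fst ` J \<Longrightarrow> \<bar>f b a - t b\<bar> < e"
      using dense by metis
    have "a \<in> C p" if "p \<in> J" for p
    proof -
      have "e \<le> snd p" unfolding e_def using J that by (intro Min_le) auto
      then show ?thesis using a(2)[of "fst p"] a(1) A that unfolding C_def
        by (auto simp: dist_real_def split: prod.splits)
    qed
    then show ?thesis using J a closure_of_subset[OF A] by auto
  qed
  ultimately have "X closure_of A \<inter> \<Inter>(C ` I) \<noteq> {}"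
    using cpt[unfolded compactin_fip] by blast
  then obtain a where a: "a \<in> X closure_of A" "\<And>p. p \<in> I \<Longrightarrow> a \<in> C p" by auto
  have "f b a = t b" if "b \<in> B" for b
  proof -
    have "\<bar>f b a - t b\<bar> \<le> e" if "e > 0" for e
      using a(2)[of "(b, e)"] \<open>b \<in> B\<close> that unfolding C_def I_def by (auto simp: dist_real_def)
    then have "\<bar>f b a - t b\<bar> \<le> 0" by (meson dense_ge)
    then show ?thesis by simp
  qed
  then show ?thesis using a(1) by blast
qed

text \<open>If no finite set of functions confined \<open>x\<close> to \<open>U\<close>, the closed
  complement of \<open>U\<close> would contain points approximating \<open>x\<close> on every finite
  set, hence by \<open>closure_of_realizes\<close> a point that no function tells from
  \<open>x\<close>. So a point-separating family on a compact space generates its topology.\<close>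

lemma compact_space_initial:
  assumes X: "compact_space X" and cont: "\<And>f. f \<in> F \<Longrightarrow> continuous_map X euclideanreal f"
    and sep: "\<And>x y. x \<in> topspace X \<Longrightarrow> y \<in> topspace X \<Longrightarrow> \<forall>f\<in>F. f x = f y \<Longrightarrow> x = y"
    and U: "openin X U" "x \<in> U"
  shows "\<exists>G e. finite G \<and> G \<subseteq> F \<and> 0 < e \<and> (\<forall>z\<in>topspace X. (\<forall>f\<in>G. \<bar>f z - f x\<bar> < (e::real)) \<longrightarrow> z \<in> U)"
proof (rule ccontr)
  assume *: "\<not> ?thesis"
  have xX: "x \<in> topspace X" using U openin_subset by blast
  define A where "A = topspace X - U"
  have "\<exists>a\<in>A. \<forall>f\<in>G. \<bar>f a - f x\<bar> < e" if "finite G" "G \<subseteq> F" "0 < e" for G and e :: real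
    using * that unfolding A_def by blast
  then have "\<exists>a\<in>X closure_of A. \<forall>f\<in>F. f a = f x"
    using X cont by (intro closure_of_realizes[where f = "\<lambda>f. f"]) (auto simp: A_def)
  moreover have "closedin X A" unfolding A_def using U by (intro closedin_diff) auto
  ultimately obtain a where "a \<in> A" "\<forall>f\<in>F. f a = f x" by (auto simp: closure_of_closedin)
  then show False using sep[of a x] xX U unfolding A_def by auto
qed

lemma continuous_map_into_compact_space:
  assumes X: "compact_space X" and cont: "\<And>f. f \<in> F \<Longrightarrow> continuous_map X euclideanreal f"
    and sep: "\<And>x y. x \<in> topspace X \<Longrightarrow> y \<in> topspace X \<Longrightarrow> \<forall>f\<in>F. f x = f y \<Longrightarrow> x = y"
    and g: "\<And>z. z \<in> topspace Z \<Longrightarrow> g z \<in> topspace X"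
    and fg: "\<And>f. f \<in> F \<Longrightarrow> continuous_map Z euclideanreal (\<lambda>z. f (g z))"
  shows "continuous_map Z X g"
  unfolding continuous_map_def
proof (intro conjI allI impI)
  show "g \<in> topspace Z \<rightarrow> topspace X" using g by auto
  fix U assume U: "openin X U"
  show "openin Z {z \<in> topspace Z. g z \<in> U}"
  proof (subst openin_subopen, intro ballI)
    fix z assume z: "z \<in> {z \<in> topspace Z. g z \<in> U}"
    then have "\<exists>G e. finite G \<and> G \<subseteq> F \<and> 0 < e \<and>
        (\<forall>w\<in>topspace X. (\<forall>f\<in>G. \<bar>f w - f (g z)\<bar> < (e::real)) \<longrightarrow> w \<in> U)"
      by (intro compact_space_initial[OF X cont sep U]) auto
    then obtain G and e :: real where G: "finite G" "G \<subseteq> F" "0 < e"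
      "\<And>w. w \<in> topspace X \<Longrightarrow> \<forall>f\<in>G. \<bar>f w - f (g z)\<bar> < e \<Longrightarrow> w \<in> U"
      by blast
    define N where "N = topspace Z \<inter> (\<Inter>f\<in>G. {w \<in> topspace Z. f (g w) \<in> ball (f (g z)) e})"
    have "openin Z {w \<in> topspace Z. f (g w) \<in> ball (f (g z)) e}" if "f \<in> G" for f
      using openin_continuous_map_preimage[OF fg[of f], of "ball (f (g z)) e"] that G(2) by auto
    then have "openin Z N"
      unfolding N_def using G(1) by (intro openin_Int_Inter) auto
    moreover have "z \<in> N" using z G unfolding N_def by auto
    moreover have "N \<subseteq> {z \<in> topspace Z. g z \<in> U}"
      using G(4) g unfolding N_def by (auto simp: dist_real_def abs_minus_commute)
    ultimately show "\<exists>T. openin Z T \<and> z \<in> T \<and> T \<subseteq> {z \<in> topspace Z. g z \<in> U}" by blast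
  qed
qed

text \<open>Values on \<open>F\<close> live in a finite-dimensional space, which is second
  countable. Boxes are coded by a rational centre \<open>q\<close> and a radius
  \<open>1 / real (Suc n)\<close>; one point of \<open>A\<close> is chosen in each box that contains
  one. Two points in a box differ by less than two radii, hence the choice of \<open>n\<close> with
  radius below \<open>e / 2\<close>.\<close>

lemma countable_approximating_subset:
  fixes f :: "'b \<Rightarrow> 'a \<Rightarrow> real"
  assumes "finite F"
  shows "\<exists>D\<subseteq>A. countable D \<and> (\<forall>x\<in>A. \<forall>e>0. \<exists>a\<in>D. \<forall>b\<in>F. \<bar>f b a - f b x\<bar> < e)"
proof -
  define Q where "Q = Pi\<^sub>E F (\<lambda>_. \<rat> :: real set) \<times> (UNIV :: nat set)"
  define P where "P = (\<lambda>(q, n) a. a \<in> A \<and> (\<forall>b\<in>F. \<bar>f b a - q b\<bar> < 1 / real (Suc n)))"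
  define D where "D = (\<lambda>p. SOME a. P p a) ` {p \<in> Q. \<exists>a. P p a}"
  have P: "P p (SOME a. P p a)" if "\<exists>a. P p a" for p using that by (rule someI_ex)
  have "countable Q" unfolding Q_def
    using assms by (intro countable_SIGMA countable_PiE) (auto simp: countable_rat)
  then have "countable D" unfolding D_def by (intro countable_image) (auto intro: countable_subset)
  moreover have "D \<subseteq> A" unfolding D_def using P by (auto simp: P_def)
  moreover have "\<exists>a\<in>D. \<forall>b\<in>F. \<bar>f b a - f b x\<bar> < e" if x: "x \<in> A" and e: "e > 0" for x and e :: real
  proof -
    obtain n where n: "1 / real (Suc n) < e / 2" using e nat_approx_posE[of "e / 2"] by auto
    have "\<exists>r\<in>\<rat>. \<bar>f b x - r\<bar> < 1 / real (Suc n)" for b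
    proof -
      obtain r where "r \<in> \<rat>" "f b x - 1 / real (Suc n) < r" "r < f b x"
        using Rats_dense_in_real[of "f b x - 1 / real (Suc n)" "f b x"] by auto
      then show ?thesis by (intro bexI[of _ r]) (auto simp: abs_if)
    qed
    then obtain q where q: "\<And>b. q b \<in> \<rat>" "\<And>b. \<bar>f b x - q b\<bar> < 1 / real (Suc n)" by metis
    define p where "p = (restrict q F, n)"
    have "p \<in> Q" unfolding p_def Q_def using q by auto
    moreover have "P p x" unfolding p_def P_def using q x by auto
    ultimately have "(SOME a. P p a) \<in> D" "P p (SOME a. P p a)" unfolding D_def using P[of p] by blast+
    moreover have "\<bar>f b a - f b x\<bar> < e" if "P p a" "b \<in> F" for a b
      using that q(2)[of b] n unfolding P_def p_def by auto
    ultimately show ?thesis by blast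
  qed
  ultimately show ?thesis by blast
qed

section \<open>Conjugate sets and the Amir--Lindenstrauss theorem\<close>

locale separating_pairing =
  fixes X :: "'x topology" and Y :: "'y topology" and \<phi> :: "'x \<Rightarrow> 'y \<Rightarrow> real"
  assumes compact_X: "compact_space X" and compact_Y: "compact_space Y"
    and cont_left: "\<And>y. y \<in> topspace Y \<Longrightarrow> continuous_map X euclideanreal (\<lambda>x. \<phi> x y)"
    and cont_right: "\<And>x. x \<in> topspace X \<Longrightarrow> continuous_map Y euclideanreal (\<phi> x)"
    and separating: "\<And>x x'. x \<in> topspace X \<Longrightarrow> x' \<in> topspace X \<Longrightarrow>
      \<forall>y\<in>topspace Y. \<phi> x y = \<phi> x' y \<Longrightarrow> x = x'"
begin

text \<open>Density for pointwise convergence is spelled out by finite sets and accuracies: the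
  topology that \<open>B\<close> induces on \<open>X\<close> need not be Hausdorff and never has to
  be formed.\<close>

definition conjugate :: "'x set \<Rightarrow> 'y set \<Rightarrow> bool" where
  "conjugate A B \<longleftrightarrow> A \<subseteq> topspace X \<and> B \<subseteq> topspace Y \<and>
    (\<forall>x\<in>topspace X. \<forall>F e. finite F \<longrightarrow> F \<subseteq> B \<longrightarrow> 0 < e \<longrightarrow> (\<exists>a\<in>A. \<forall>b\<in>F. \<bar>\<phi> a b - \<phi> x b\<bar> < e)) \<and>
    (\<forall>y\<in>topspace Y. \<forall>F e. finite F \<longrightarrow> F \<subseteq> A \<longrightarrow> 0 < e \<longrightarrow> (\<exists>b\<in>B. \<forall>a\<in>F. \<bar>\<phi> a b - \<phi> a y\<bar> < e))"

lemma conjugate_subsets: "conjugate A B \<Longrightarrow> A \<subseteq> topspace X" "conjugate A B \<Longrightarrow> B \<subseteq> topspace Y"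
  by (simp_all add: conjugate_def)

lemma conjugate_dense_left:
  "conjugate A B \<Longrightarrow> x \<in> topspace X \<Longrightarrow> finite F \<Longrightarrow> F \<subseteq> B \<Longrightarrow> 0 < e \<Longrightarrow>
    \<exists>a\<in>A. \<forall>b\<in>F. \<bar>\<phi> a b - \<phi> x b\<bar> < e"
  by (simp add: conjugate_def)

lemma conjugate_dense_right:
  "conjugate A B \<Longrightarrow> y \<in> topspace Y \<Longrightarrow> finite F \<Longrightarrow> F \<subseteq> A \<Longrightarrow> 0 < e \<Longrightarrow>
    \<exists>b\<in>B. \<forall>a\<in>F. \<bar>\<phi> a b - \<phi> a y\<bar> < e"
  by (simp add: conjugate_def)

lemma agree_on_closure_left:
  assumes "\<And>a. a \<in> A \<Longrightarrow> \<phi> a y = \<phi> a y'" "x \<in> X closure_of A" "y \<in> topspace Y" "y' \<in> topspace Y"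
  shows "\<phi> x y = \<phi> x y'"
  using forall_in_closure_of_eq[OF assms(2) Hausdorff_space_euclidean cont_left[OF assms(3)] cont_left[OF assms(4)]]
    assms(1) by blast

lemma agree_on_closure_right:
  assumes "\<And>b. b \<in> B \<Longrightarrow> \<phi> x b = \<phi> x' b" "y \<in> Y closure_of B" "x \<in> topspace X" "x' \<in> topspace X"
  shows "\<phi> x y = \<phi> x' y"
  using forall_in_closure_of_eq[OF assms(2) Hausdorff_space_euclidean cont_right[OF assms(3)] cont_right[OF assms(4)]]
    assms(1) by blast

lemma closure_mem: "x \<in> X closure_of A \<Longrightarrow> x \<in> topspace X" "y \<in> Y closure_of B \<Longrightarrow> y \<in> topspace Y"
  by (auto simp: in_closure_of)

lemma conjugate_left_realizes:
  assumes "conjugate A B" "x \<in> topspace X"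
  shows "\<exists>a\<in>X closure_of A. \<forall>b\<in>B. \<phi> a b = \<phi> x b"
  using assms conjugate_subsets[OF assms(1)]
  by (intro closure_of_realizes[OF compact_X, of B "\<lambda>b a. \<phi> a b" A "\<phi> x"] conjugate_dense_left cont_left) auto

lemma conjugate_right_realizes:
  assumes c: "conjugate A B" and y: "y \<in> topspace Y"
  shows "\<exists>b\<in>Y closure_of B. \<forall>a\<in>X closure_of A. \<phi> a b = \<phi> a y"
proof -
  have "\<exists>b\<in>Y closure_of B. \<forall>a\<in>A. \<phi> a b = \<phi> a y"
    using c y conjugate_subsets[OF c]
    by (intro closure_of_realizes[OF compact_Y, of A \<phi> B "\<lambda>a. \<phi> a y"] conjugate_dense_right cont_right) auto
  then show ?thesis using agree_on_closure_left closure_mem y by meson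
qed

text \<open>Every \<open>y\<close> has the same values on the closure of \<open>A\<close> as some
  \<open>b\<close> in the closure of \<open>B\<close>, and there values are determined by those on
  \<open>B\<close>. So \<open>B\<close> alone separates the points of the closure of
  \<open>A\<close>, which makes the retraction well defined.\<close>

lemma conjugate_unique:
  assumes c: "conjugate A B" and a: "a \<in> X closure_of A" "a' \<in> X closure_of A"
    and eq: "\<And>b. b \<in> B \<Longrightarrow> \<phi> a b = \<phi> a' b"
  shows "a = a'"
proof (rule separating)
  show "\<forall>y\<in>topspace Y. \<phi> a y = \<phi> a' y"
  proof
    fix y assume "y \<in> topspace Y"
    then obtain b where "b \<in> Y closure_of B" "\<phi> a b = \<phi> a y" "\<phi> a' b = \<phi> a' y"
      using conjugate_right_realizes[OF c] a by blast
    then show "\<phi> a y = \<phi> a' y"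
      using agree_on_closure_right[of B a a' b] eq a closure_mem by metis
  qed
qed (use a closure_mem in auto)

definition ret :: "'x set \<Rightarrow> 'y set \<Rightarrow> 'x \<Rightarrow> 'x" where
  "ret A B x = (SOME a. a \<in> X closure_of A \<and> (\<forall>b\<in>B. \<phi> a b = \<phi> x b))"

context
  fixes A B assumes c: "conjugate A B"
begin

lemma ret_closure: "x \<in> topspace X \<Longrightarrow> ret A B x \<in> X closure_of A"
  and ret_eq: "x \<in> topspace X \<Longrightarrow> b \<in> B \<Longrightarrow> \<phi> (ret A B x) b = \<phi> x b"
  using someI_ex[of "\<lambda>a. a \<in> X closure_of A \<and> (\<forall>b\<in>B. \<phi> a b = \<phi> x b)"] conjugate_left_realizes[OF c]
  unfolding ret_def by blast+

lemma ret_topspace: "x \<in> topspace X \<Longrightarrow> ret A B x \<in> topspace X"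
  using ret_closure closure_mem by blast

lemma ret_eq_closure:
  assumes "x \<in> topspace X" "b \<in> Y closure_of B"
  shows "\<phi> (ret A B x) b = \<phi> x b"
  using agree_on_closure_right[OF ret_eq[OF assms(1)] assms(2)] ret_topspace assms by blast

text \<open>The adjoint of the retraction: evaluating at \<open>y\<close> after retracting is
  evaluating at a point \<open>b\<close>. Continuity of the retraction and its nonexpansiveness for
  the sup distance over \<open>Y\<close> both follow.\<close>

lemma ret_dual:
  assumes "y \<in> topspace Y"
  shows "\<exists>b\<in>Y closure_of B. (\<forall>x\<in>topspace X. \<phi> (ret A B x) y = \<phi> x b) \<and> (\<forall>a\<in>A. \<phi> a b = \<phi> a y)"
proof -
  obtain b where b: "b \<in> Y closure_of B" "\<forall>a\<in>X closure_of A. \<phi> a b = \<phi> a y"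
    using conjugate_right_realizes[OF c assms] by blast
  then have "\<phi> (ret A B x) y = \<phi> x b" if "x \<in> topspace X" for x
    using ret_closure ret_eq_closure that by metis
  moreover have "A \<subseteq> X closure_of A"
    using c unfolding conjugate_def by (simp add: closure_of_subset)
  ultimately show ?thesis using b by blast
qed

lemma ret_continuous: "continuous_map X X (ret A B)"
proof (rule continuous_map_into_compact_space[OF compact_X, of "(\<lambda>y x. \<phi> x y) ` topspace Y"])
  fix f assume "f \<in> (\<lambda>y x. \<phi> x y) ` topspace Y"
  then obtain y where y: "y \<in> topspace Y" "f = (\<lambda>x. \<phi> x y)" by blast
  obtain b where "b \<in> Y closure_of B" "\<forall>x\<in>topspace X. \<phi> (ret A B x) y = \<phi> x b"
    using ret_dual[OF y(1)] by blast
  then show "continuous_map X euclideanreal (\<lambda>z. f (ret A B z))"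
    using continuous_map_eq[OF cont_left[of b]] closure_mem y by auto
qed (use cont_left separating ret_topspace in \<open>auto simp: image_iff\<close>)

lemma ret_agree:
  assumes "x \<in> topspace X" "x' \<in> topspace X" "\<And>b. b \<in> B \<Longrightarrow> \<phi> x b = \<phi> x' b"
  shows "ret A B x = ret A B x'"
  using assms ret_eq ret_closure by (intro conjugate_unique[OF c]) auto

lemma ret_agreeD:
  assumes "ret A B x = ret A B x'" "x \<in> topspace X" "x' \<in> topspace X" "b \<in> B"
  shows "\<phi> x b = \<phi> x' b"
  using ret_eq assms by metis

end

section \<open>Conjugate pairs generated by countable witnesses\<close>

abbreviation carrier :: "('x + 'y) set" where
  "carrier \<equiv> topspace X <+> topspace Y"

text \<open>A pair of sets is coded as one subset of the disjoint sum, so that a single finite set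
  \<open>F\<close> can constrain both sides. The density clauses are imposed for finite
  \<open>F\<close> inside the carrier; any other \<open>F\<close> is served by the empty set, which
  makes \<open>wit\<close> total.\<close>

definition witnesses :: "('x + 'y) set \<Rightarrow> ('x + 'y) set \<Rightarrow> bool" where
  "witnesses F D \<longleftrightarrow> countable D \<and> D \<subseteq> carrier \<and>
    (finite F \<longrightarrow> F \<subseteq> carrier \<longrightarrow>
      (\<forall>x\<in>topspace X. \<forall>e>0. \<exists>a. Inl a \<in> D \<and> (\<forall>b. Inr b \<in> F \<longrightarrow> \<bar>\<phi> a b - \<phi> x b\<bar> < e)) \<and>
      (\<forall>y\<in>topspace Y. \<forall>e>0. \<exists>b. Inr b \<in> D \<and> (\<forall>a. Inl a \<in> F \<longrightarrow> \<bar>\<phi> a b - \<phi> a y\<bar> < e)))"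

lemma witnesses_exist: "\<exists>D. witnesses F D"
proof (cases "finite F \<and> F \<subseteq> carrier")
  case True
  then have fin: "finite (Inr -` F)" "finite (Inl -` F)"
    by (auto intro!: finite_vimageI)
  obtain D E where D: "D \<subseteq> topspace X" "countable D"
      "\<forall>x\<in>topspace X. \<forall>e>0. \<exists>a\<in>D. \<forall>b\<in>Inr -` F. \<bar>\<phi> a b - \<phi> x b\<bar> < e"
    and E: "E \<subseteq> topspace Y" "countable E"
      "\<forall>y\<in>topspace Y. \<forall>e>0. \<exists>b\<in>E. \<forall>a\<in>Inl -` F. \<bar>\<phi> a b - \<phi> a y\<bar> < e"
    using countable_approximating_subset[OF fin(1), of "topspace X" "\<lambda>b a. \<phi> a b"]
      countable_approximating_subset[OF fin(2), of "topspace Y" \<phi>] by blast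
  have "\<exists>a. Inl a \<in> D <+> E \<and> (\<forall>b. Inr b \<in> F \<longrightarrow> \<bar>\<phi> a b - \<phi> x b\<bar> < e)"
    if xe: "x \<in> topspace X" "0 < e" for x e
  proof -
    obtain a where "a \<in> D" "\<forall>b\<in>Inr -` F. \<bar>\<phi> a b - \<phi> x b\<bar> < e" using D(3) xe by meson
    then show ?thesis by (intro exI[of _ a]) auto
  qed
  moreover have "\<exists>b. Inr b \<in> D <+> E \<and> (\<forall>a. Inl a \<in> F \<longrightarrow> \<bar>\<phi> a b - \<phi> a y\<bar> < e)"
    if ye: "y \<in> topspace Y" "0 < e" for y e
  proof -
    obtain b where "b \<in> E" "\<forall>a\<in>Inl -` F. \<bar>\<phi> a b - \<phi> a y\<bar> < e" using E(3) ye by meson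
    then show ?thesis by (intro exI[of _ b]) auto
  qed
  ultimately have "witnesses F (D <+> E)"
    unfolding witnesses_def using D(1,2) E(1,2) by auto
  then show ?thesis ..
qed (auto simp: witnesses_def intro!: exI[of _ "{}"])

definition wit :: "('x + 'y) set \<Rightarrow> ('x + 'y) set" where
  "wit F = (SOME D. witnesses F D)"

lemma wit: "witnesses F (wit F)"
  unfolding wit_def using witnesses_exist by (rule someI_ex)

lemma wit_carrier: "wit F \<subseteq> carrier" and countable_wit: "countable (wit F)"
  using wit[of F] unfolding witnesses_def by simp_all

lemma wit_dense_left:
  "finite F \<Longrightarrow> F \<subseteq> carrier \<Longrightarrow> x \<in> topspace X \<Longrightarrow> 0 < e \<Longrightarrow>
    \<exists>a. Inl a \<in> wit F \<and> (\<forall>b. Inr b \<in> F \<longrightarrow> \<bar>\<phi> a b - \<phi> x b\<bar> < e)"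
  using wit[of F] unfolding witnesses_def by simp

lemma wit_dense_right:
  "finite F \<Longrightarrow> F \<subseteq> carrier \<Longrightarrow> y \<in> topspace Y \<Longrightarrow> 0 < e \<Longrightarrow>
    \<exists>b. Inr b \<in> wit F \<and> (\<forall>a. Inl a \<in> F \<longrightarrow> \<bar>\<phi> a b - \<phi> a y\<bar> < e)"
  using wit[of F] unfolding witnesses_def by simp

abbreviation full :: "('x + 'y) set \<Rightarrow> bool" where
  "full S \<equiv> S \<subseteq> carrier \<and> finitely_closed wit S"

definition gen :: "('x + 'y) set \<Rightarrow> ('x + 'y) set" where
  "gen T = finitely_closed wit hull T"

lemma full_carrier: "full carrier"
  unfolding finitely_closed_def by (simp add: wit_carrier)

lemma full_gen: "T \<subseteq> carrier \<Longrightarrow> full (gen T)"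
  unfolding gen_def using hull_minimal[of T carrier "finitely_closed wit"] full_carrier
  by (simp only: finitely_closed_hull)

lemma gen_superset: "T \<subseteq> gen T"
  unfolding gen_def by (rule hull_subset)

lemma gen_mono: "T \<subseteq> T' \<Longrightarrow> gen T \<subseteq> gen T'"
  unfolding gen_def by (rule hull_mono)

lemma gen_minimal: "T \<subseteq> S \<Longrightarrow> finitely_closed wit S \<Longrightarrow> gen T \<subseteq> S"
  unfolding gen_def by (rule hull_minimal)

lemma full_conjugate:
  assumes "full S"
  shows "conjugate (Inl -` S) (Inr -` S)"
  unfolding conjugate_def
proof (intro conjI ballI allI impI)
  fix x F and e :: real
  assume x: "x \<in> topspace X" and F: "finite F" "F \<subseteq> Inr -` S" and e: "0 < e"
  have "finite (Inr ` F)" "Inr ` F \<subseteq> S" using F by auto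
  then have "wit (Inr ` F) \<subseteq> S" using assms unfolding finitely_closed_def by blast
  moreover have "\<exists>a. Inl a \<in> wit (Inr ` F) \<and> (\<forall>b\<in>F. \<bar>\<phi> a b - \<phi> x b\<bar> < e)"
    using wit_dense_left[of "Inr ` F" x e] F x e subset_trans[OF \<open>Inr ` F \<subseteq> S\<close>] assms by auto
  ultimately show "\<exists>a\<in>Inl -` S. \<forall>b\<in>F. \<bar>\<phi> a b - \<phi> x b\<bar> < e" by blast
next
  fix y F and e :: real
  assume y: "y \<in> topspace Y" and F: "finite F" "F \<subseteq> Inl -` S" and e: "0 < e"
  have "finite (Inl ` F)" "Inl ` F \<subseteq> S" using F by auto
  then have "wit (Inl ` F) \<subseteq> S" using assms unfolding finitely_closed_def by blast
  moreover have "\<exists>b. Inr b \<in> wit (Inl ` F) \<and> (\<forall>a\<in>F. \<bar>\<phi> a b - \<phi> a y\<bar> < e)"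
    using wit_dense_right[of "Inl ` F" y e] F y e subset_trans[OF \<open>Inl ` F \<subseteq> S\<close>] assms by auto
  ultimately show "\<exists>b\<in>Inr -` S. \<forall>a\<in>F. \<bar>\<phi> a b - \<phi> a y\<bar> < e" by blast
next
  show "Inl -` S \<subseteq> topspace X" "Inr -` S \<subseteq> topspace Y" using assms by auto
qed

abbreviation proj :: "('x + 'y) set \<Rightarrow> 'x \<Rightarrow> 'x" where
  "proj S \<equiv> ret (Inl -` S) (Inr -` S)"

text \<open>Otherwise the increments at a strictly increasing sequence of indices would yield pairs
  \<open>(u, v)\<close> that \<open>x\<close> keeps apart but all earlier stages identify. By compactness of
  \<open>Y \<times> Y\<close> there is a limit pair, and the union of the stages identifies \<open>u\<close> with \<open>v\<close>, hence
  so does the projection of \<open>x\<close>.\<close>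

lemma finite_large_increments:
  fixes r :: "'c rel"
  assumes r: "Well_order r" and P: "\<And>a. a \<in> Field r \<Longrightarrow> full (P a)" and M: "\<And>a. a \<in> Field r \<Longrightarrow> full (M a)"
    and mono: "\<And>a b. (a, b) \<in> r \<Longrightarrow> a \<noteq> b \<Longrightarrow> P a \<subseteq> M b" and MP: "\<And>a. a \<in> Field r \<Longrightarrow> M a \<subseteq> P a"
    and x: "x \<in> topspace X" and e: "0 < e"
  shows "finite {a \<in> Field r. \<exists>y\<in>topspace Y. \<bar>\<phi> (proj (P a) x) y - \<phi> (proj (M a) x) y\<bar> > e}"
proof (rule ccontr)
  assume "infinite {a \<in> Field r. \<exists>y\<in>topspace Y. \<bar>\<phi> (proj (P a) x) y - \<phi> (proj (M a) x) y\<bar> > e}"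
  from well_order_infinite_imp_sequence[OF r this]
  obtain a :: "nat \<Rightarrow> 'c" where a: "\<And>n. a n \<in> Field r"
      "\<And>n. \<exists>y\<in>topspace Y. \<bar>\<phi> (proj (P (a n)) x) y - \<phi> (proj (M (a n)) x) y\<bar> > e"
      "\<And>n. (a n, a (Suc n)) \<in> r \<and> a n \<noteq> a (Suc n)"
    by blast
  have PM: "P (a n) \<subseteq> M (a (Suc n))" and MPa: "M (a n) \<subseteq> P (a n)" for n
    using mono a MP by blast+
  have incP: "P (a m) \<subseteq> P (a n)" if "m \<le> n" for m n
    using lift_Suc_mono_le[of "\<lambda>n. P (a n)" m n] PM MPa that by blast
  define T where "T = (\<Union>n. P (a n))"
  have "P (a m) \<subseteq> P (a n) \<or> P (a n) \<subseteq> P (a m)" for m n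
    using incP nat_le_linear by blast
  then have "finitely_closed wit T"
    unfolding T_def using P a(1) by (intro finitely_closed_chain_Union) auto
  moreover have "T \<subseteq> carrier" unfolding T_def using P a(1) by blast
  ultimately have cT: "conjugate (Inl -` T) (Inr -` T)" by (intro full_conjugate) simp
  have cP: "conjugate (Inl -` P (a n)) (Inr -` P (a n))" and cM: "conjugate (Inl -` M (a n)) (Inr -` M (a n))" for n
    using full_conjugate P M a(1) by blast+
  define cl where "cl = Y closure_of (Inr -` T)"
  define D where "D = {p \<in> topspace (prod_topology Y Y). \<bar>\<phi> x (fst p) - \<phi> x (snd p)\<bar> \<in> {e..}} \<inter> (cl \<times> cl)"
  define C where "C n = D \<inter> {p \<in> topspace (prod_topology Y Y). \<forall>b\<in>Inl -` P (a n). \<phi> b (fst p) - \<phi> b (snd p) = 0}" for n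
  have cont: "continuous_map (prod_topology Y Y) euclideanreal (\<lambda>p. \<phi> b (fst p) - \<phi> b (snd p))"
    if "b \<in> topspace X" for b
    using continuous_map_compose[OF continuous_map_fst cont_right[OF that], of Y]
      continuous_map_compose[OF continuous_map_snd cont_right[OF that], of Y]
    by (intro continuous_map_diff) (simp_all add: comp_def)
  have "closedin (prod_topology Y Y) {p \<in> topspace (prod_topology Y Y). \<bar>\<phi> x (fst p) - \<phi> x (snd p)\<bar> \<in> {e..}}"
    using cont[OF x] by (intro closedin_continuous_map_preimage[where Y = euclideanreal] continuous_map_real_abs) auto
  moreover have "closedin (prod_topology Y Y) (cl \<times> cl)"
    by (simp add: cl_def closedin_prod_Times_iff)
  ultimately have closedD: "closedin (prod_topology Y Y) D"
    unfolding D_def by (rule closedin_Int)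
  have "(\<Inter>n. C n) \<noteq> {}"
  proof (rule compact_space_imp_nest)
    show "compact_space (prod_topology Y Y)" using compact_Y by (simp add: compact_space_prod_topology)
    show "closedin (prod_topology Y Y) (C n)" for n
      unfolding C_def
    proof (intro closedin_Int closedD closedin_Collect_eq_zero cont)
      show "b \<in> topspace X" if "b \<in> Inl -` P (a n)" for b
        using that conjugate_subsets(1)[OF cP] by blast
    qed
    show "decseq C" unfolding decseq_def C_def using incP by blast
    show "C n \<noteq> {}" for n
    proof -
      obtain y where y: "y \<in> topspace Y" "\<bar>\<phi> (proj (P (a (Suc n))) x) y - \<phi> (proj (M (a (Suc n))) x) y\<bar> > e"
        using a(2) by blast
      \<comment> \<open>\<open>u\<close> and \<open>v\<close> are the dual points of the same
        \<open>y\<close> for the two pairs at index \<open>Suc n\<close>. They agree with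
        \<open>y\<close>, hence with each other, on the left part of \<open>M (a (Suc n))\<close>,
        which contains that of \<open>P (a n)\<close>: hence the shift by one.\<close>
      obtain u where u: "u \<in> Y closure_of (Inr -` P (a (Suc n)))" "\<phi> (proj (P (a (Suc n))) x) y = \<phi> x u"
          "\<forall>b\<in>Inl -` P (a (Suc n)). \<phi> b u = \<phi> b y"
        using ret_dual[OF cP y(1)] x by blast
      obtain v where v: "v \<in> Y closure_of (Inr -` M (a (Suc n)))" "\<phi> (proj (M (a (Suc n))) x) y = \<phi> x v"
          "\<forall>b\<in>Inl -` M (a (Suc n)). \<phi> b v = \<phi> b y"
        using ret_dual[OF cM y(1)] x by blast
      have "Inr -` P (a (Suc n)) \<subseteq> Inr -` T" "Inr -` M (a (Suc n)) \<subseteq> Inr -` T"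
        using MPa unfolding T_def by blast+
      then have "u \<in> cl" "v \<in> cl"
        using u(1) v(1) closure_of_mono unfolding cl_def by blast+
      moreover have "\<phi> b u = \<phi> b v" if "b \<in> Inl -` P (a n)" for b
        using that u(3) v(3) PM[of n] MPa[of "Suc n"] by (auto simp: subset_iff)
      moreover have "u \<in> topspace Y" "v \<in> topspace Y" using u(1) v(1) closure_mem by auto
      ultimately have "(u, v) \<in> C n"
        using y(2) u(2) v(2) unfolding C_def D_def by auto
      then show ?thesis by blast
    qed
  qed
  then obtain u v where uv: "\<And>n. (u, v) \<in> C n" by auto
  then have uv': "u \<in> cl" "v \<in> cl" "e \<le> \<bar>\<phi> x u - \<phi> x v\<bar>" unfolding C_def D_def by auto
  have eqT: "\<phi> b u = \<phi> b v" if "b \<in> Inl -` T" for b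
    using that uv unfolding T_def C_def by auto
  have "u \<in> topspace Y" "v \<in> topspace Y"
    using uv'(1,2) closure_mem(2) unfolding cl_def by blast+
  then have "\<phi> (proj T x) u = \<phi> (proj T x) v"
    using agree_on_closure_left[OF eqT ret_closure[OF cT x]] by blast
  \<comment> \<open>On \<open>cl\<close> the projection of \<open>x\<close> has the same values as
    \<open>x\<close>; this is why the limit pair was kept in \<open>cl \<times> cl\<close>.\<close>
  then have "\<phi> x u = \<phi> x v"
    using ret_eq_closure[OF cT x, of u] ret_eq_closure[OF cT x, of v] uv'(1,2) unfolding cl_def by simp
  then show False using uv'(3) e by simp
qed

text \<open>Nonexpansive for the distance given by the supremum of
  \<open>\<bar>\<phi> x y - \<phi> x' y\<bar>\<close> over \<open>y\<close>. This is the link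
  between the increments of the retractions, which are measured by \<open>\<phi>\<close>, and the
  functions built from them.\<close>

definition sup_lipschitz :: "('x \<Rightarrow> real) \<Rightarrow> bool" where
  "sup_lipschitz \<mu> \<longleftrightarrow> (\<forall>x\<in>topspace X. \<forall>x'\<in>topspace X. \<forall>e.
    (\<forall>y\<in>topspace Y. \<bar>\<phi> x y - \<phi> x' y\<bar> \<le> e) \<longrightarrow> \<bar>\<mu> x - \<mu> x'\<bar> \<le> e)"

text \<open>For each \<open>n\<close> the values on \<open>\<Phi> n\<close> map a point of
  \<open>X\<close> into \<open>c\<^sub>0\<close>; countably many such maps are allowed so that a
  countable pair can spread its functions over different \<open>n\<close>. Separation is asked on
  \<open>C\<close> alone, because the induction composes the functions of a smaller pair with
  retractions.\<close>

definition separating_system :: "'x set \<Rightarrow> (nat \<Rightarrow> ('x \<Rightarrow> real) set) \<Rightarrow> bool" where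
  "separating_system C \<Phi> \<longleftrightarrow> (\<forall>n. \<forall>\<mu>\<in>\<Phi> n. continuous_map X euclideanreal \<mu> \<and> sup_lipschitz \<mu>) \<and>
    (\<forall>n. \<forall>x\<in>topspace X. \<forall>e>0. finite {\<mu> \<in> \<Phi> n. \<bar>\<mu> x\<bar> > e}) \<and>
    (\<forall>x\<in>C. \<forall>x'\<in>C. (\<forall>n. \<forall>\<mu>\<in>\<Phi> n. \<mu> x = \<mu> x') \<longrightarrow> x = x')"

text \<open>An enumeration of \<open>B\<close> puts at most one function into each
  \<open>\<Phi> n\<close>, so finiteness is automatic; separation is
  \<open>conjugate_unique\<close>.\<close>

lemma ex_separating_system_countable:
  assumes c: "conjugate A B" and B: "countable B"
  shows "\<exists>\<Phi>. separating_system (X closure_of A) \<Phi>"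
proof -
  define \<Phi> where "\<Phi> n = (\<lambda>b x. \<phi> x b) ` {b \<in> B. to_nat_on B b = n}" for n
  have BY: "B \<subseteq> topspace Y" using conjugate_subsets[OF c] by blast
  have "separating_system (X closure_of A) \<Phi>"
    unfolding separating_system_def
  proof (intro conjI allI ballI impI)
    fix n \<mu> assume "\<mu> \<in> \<Phi> n"
    then obtain b where b: "b \<in> B" "\<mu> = (\<lambda>x. \<phi> x b)" unfolding \<Phi>_def by auto
    show "continuous_map X euclideanreal \<mu>" using b BY cont_left by auto
    show "sup_lipschitz \<mu>" using b BY unfolding sup_lipschitz_def by auto
  next
    fix n x and e :: real
    have "inj_on (to_nat_on B) {b \<in> B. to_nat_on B b = n}"
      using inj_on_to_nat_on[OF B] by (rule inj_on_subset) auto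
    then have "finite {b \<in> B. to_nat_on B b = n}"
      by (rule inj_on_finite[of _ _ "{n}"]) auto
    then have "finite (\<Phi> n)" unfolding \<Phi>_def by blast
    then show "finite {\<mu> \<in> \<Phi> n. \<bar>\<mu> x\<bar> > e}" by simp
  next
    fix x x' assume x: "x \<in> X closure_of A" "x' \<in> X closure_of A" and eq: "\<forall>n. \<forall>\<mu>\<in>\<Phi> n. \<mu> x = \<mu> x'"
    have "\<phi> x b = \<phi> x' b" if "b \<in> B" for b
    proof -
      have "(\<lambda>x. \<phi> x b) \<in> \<Phi> (to_nat_on B b)" unfolding \<Phi>_def using that by blast
      from bspec[OF spec[OF eq] this] show ?thesis by simp
    qed
    then show "x = x'" using conjugate_unique[OF c] x by blast
  qed
  then show ?thesis by (intro exI)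
qed

lemma sup_lipschitz_ret:
  assumes c: "conjugate A B" and \<mu>: "sup_lipschitz \<mu>"
  shows "sup_lipschitz (\<lambda>x. \<mu> (ret A B x))"
  unfolding sup_lipschitz_def
proof (intro ballI allI impI)
  fix x x' e
  assume x: "x \<in> topspace X" "x' \<in> topspace X" and le: "\<forall>y\<in>topspace Y. \<bar>\<phi> x y - \<phi> x' y\<bar> \<le> e"
  have "\<bar>\<phi> (ret A B x) y - \<phi> (ret A B x') y\<bar> \<le> e" if y: "y \<in> topspace Y" for y
  proof -
    obtain b where "b \<in> topspace Y" "\<forall>x\<in>topspace X. \<phi> (ret A B x) y = \<phi> x b"
      using ret_dual[OF c y] closure_mem by blast
    then show ?thesis using le x by simp
  qed
  then show "\<bar>\<mu> (ret A B x) - \<mu> (ret A B x')\<bar> \<le> e"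
    using \<mu> ret_topspace[OF c] x unfolding sup_lipschitz_def by blast
qed

lemma continuous_map_ret:
  assumes "conjugate A B" "continuous_map X euclideanreal \<mu>"
  shows "continuous_map X euclideanreal (\<lambda>x. \<mu> (ret A B x))"
  using continuous_map_compose[OF ret_continuous[OF assms(1)] assms(2)] by (simp add: comp_def)

lemma card_of_gen:
  assumes "|T| <o |S|" "uncountable S"
  shows "|gen T| <o |S|"
proof (cases "finite T")
  case True
  then have "|T| \<le>o |UNIV :: nat set|"
    by (simp add: countable_card_of_nat[symmetric] countable_finite)
  then have "|gen T| \<le>o |UNIV :: nat set|"
    unfolding gen_def by (intro card_of_finitely_closed_hull countable_wit) auto
  moreover have "|UNIV :: nat set| <o |S|"
    using assms(2) by (simp add: countable_card_of_nat flip: not_ordLeq_iff_ordLess[OF card_of_Well_order card_of_Well_order])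
  ultimately show ?thesis by (rule ordLeq_ordLess_trans)
next
  case False
  have "|gen T| \<le>o |T|"
    unfolding gen_def using False by (intro card_of_finitely_closed_hull countable_wit) (simp_all add: ordLeq_refl card_of_Card_order)
  then show ?thesis using assms(1) by (rule ordLeq_ordLess_trans)
qed

lemma countable_gen_empty: "countable (gen {})"
proof -
  have "|gen {}| \<le>o |UNIV :: nat set|"
    unfolding gen_def by (intro card_of_finitely_closed_hull countable_wit) (auto simp: card_of_empty)
  then show ?thesis by (simp add: countable_card_of_nat)
qed

text \<open>\<open>S\<close> is indexed by itself in the order type of its cardinal, so all pairs
  generated by proper initial segments are smaller than \<open>S\<close>. The countable pair
  \<open>gen {}\<close> contributes its own functions: it is the value of \<open>M\<close> at the
  least index, and its retraction starts the transfinite induction that proves separation.\<close>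

lemma ex_separating_system_uncountable:
  assumes S: "full S" "uncountable S"
    and IH: "\<And>T. full T \<Longrightarrow> |T| <o |S| \<Longrightarrow> \<exists>\<Phi>. separating_system (X closure_of (Inl -` T)) \<Phi>"
  shows "\<exists>\<Phi>. separating_system (X closure_of (Inl -` S)) \<Phi>"
proof -
  define r where "r = |S|"
  have card: "Card_order r" and Field: "Field r = S" unfolding r_def by (rule card_of_Card_order, rule Field_card_of)
  have wo: "Well_order r" using card by (simp add: card_order_on_def)
  have wor: "wo_rel r" using wo by (simp add: wo_rel_def)
  define P where "P a = gen (insert a (underS r a))" for a
  define M where "M a = gen (underS r a)" for a
  have underS_sub: "underS r a \<subseteq> S" for a using Order_Relation.underS_Field[of r a] Field by simp
  have fP: "full (P a)" and fM: "full (M a)" if "a \<in> S" for a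
    unfolding P_def M_def using that underS_sub[of a] S(1) by (intro full_gen; auto)+
  have f0: "full (gen {})" by (rule full_gen) simp
  have chain: "insert a (underS r a) \<subseteq> underS r b" if "(a, b) \<in> r" "a \<noteq> b" for a b
    using that wo_rel.TRANS[OF wor] wo_rel.ANTISYM[OF wor] unfolding underS_def trans_def antisym_def by auto
  have mono: "P a \<subseteq> M b" if "(a, b) \<in> r" "a \<noteq> b" for a b
    unfolding P_def M_def using chain[OF that] by (rule gen_mono)
  have MP: "M a \<subseteq> P a" and NP: "gen {} \<subseteq> P a" for a
    unfolding P_def M_def by (intro gen_mono; blast)+
  have cardP: "|P a| <o |S|" if aS: "a \<in> S" for a
  proof -
    \<comment> \<open>An infinite cardinal has no last element: with some \<open>b\<close> above
      \<open>a\<close>, the segment up to \<open>a\<close> sits inside the segment below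
      \<open>b\<close>, which is smaller than \<open>S\<close>.\<close>
    have "infinite S" using S(2) countable_finite by blast
    then obtain b where b: "b \<in> S" "(a, b) \<in> r" "a \<noteq> b"
      using infinite_Card_order_limit[OF card] aS Field by metis
    have "|insert a (underS r a)| \<le>o |underS r b|"
      using chain[OF b(2,3)] by (rule card_of_mono1)
    moreover have "|underS r b| <o |S|"
      using card_of_underS[OF card] b(1) Field unfolding r_def by simp
    ultimately show ?thesis
      unfolding P_def using S(2) by (intro card_of_gen) (rule ordLeq_ordLess_trans)
  qed
  have "\<forall>a\<in>S. \<exists>\<Phi>. separating_system (X closure_of (Inl -` P a)) \<Phi>"
    using IH fP cardP by blast
  then obtain \<Phi> where \<Phi>: "\<And>a. a \<in> S \<Longrightarrow> separating_system (X closure_of (Inl -` P a)) (\<Phi> a)"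
    by metis
  have cP: "conjugate (Inl -` P a) (Inr -` P a)" and cM: "conjugate (Inl -` M a) (Inr -` M a)" if "a \<in> S" for a
    using full_conjugate fP fM that by blast+
  have c0: "conjugate (Inl -` gen {}) (Inr -` gen {})" using full_conjugate f0 by blast
  have "countable (Inr ` (Inr -` gen {}) :: ('x + 'y) set)"
    using countable_gen_empty by (rule countable_subset[rotated]) blast
  then have "countable (Inr -` gen {})" by (rule countable_image_inj_on) simp
  then obtain \<Phi>0 where \<Phi>0: "separating_system (X closure_of (Inl -` gen {})) \<Phi>0"
    using ex_separating_system_countable[OF c0] by blast
  \<comment> \<open>A difference of two nonexpansive functions is only 2-Lipschitz; the factor 1/2
    restores the invariant for the next cardinality.\<close>
  define \<nu> where "\<nu> a \<mu> = (\<lambda>x. (1/2) * (\<mu> (proj (P a) x) - \<mu> (proj (M a) x)))" for a and \<mu> :: "'x \<Rightarrow> real"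
  define \<Psi> where "\<Psi> n = (\<lambda>\<mu> x. \<mu> (proj (gen {}) x)) ` \<Phi>0 n \<union> (\<Union>a\<in>S. \<nu> a ` \<Phi> a n)" for n
  have \<nu>: "continuous_map X euclideanreal (\<nu> a \<mu>)" "sup_lipschitz (\<nu> a \<mu>)" if a: "a \<in> S" and "\<mu> \<in> \<Phi> a n" for a \<mu> n
  proof -
    have \<mu>: "continuous_map X euclideanreal \<mu>" "sup_lipschitz \<mu>" using \<Phi>[OF a] that unfolding separating_system_def by blast+
    show "continuous_map X euclideanreal (\<nu> a \<mu>)"
      unfolding \<nu>_def
      by (intro continuous_map_real_mult_left continuous_map_diff continuous_map_ret cP cM a \<mu>(1))
    have l: "sup_lipschitz (\<lambda>x. \<mu> (proj (P a) x))" "sup_lipschitz (\<lambda>x. \<mu> (proj (M a) x))"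
      by (intro sup_lipschitz_ret cP cM a \<mu>(2))+
    show "sup_lipschitz (\<nu> a \<mu>)"
      unfolding sup_lipschitz_def
    proof (intro ballI allI impI)
      fix x x' e assume "x \<in> topspace X" "x' \<in> topspace X" "\<forall>y\<in>topspace Y. \<bar>\<phi> x y - \<phi> x' y\<bar> \<le> e"
      then have "\<bar>\<mu> (proj (P a) x) - \<mu> (proj (P a) x')\<bar> \<le> e" "\<bar>\<mu> (proj (M a) x) - \<mu> (proj (M a) x')\<bar> \<le> e"
        using l unfolding sup_lipschitz_def by blast+
      then show "\<bar>\<nu> a \<mu> x - \<nu> a \<mu> x'\<bar> \<le> e" unfolding \<nu>_def by (simp add: abs_le_iff field_simps)
    qed
  qed
  have "separating_system (X closure_of (Inl -` S)) \<Psi>"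
    unfolding separating_system_def
  proof (intro conjI allI ballI impI)
    fix n \<mu> assume "\<mu> \<in> \<Psi> n"
    then consider \<mu>' where "\<mu>' \<in> \<Phi>0 n" "\<mu> = (\<lambda>x. \<mu>' (proj (gen {}) x))"
      | a \<mu>' where "a \<in> S" "\<mu>' \<in> \<Phi> a n" "\<mu> = \<nu> a \<mu>'"
      unfolding \<Psi>_def by auto
    then have "continuous_map X euclideanreal \<mu> \<and> sup_lipschitz \<mu>"
    proof cases
      case 1
      then have "continuous_map X euclideanreal \<mu>'" "sup_lipschitz \<mu>'" using \<Phi>0 unfolding separating_system_def by blast+
      then show ?thesis using 1(2) continuous_map_ret[OF c0] sup_lipschitz_ret[OF c0] by simp
    qed (simp add: \<nu>)
    then show "continuous_map X euclideanreal \<mu>" "sup_lipschitz \<mu>" by blast+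
  next
    fix n x and e :: real
    assume x: "x \<in> topspace X" and e: "0 < e"
    \<comment> \<open>\<open>\<bar>\<nu> a \<mu> x\<bar> > e\<close> forces an increment above
      \<open>e\<close> at \<open>a\<close>, by the Lipschitz bound, and so \<open>a \<in> E\<close>;
      and it forces one of the two values of \<open>\<mu>\<close> above \<open>e\<close> in absolute
      value, which for each \<open>a\<close> leaves finitely many \<open>\<mu>\<close>.\<close>
    define E where "E = {a \<in> Field r. \<exists>y\<in>topspace Y. \<bar>\<phi> (proj (P a) x) y - \<phi> (proj (M a) x) y\<bar> > e}"
    have E: "finite E"
      unfolding E_def using wo fP fM mono MP x e Field by (intro finite_large_increments) auto
    define G where "G a = \<nu> a ` ({\<mu> \<in> \<Phi> a n. \<bar>\<mu> (proj (P a) x)\<bar> > e} \<union> {\<mu> \<in> \<Phi> a n. \<bar>\<mu> (proj (M a) x)\<bar> > e})" for a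
    define G0 where "G0 = (\<lambda>\<mu> x. \<mu> (proj (gen {}) x)) ` {\<mu> \<in> \<Phi>0 n. \<bar>\<mu> (proj (gen {}) x)\<bar> > e}"
    have "finite (G a)" if "a \<in> E" for a
    proof -
      have a: "a \<in> S" using that Field unfolding E_def by blast
      have "proj (P a) x \<in> topspace X" "proj (M a) x \<in> topspace X"
        using ret_topspace cP[OF a] cM[OF a] x by blast+
      then show ?thesis using \<Phi>[OF a] e unfolding G_def separating_system_def by blast
    qed
    moreover have "finite G0"
      using \<Phi>0 e ret_topspace[OF c0 x] unfolding G0_def separating_system_def by blast
    moreover have "{\<mu> \<in> \<Psi> n. \<bar>\<mu> x\<bar> > e} \<subseteq> G0 \<union> (\<Union>a\<in>E. G a)"
    proof
      fix \<mu> assume \<mu>: "\<mu> \<in> {\<mu> \<in> \<Psi> n. \<bar>\<mu> x\<bar> > e}"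
      then consider \<mu>' where "\<mu>' \<in> \<Phi>0 n" "\<mu> = (\<lambda>x. \<mu>' (proj (gen {}) x))"
        | a \<mu>' where "a \<in> S" "\<mu>' \<in> \<Phi> a n" "\<mu> = \<nu> a \<mu>'"
        unfolding \<Psi>_def by auto
      then show "\<mu> \<in> G0 \<union> (\<Union>a\<in>E. G a)"
      proof cases
        case 1
        then show ?thesis using \<mu> unfolding G0_def by auto
      next
        case 2
        have l: "sup_lipschitz \<mu>'" using \<Phi>[OF 2(1)] 2(2) unfolding separating_system_def by blast
        have big: "e < (1/2) * \<bar>\<mu>' (proj (P a) x) - \<mu>' (proj (M a) x)\<bar>"
          using \<mu> 2(3) unfolding \<nu>_def by (simp add: abs_mult)
        have "a \<in> E"
        proof (rule ccontr)
          assume "a \<notin> E"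
          then have "\<forall>y\<in>topspace Y. \<bar>\<phi> (proj (P a) x) y - \<phi> (proj (M a) x) y\<bar> \<le> e"
            using 2(1) Field unfolding E_def by auto
          then have "\<bar>\<mu>' (proj (P a) x) - \<mu>' (proj (M a) x)\<bar> \<le> e"
            using l ret_topspace[OF cP[OF 2(1)] x] ret_topspace[OF cM[OF 2(1)] x] unfolding sup_lipschitz_def by blast
          moreover have "False" if "t \<le> e" "e < (1/2) * t" for t :: real using that e by linarith
          ultimately show False using big by blast
        qed
        moreover have "e < \<bar>\<mu>' (proj (P a) x)\<bar> \<or> e < \<bar>\<mu>' (proj (M a) x)\<bar>"
        proof -
          have "e < s \<or> e < t" if "e < (1/2) * d" "d \<le> s + t" for d s t :: real
            using that by linarith
          then show ?thesis using big abs_triangle_ineq4 by blast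
        qed
        then have "\<mu> \<in> G a" unfolding G_def using 2 by blast
        ultimately show ?thesis by blast
      qed
    qed
    ultimately show "finite {\<mu> \<in> \<Psi> n. \<bar>\<mu> x\<bar> > e}"
      using E by (meson finite_UN_I finite_UnI finite_subset)
  next
    fix x x' assume xC: "x \<in> X closure_of (Inl -` S)" "x' \<in> X closure_of (Inl -` S)"
      and eq: "\<forall>n. \<forall>\<mu>\<in>\<Psi> n. \<mu> x = \<mu> x'"
    have x: "x \<in> topspace X" "x' \<in> topspace X" using xC closure_mem by auto
    have "\<mu> (proj (gen {}) x) = \<mu> (proj (gen {}) x')" if "\<mu> \<in> \<Phi>0 n" for \<mu> n
    proof -
      have "(\<lambda>x. \<mu> (proj (gen {}) x)) \<in> \<Psi> n" unfolding \<Psi>_def using that by blast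
      from bspec[OF spec[OF eq] this] show ?thesis by simp
    qed
    then have eq0: "proj (gen {}) x = proj (gen {}) x'"
      using \<Phi>0 ret_closure[OF c0] x unfolding separating_system_def by blast
    \<comment> \<open>Transfinite induction on \<open>a\<close>: equal projections at the earlier
      stages give equal values on the right part of \<open>M a\<close>, hence equal projections
      there. Then equality of \<open>\<nu> a \<mu>\<close> becomes equality of \<open>\<mu>\<close>
      at the projections to \<open>P a\<close>, and the functions \<open>\<Phi> a\<close> separate
      the closure in which these projections lie.\<close>
    have eqP: "a \<in> S \<longrightarrow> proj (P a) x = proj (P a) x'" for a
    proof (induction a rule: wo_rel.well_order_induct[OF wor])
      case (1 a)
      show ?case
      proof
        assume a: "a \<in> S"
        \<comment> \<open>There may be no earlier stage; \<open>gen {}\<close>, contained in each of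
          them, makes the chain nonempty.\<close>
        define \<D> where "\<D> = insert (gen {}) (P ` underS r a)"
        have "finitely_closed wit (\<Union>\<D>)"
        proof (rule finitely_closed_chain_Union)
          show "finitely_closed wit T" if "T \<in> \<D>" for T
            using that f0 fP underS_sub[of a] unfolding \<D>_def by auto
          show "T \<subseteq> T' \<or> T' \<subseteq> T" if TT: "T \<in> \<D>" "T' \<in> \<D>" for T T'
          proof -
            have "P b \<subseteq> P c \<or> P c \<subseteq> P b" if "b \<in> underS r a" "c \<in> underS r a" for b c
            proof (cases "b = c")
              case False
              then have "(b, c) \<in> r \<or> (c, b) \<in> r"
                using wo_rel.TOTALS[OF wor] that Order_Relation.underS_Field[of r a] by blast
              then show ?thesis using mono MP False by (metis subset_trans)
            qed simp
            then show ?thesis using TT unfolding \<D>_def by (elim insertE imageE) (use NP in simp_all)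
          qed
        qed (simp add: \<D>_def)
        moreover have "b \<in> P b" for b unfolding P_def using gen_superset by blast
        then have "underS r a \<subseteq> \<Union>\<D>" unfolding \<D>_def by blast
        ultimately have "M a \<subseteq> \<Union>\<D>" unfolding M_def by (intro gen_minimal)
        have eqB: "\<phi> x b = \<phi> x' b" if b: "b \<in> Inr -` M a" for b
        proof -
          consider "b \<in> Inr -` gen {}" | c where "c \<in> underS r a" "b \<in> Inr -` P c"
            using b \<open>M a \<subseteq> \<Union>\<D>\<close> unfolding \<D>_def by blast
          then show ?thesis
          proof cases
            case 1
            then show ?thesis using ret_agreeD[OF c0 eq0 x] by blast
          next
            case (2 c)
            then have "c \<in> S" using underS_sub by blast
            moreover have "proj (P c) x = proj (P c) x'"
              using 1 2(1) \<open>c \<in> S\<close> unfolding underS_def by blast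
            ultimately show ?thesis using ret_agreeD[OF cP _ x 2(2)] by blast
          qed
        qed
        have eqM: "proj (M a) x = proj (M a) x'"
          using ret_agree[OF cM[OF a] x] eqB by blast
        have "\<mu> (proj (P a) x) = \<mu> (proj (P a) x')" if "\<mu> \<in> \<Phi> a n" for \<mu> n
        proof -
          have "\<nu> a \<mu> \<in> \<Psi> n" unfolding \<Psi>_def using that a by blast
          from bspec[OF spec[OF eq] this] show ?thesis using eqM unfolding \<nu>_def by simp
        qed
        then show "proj (P a) x = proj (P a) x'"
          using \<Phi>[OF a] ret_closure[OF cP[OF a]] x unfolding separating_system_def by blast
      qed
    qed
    \<comment> \<open>Each element of \<open>S\<close> is itself an index and belongs to its own
      stage, so the equal projections determine all values on the right part of
      \<open>S\<close>.\<close>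
    have "\<phi> x b = \<phi> x' b" if b: "b \<in> Inr -` S" for b
    proof -
      have bS: "Inr b \<in> S" using b by simp
      have "Inr b \<in> P (Inr b)" unfolding P_def using gen_superset by blast
      then have "b \<in> Inr -` P (Inr b)" by simp
      then show ?thesis using ret_agreeD[OF cP[OF bS] _ x] eqP bS by blast
    qed
    then show "x = x'"
      using conjugate_unique[OF full_conjugate[OF S(1)]] xC by blast
  qed
  then show ?thesis by (intro exI)
qed

lemma ex_separating_system:
  assumes "full S"
  shows "\<exists>\<Phi>. separating_system (X closure_of (Inl -` S)) \<Phi>"
  using assms
proof (induction "|S|" arbitrary: S rule: wf_induct_rule[OF wf_ordLess])
  case (1 S)
  show ?case
  proof (cases "countable S")
    case True
    have "countable (Inr ` (Inr -` S) :: ('x + 'y) set)"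
      using True by (rule countable_subset[rotated]) blast
    then have "countable (Inr -` S)" by (rule countable_image_inj_on) simp
    then show ?thesis using ex_separating_system_countable full_conjugate[OF 1(2)] by blast
  next
    case False
    show ?thesis
    proof (rule ex_separating_system_uncountable[OF 1(2) False])
      show "\<exists>\<Phi>. separating_system (X closure_of (Inl -` T)) \<Phi>" if "full T" "|T| <o |S|" for T
        using 1(1) that by blast
    qed
  qed
qed

theorem sigma_point_finite_separating_functions:
  shows "\<exists>\<Phi> :: nat \<Rightarrow> ('x \<Rightarrow> real) set. (\<forall>n. \<forall>\<mu>\<in>\<Phi> n. continuous_map X euclideanreal \<mu>) \<and>
    (\<forall>n. \<forall>x\<in>topspace X. \<forall>e>0. finite {\<mu> \<in> \<Phi> n. \<bar>\<mu> x\<bar> > e}) \<and>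
    (\<forall>x\<in>topspace X. \<forall>x'\<in>topspace X. (\<forall>n. \<forall>\<mu>\<in>\<Phi> n. \<mu> x = \<mu> x') \<longrightarrow> x = x')"
proof -
  have "Inl -` carrier = topspace X" by auto
  then have "X closure_of (Inl -` carrier) = topspace X" by (simp add: closure_of_topspace)
  then obtain \<Phi> where "separating_system (topspace X) \<Phi>" using ex_separating_system[OF full_carrier] by auto
  then show ?thesis by (intro exI[of _ \<Phi>]) (simp add: separating_system_def)
qed

end

section \<open>Almost subbases from families of functions\<close>

lemma zero_setI:
  assumes "continuous_map X euclideanreal f"
  shows "{x \<in> topspace X. f x = 0} \<in> zero_sets X"
proof -
  have "continuous_map X (top_of_set {0..1}) (\<lambda>x. min 1 \<bar>f x\<bar>)"
    using assms unfolding continuous_map_in_subtopology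
    by (simp add: continuous_map_real_min continuous_map_real_abs Pi_iff)
  moreover have "{x \<in> topspace X. f x = 0} = {x \<in> topspace X. min 1 \<bar>f x\<bar> = 0}"
    by (auto simp: min_def)
  ultimately show ?thesis unfolding zero_sets_def by (intro CollectI exI conjI)
qed

lemma cozero_setI:
  assumes "continuous_map X euclideanreal f"
  shows "{x \<in> topspace X. f x \<noteq> 0} \<in> cozero_sets X"
proof -
  have "{x \<in> topspace X. f x \<noteq> 0} = topspace X - {x \<in> topspace X. f x = 0}" by auto
  then show ?thesis using zero_setI[OF assms] unfolding zero_sets_def cozero_sets_def by auto
qed

text \<open>For \<open>k = 2 * m + 1\<close> and \<open>k = 2 * m\<close> the condition compares the
  maximum of finitely many \<open>h i\<close> with \<open>1 / (m + 1)\<close>. Passing from odd to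
  even lowers the threshold; passing from even to odd relaxes the strict inequality and admits one
  more function. So one increasing sequence exhausts the points where some \<open>h i\<close> is
  positive, with a continuous maximum at every level.\<close>

definition level_sets :: "'a topology \<Rightarrow> (nat \<Rightarrow> 'a \<Rightarrow> real) \<Rightarrow> nat \<Rightarrow> 'a set" where
  "level_sets X h k =
    (if odd k then {x \<in> topspace X. \<exists>i\<le>Suc (k div 2). 1 / real (Suc (k div 2)) \<le> h i x}
     else {x \<in> topspace X. \<exists>i\<le>k div 2. 1 / real (Suc (k div 2)) < h i x})"

lemma continuous_map_Max_atMost:
  assumes "\<And>i. continuous_map X euclideanreal (h i)"
  shows "continuous_map X euclideanreal (\<lambda>x. Max ((\<lambda>i. h i x) ` {..m :: nat}))"
proof (induction m)
  case (Suc m)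
  have "(\<lambda>x. Max ((\<lambda>i. h i x) ` {..Suc m})) = (\<lambda>x. max (h (Suc m) x) (Max ((\<lambda>i. h i x) ` {..m})))"
    by (simp add: atMost_Suc)
  then show ?case using Suc assms by (simp add: continuous_map_real_max)
qed (use assms in simp)

lemma U_representation_level_sets:
  assumes h: "\<And>i. continuous_map X euclideanreal (h i)"
  shows "U_representation X {x \<in> topspace X. \<exists>i. 0 < h i x} (level_sets X h)"
  unfolding U_representation_def
proof (intro conjI allI impI)
  show "{x \<in> topspace X. \<exists>i. 0 < h i x} = (\<Union>k\<in>{1..}. level_sets X h k)"
  proof (intro equalityI subsetI)
    fix x assume "x \<in> {x \<in> topspace X. \<exists>i. 0 < h i x}"
    then obtain i where x: "x \<in> topspace X" "0 < h i x" by blast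
    obtain m where m: "1 / real (Suc m) < h i x" using nat_approx_posE[OF x(2)] by blast
    define l where "l = max i m"
    have "1 / real (Suc l) \<le> 1 / real (Suc m)" unfolding l_def by (intro divide_left_mono) auto
    then have "x \<in> level_sets X h (2 * l + 1)"
      using x m unfolding level_sets_def by (auto intro!: exI[of _ i] simp: l_def)
    moreover have "2 * l + 1 \<in> {1..}" by simp
    ultimately show "x \<in> (\<Union>k\<in>{1..}. level_sets X h k)" by (rule UN_I[rotated])
  next
    fix x assume "x \<in> (\<Union>k\<in>{1..}. level_sets X h k)"
    then obtain k where x: "x \<in> level_sets X h k" by blast
    then obtain i where "1 / real (Suc (k div 2)) \<le> h i x"
      unfolding level_sets_def by (auto split: if_splits intro: less_imp_le)
    moreover have "0 < 1 / real (Suc (k div 2))" by simp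
    ultimately have "0 < h i x" by (rule less_le_trans[rotated])
    then show "x \<in> {x \<in> topspace X. \<exists>i. 0 < h i x}"
      using x unfolding level_sets_def by (auto split: if_splits)
  qed
next
  fix k :: nat assume "1 \<le> k"
  show "level_sets X h k \<subseteq> level_sets X h (k + 1)"
  proof (cases "odd k")
    case True
    then have d: "(k + 1) div 2 = Suc (k div 2)" by presburger
    have "1 / real (Suc (Suc (k div 2))) < 1 / real (Suc (k div 2))" by (intro divide_strict_left_mono) auto
    then show ?thesis using True unfolding level_sets_def d by (auto intro: less_le_trans)
  next
    case False
    then have d: "(k + 1) div 2 = k div 2" by presburger
    show ?thesis using False unfolding level_sets_def d by (auto intro: less_imp_le le_SucI)
  qed
  \<comment> \<open>The levels \<open>2 * k - 1\<close> and \<open>2 * k\<close> admit the same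
    functions \<open>h 0, ..., h k\<close> and differ in strictness and threshold,
    \<open>1 / k\<close> against \<open>1 / (k + 1)\<close>, so one maximum describes both.\<close>
  define m where "m x = Max ((\<lambda>i. h i x) ` {..k})" for x
  have m: "continuous_map X euclideanreal m"
    unfolding m_def using h by (rule continuous_map_Max_atMost)
  have d: "(2 * k - 1) div 2 = k - 1" "odd (2 * k - 1)" "Suc (k - 1) = k" using \<open>1 \<le> k\<close> by presburger+
  have "level_sets X h (2 * k - 1) = {x \<in> topspace X. 1 / real k \<le> m x}"
    unfolding level_sets_def m_def using d by (auto simp: Max_ge_iff)
  also have "\<dots> = {x \<in> topspace X. max 0 (1 / real k - m x) = 0}" by (auto simp: max_def)
  also have "\<dots> \<in> zero_sets X"
    by (intro zero_setI continuous_map_real_max continuous_map_diff m) auto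
  finally show "level_sets X h (2 * k - 1) \<in> zero_sets X" .
  have "level_sets X h (2 * k) = {x \<in> topspace X. 1 / real (Suc k) < m x}"
    unfolding level_sets_def m_def by (auto simp: Max_gr_iff)
  also have "\<dots> = {x \<in> topspace X. max 0 (m x - 1 / real (Suc k)) \<noteq> 0}" by (auto simp: max_def)
  also have "\<dots> \<in> cozero_sets X"
    by (intro cozero_setI continuous_map_real_max continuous_map_diff m) auto
  finally show "level_sets X h (2 * k) \<in> cozero_sets X" .
qed

lemma is_subbaseI:
  assumes op: "\<And>S. S \<in> \<S> \<Longrightarrow> openin X S"
    and nbhd: "\<And>U x. openin X U \<Longrightarrow> x \<in> U \<Longrightarrow>
      \<exists>\<H>. finite \<H> \<and> \<H> \<subseteq> \<S> \<and> (\<forall>S\<in>\<H>. x \<in> S) \<and> topspace X \<inter> \<Inter>\<H> \<subseteq> U"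
  shows "is_subbase X \<S>"
proof -
  define T where "T = topology (arbitrary union_of (finite intersection_of (\<lambda>U. U \<in> \<S>) relative_to topspace X))"
  have sub: "\<S> \<subseteq> Pow (topspace X)" using op openin_subset by blast
  have T: "openin T S" if "S \<in> \<S>" for S
    unfolding T_def openin_subbase using that sub
    by (intro arbitrary_union_of_inc relative_to_subset_inc finite_intersection_of_inc) auto
  have top: "topspace T = topspace X" unfolding T_def by simp
  have "openin X U \<longleftrightarrow> openin T U" for U
  proof
    assume U: "openin X U"
    show "openin T U"
    proof (subst openin_subopen, intro ballI)
      fix x assume x: "x \<in> U"
      obtain \<H> where H: "finite \<H>" "\<H> \<subseteq> \<S>" "\<forall>S\<in>\<H>. x \<in> S" "topspace X \<inter> \<Inter>\<H> \<subseteq> U"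
        using nbhd[OF U x] by blast
      have "openin T (topspace T \<inter> \<Inter>\<H>)" using H T by (intro openin_Int_Inter) auto
      moreover have "x \<in> topspace T \<inter> \<Inter>\<H>" using H x openin_subset[OF U] top by auto
      ultimately show "\<exists>V. openin T V \<and> x \<in> V \<and> V \<subseteq> U" using H(4) top by auto
    qed
  next
    assume "openin T U"
    then show "openin X U" unfolding T_def
      by (intro minimal_topology_subbase[of "\<lambda>U. U \<in> \<S>" X "topspace X" U]) (auto intro: op)
  qed
  then have "X = T" by (simp add: topology_eq)
  then show ?thesis unfolding is_subbase_def using sub T_def by simp
qed

text \<open>Different pairs \<open>(f, q)\<close> may define the same set \<open>{f > q}\<close>, but an almost subbase has to
  choose a single U-representation of it. Since only countably many pairs define a given nonempty
  set, the representation can be taken from all of them at once.\<close>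

lemma almost_subbase_of_functions:
  fixes F :: "('a \<Rightarrow> real) set"
  assumes cont: "\<And>f. f \<in> F \<Longrightarrow> continuous_map X euclideanreal f"
    and nonneg: "\<And>f x. f \<in> F \<Longrightarrow> x \<in> topspace X \<Longrightarrow> 0 \<le> f x"
    and initial: "\<And>U x. openin X U \<Longrightarrow> x \<in> U \<Longrightarrow>
      \<exists>G e. finite G \<and> G \<subseteq> F \<and> 0 < e \<and> (\<forall>z\<in>topspace X. (\<forall>f\<in>G. \<bar>f z - f x\<bar> < e) \<longrightarrow> z \<in> U)"
    and countable: "\<And>x. x \<in> topspace X \<Longrightarrow> countable {f \<in> F. 0 < f x}"
  shows "almost_subbase X {{x \<in> topspace X. q < f x} | f q. f \<in> F \<and> q \<in> \<rat> \<and> 0 < q}"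
proof -
  define \<alpha> where "\<alpha> = {{x \<in> topspace X. q < f x} | f q. f \<in> F \<and> q \<in> \<rat> \<and> 0 < q}"
  define R where "R V = {(f, q). f \<in> F \<and> q \<in> \<rat> \<and> 0 < q \<and> V = {x \<in> topspace X. q < f x}}" for V
  \<comment> \<open>The pairs defining a nonempty \<open>V\<close> can be enumerated, because
    \<open>f\<close> is positive at any point of \<open>V\<close>. For the empty set they need not
    be countable; the constant \<open>-1\<close> then gives empty level sets.\<close>
  define h where "h V i = (if V = {} then (\<lambda>x. -1) else (\<lambda>x. fst (from_nat_into (R V) i) x - snd (from_nat_into (R V) i)))"
    for V and i :: nat
  have R_ne: "R V \<noteq> {}" if "V \<in> \<alpha>" for V using that unfolding \<alpha>_def R_def by auto
  have R_countable: "countable (R V)" if "V \<noteq> {}" for V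
  proof (cases "V \<subseteq> topspace X")
    case True
    obtain x where x: "x \<in> V" using \<open>V \<noteq> {}\<close> by blast
    have "R V \<subseteq> {f \<in> F. 0 < f x} \<times> \<rat>"
      using x unfolding R_def by (auto intro: less_trans)
    moreover have "x \<in> topspace X" using x True by blast
    then have "countable ({f \<in> F. 0 < f x} \<times> (\<rat> :: real set))"
      using countable by (intro countable_SIGMA) (auto simp: countable_rat)
    ultimately show ?thesis by (rule countable_subset)
  next
    case False
    then have "R V = {}" unfolding R_def by auto
    then show ?thesis by simp
  qed
  have Rmem: "from_nat_into (R V) i \<in> R V" if "V \<in> \<alpha>" for V i
    using R_ne[OF that] by (rule from_nat_into)
  have h_cont: "continuous_map X euclideanreal (h V i)" if "V \<in> \<alpha>" for V i
    using Rmem[OF that, of i] cont unfolding h_def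
    by (auto simp: R_def split: prod.splits intro!: continuous_map_diff)
  have h_pos: "0 < h V i x \<longleftrightarrow> x \<in> V" if "V \<in> \<alpha>" "x \<in> topspace X" for V i x
    using Rmem[OF that(1), of i] that(2) unfolding h_def R_def by (auto split: prod.splits)
  have U: "U_representation X V (level_sets X (h V))" if V: "V \<in> \<alpha>" for V
  proof -
    have "V = {x \<in> topspace X. \<exists>i. 0 < h V i x}"
      using h_pos[OF V] V unfolding \<alpha>_def by auto
    then show ?thesis using U_representation_level_sets[of X "h V"] h_cont[OF V] by simp
  qed
  define \<S> where "\<S> = \<alpha> \<union> {topspace X - level_sets X (h V) (2 * k - 1) | V k. V \<in> \<alpha> \<and> 1 \<le> k}"
  have "is_subbase X \<S>"
  proof (rule is_subbaseI)
    fix S assume "S \<in> \<S>"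
    then consider "S \<in> \<alpha>" | V k where "V \<in> \<alpha>" "1 \<le> k" "S = topspace X - level_sets X (h V) (2 * k - 1)"
      unfolding \<S>_def by auto
    then show "openin X S"
    proof cases
      case 1
      then obtain f q where f: "f \<in> F" "S = {x \<in> topspace X. f x \<in> {q<..}}" unfolding \<alpha>_def by auto
      show ?thesis unfolding f(2)
        using cont[OF f(1)] by (rule openin_continuous_map_preimage) auto
    next
      case 2
      then have "level_sets X (h V) (2 * k - 1) \<in> zero_sets X"
        using U[OF 2(1)] unfolding U_representation_def by blast
      then obtain g :: "'a \<Rightarrow> real" where g: "continuous_map X (top_of_set {0..1}) g"
          "level_sets X (h V) (2 * k - 1) = {x \<in> topspace X. g x = 0}"
        unfolding zero_sets_def by auto
      have "continuous_map X euclideanreal g" using g(1) by (simp add: continuous_map_in_subtopology)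
      then have "closedin X {x \<in> topspace X. g x \<in> {0}}"
        by (rule closedin_continuous_map_preimage) auto
      then show ?thesis unfolding 2(3) g(2) by (intro openin_diff) auto
    qed
  next
    fix U x assume "openin X U" "x \<in> U"
    then have x: "x \<in> topspace X" using openin_subset by blast
    obtain G e where G: "finite G" "G \<subseteq> F" "0 < e"
        "\<forall>z\<in>topspace X. (\<forall>f\<in>G. \<bar>f z - f x\<bar> < e) \<longrightarrow> z \<in> U"
      using initial[OF \<open>openin X U\<close> \<open>x \<in> U\<close>] by blast
    have lower: "\<exists>\<H>. finite \<H> \<and> \<H> \<subseteq> \<S> \<and> (\<forall>S\<in>\<H>. x \<in> S) \<and> (\<forall>z\<in>topspace X \<inter> \<Inter>\<H>. f x - e < f z)"
      if f: "f \<in> F" for f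
    \<comment> \<open>The sets in \<open>\<alpha>\<close> have positive thresholds; where
      \<open>f\<close> vanishes, the lower bound comes from nonnegativity, with no set at
      all.\<close>
    proof (cases "f x = 0")
      case True
      have "\<forall>z\<in>topspace X. f x - e < f z"
        using nonneg[OF f] G(3) True by (auto intro: less_le_trans[of _ 0])
      then show ?thesis by (intro exI[of _ "{}"]) auto
    next
      case False
      then have "max 0 (f x - e) < f x" using nonneg[OF f x] G(3) by auto
      then obtain q where q: "q \<in> \<rat>" "max 0 (f x - e) < q" "q < f x"
        using Rats_dense_in_real by blast
      then have "{x \<in> topspace X. q < f x} \<in> \<S>" unfolding \<S>_def \<alpha>_def using f by auto
      then show ?thesis
        using q x by (intro exI[of _ "{{x \<in> topspace X. q < f x}}"]) (auto intro: less_trans)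
    qed
    have upper: "\<exists>\<H>. finite \<H> \<and> \<H> \<subseteq> \<S> \<and> (\<forall>S\<in>\<H>. x \<in> S) \<and> (\<forall>z\<in>topspace X \<inter> \<Inter>\<H>. f z < f x + e)"
      if f: "f \<in> F" for f
    proof -
      obtain q where q: "q \<in> \<rat>" "f x < q" "q < f x + e"
        using Rats_dense_in_real[of "f x" "f x + e"] G(3) by auto
      have q0: "0 < q" using nonneg[OF f x] q(2) by (rule le_less_trans)
      define V where "V = {x \<in> topspace X. q < f x}"
      have V: "V \<in> \<alpha>" unfolding \<alpha>_def V_def using f q(1) q0 by blast
      have xV: "x \<notin> V" unfolding V_def using q by auto
      show ?thesis
      proof (cases "V = {}")
        case True
        then have "\<forall>z\<in>topspace X. f z < f x + e"
          unfolding V_def using q(3) by (auto simp: not_less intro: le_less_trans)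
        then show ?thesis by (intro exI[of _ "{}"]) auto
      next
        case False
        have "(f, q) \<in> R V" unfolding R_def V_def using f q(1) q0 by auto
        then obtain i where i: "from_nat_into (R V) i = (f, q)"
          using from_nat_into_surj[OF R_countable[OF False]] by blast
        obtain m where m: "1 / real (Suc m) < f x + e - q"
          using nat_approx_posE[of "f x + e - q"] q(3) by auto
        \<comment> \<open>The level must be late enough to admit the function with index
          \<open>i\<close>, which is \<open>f - q\<close>, and to have its threshold below the
          remaining room \<open>f x + e - q\<close>. \<open>2 * Suc l - 1\<close> is the odd index
          with parameter \<open>l\<close>; outside that level set \<open>f\<close> stays below
          \<open>f x + e\<close>.\<close>
        define l where "l = max i m"
        have l: "1 / real (Suc l) < f x + e - q"
          using m unfolding l_def by (rule le_less_trans[rotated]) (intro divide_left_mono; auto)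
        define S where "S = topspace X - level_sets X (h V) (2 * Suc l - 1)"
        have S: "S = {z \<in> topspace X. \<forall>i\<le>Suc l. h V i z < 1 / real (Suc l)}"
          unfolding S_def level_sets_def by (auto simp: not_le)
        have "S \<in> \<S>" unfolding \<S>_def S_def using V by force
        moreover have "h V i x < 1 / real (Suc l)" for i
          using h_pos[OF V x, of i] xV by (auto simp: not_less intro: le_less_trans)
        then have "x \<in> S" unfolding S using x by blast
        moreover have "f z < f x + e" if "z \<in> S" for z
        proof -
          have "h V i z < 1 / real (Suc l)" using that unfolding S l_def by auto
          moreover have "h V i z = f z - q" unfolding h_def i using False by simp
          ultimately show ?thesis using l by linarith
        qed
        ultimately show ?thesis by (intro exI[of _ "{S}"]) auto
      qed
    qed
    have "\<forall>f\<in>F. \<exists>\<H>. finite \<H> \<and> \<H> \<subseteq> \<S> \<and> (\<forall>S\<in>\<H>. x \<in> S) \<and> (\<forall>z\<in>topspace X \<inter> \<Inter>\<H>. \<bar>f z - f x\<bar> < e)"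
    proof
      fix f assume f: "f \<in> F"
      obtain \<H>1 where H1: "finite \<H>1" "\<H>1 \<subseteq> \<S>" "\<forall>S\<in>\<H>1. x \<in> S" "\<forall>z\<in>topspace X \<inter> \<Inter>\<H>1. f x - e < f z"
        using lower[OF f] by (elim exE conjE) (rule that)
      obtain \<H>2 where H2: "finite \<H>2" "\<H>2 \<subseteq> \<S>" "\<forall>S\<in>\<H>2. x \<in> S" "\<forall>z\<in>topspace X \<inter> \<Inter>\<H>2. f z < f x + e"
        using upper[OF f] by (elim exE conjE) (rule that)
      have "\<bar>f z - f x\<bar> < e" if z: "z \<in> topspace X \<inter> \<Inter>(\<H>1 \<union> \<H>2)" for z
      proof -
        have "f x - e < f z" "f z < f x + e" using z H1(4) H2(4) by blast+
        then show ?thesis by (simp add: abs_less_iff)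
      qed
      then show "\<exists>\<H>. finite \<H> \<and> \<H> \<subseteq> \<S> \<and> (\<forall>S\<in>\<H>. x \<in> S) \<and> (\<forall>z\<in>topspace X \<inter> \<Inter>\<H>. \<bar>f z - f x\<bar> < e)"
        using H1(1-3) H2(1-3) by (intro exI[of _ "\<H>1 \<union> \<H>2"] conjI ballI) auto
    qed
    from bchoice[OF this] obtain H where H: "\<forall>f\<in>F. finite (H f) \<and> H f \<subseteq> \<S> \<and> (\<forall>S\<in>H f. x \<in> S) \<and>
        (\<forall>z\<in>topspace X \<inter> \<Inter>(H f). \<bar>f z - f x\<bar> < e)" ..
    show "\<exists>\<H>. finite \<H> \<and> \<H> \<subseteq> \<S> \<and> (\<forall>S\<in>\<H>. x \<in> S) \<and> topspace X \<inter> \<Inter>\<H> \<subseteq> U"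
    proof (intro exI conjI)
      show "finite (\<Union>f\<in>G. H f)" "(\<Union>f\<in>G. H f) \<subseteq> \<S>" "\<forall>S\<in>\<Union>f\<in>G. H f. x \<in> S"
        using G H by auto
      show "topspace X \<inter> \<Inter>(\<Union>f\<in>G. H f) \<subseteq> U"
      proof
        fix z assume z: "z \<in> topspace X \<inter> \<Inter>(\<Union>f\<in>G. H f)"
        have "\<bar>f z - f x\<bar> < e" if "f \<in> G" for f
        proof -
          have "f \<in> F" "z \<in> topspace X \<inter> \<Inter>(H f)" using that z G(2) by blast+
          then show ?thesis using bspec[OF H] by blast
        qed
        then show "z \<in> U" using G(4) z by blast
      qed
    qed
  qed
  then have "almost_subbase X \<alpha>"
    unfolding almost_subbase_def \<S>_def using U
    by (intro conjI exI[of _ "\<lambda>V. level_sets X (h V)"]) (auto simp: \<alpha>_def)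
  then show ?thesis unfolding \<alpha>_def .
qed

section \<open>Superlevel sets of functions on a compact space\<close>

lemma sigma_familyE:
  assumes "sigma_family P \<alpha>"
  obtains \<G> :: "nat \<Rightarrow> 'a set set" where "\<alpha> = (\<Union>i. \<G> i)" "\<And>i. P (\<G> i)"
  using assms unfolding sigma_family_def by blast

lemma sigma_familyI:
  assumes "countable I" "I \<noteq> {}" "\<And>i. i \<in> I \<Longrightarrow> P (G i)"
  shows "sigma_family P (\<Union>i\<in>I. G i)"
proof -
  have "(\<Union>i\<in>I. G i) = (\<Union>n. G (from_nat_into I n))"
    using range_from_nat_into[OF assms(2,1)] by (metis image_image)
  moreover have "P (G (from_nat_into I n))" for n
    using assms(3) from_nat_into[OF assms(2)] by blast
  ultimately show ?thesis unfolding sigma_family_def by blast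
qed

definition superlevel_sets :: "'a topology \<Rightarrow> ('a \<Rightarrow> 'k) \<Rightarrow> ('k \<Rightarrow> real) set \<Rightarrow> real \<Rightarrow> 'a set set" where
  "superlevel_sets X j F q = (\<lambda>f. {x \<in> topspace X. q < f (j x)}) ` F"

lemma embeds_in_almost_subbase:
  assumes K: "compact_space K" and X: "embeds_in X K"
    and cont: "\<And>f. f \<in> F \<Longrightarrow> continuous_map K euclideanreal f"
    and nonneg: "\<And>f x. f \<in> F \<Longrightarrow> x \<in> topspace K \<Longrightarrow> 0 \<le> f x"
    and sep: "\<And>x y. x \<in> topspace K \<Longrightarrow> y \<in> topspace K \<Longrightarrow> \<forall>f\<in>F. f x = f y \<Longrightarrow> x = y"
    and countable: "\<And>x. x \<in> topspace K \<Longrightarrow> countable {f \<in> F. 0 < f x}"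
  shows "\<exists>j. (\<forall>x\<in>topspace X. j x \<in> topspace K) \<and>
    almost_subbase X (\<Union>q\<in>\<rat> \<inter> {0<..}. superlevel_sets X j F q)"
proof -
  obtain S where S: "S \<subseteq> topspace K" "X homeomorphic_space subtopology K S"
    using X unfolding embeds_in_def by blast
  obtain j where j: "homeomorphic_map X (subtopology K S) j"
    using S(2) by (auto simp: homeomorphic_space)
  have jc: "continuous_map X K j"
    using homeomorphic_imp_continuous_map[OF j] by (simp add: continuous_map_in_subtopology)
  have jK: "j x \<in> topspace K" if "x \<in> topspace X" for x
    using jc that unfolding continuous_map_def by blast
  have jS: "j x \<in> S" if "x \<in> topspace X" for x
    using homeomorphic_imp_surjective_map[OF j] that by auto
  have inj: "inj_on j (topspace X)" by (rule homeomorphic_imp_injective_map[OF j])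
  define F' where "F' = (\<lambda>f x. f (j x)) ` F"
  have "almost_subbase X {{x \<in> topspace X. q < f x} | f q. f \<in> F' \<and> q \<in> \<rat> \<and> 0 < q}"
  proof (rule almost_subbase_of_functions)
    fix f assume "f \<in> F'"
    then obtain g where g: "g \<in> F" "f = (\<lambda>x. g (j x))" unfolding F'_def by blast
    show "continuous_map X euclideanreal f"
      using continuous_map_compose[OF jc cont[OF g(1)]] g(2) by (simp add: comp_def)
    show "0 \<le> f x" if "x \<in> topspace X" for x using g nonneg jK that by simp
  next
    fix x assume "x \<in> topspace X"
    then have "countable {f \<in> F. 0 < f (j x)}" using countable jK by blast
    then have "countable ((\<lambda>f x. f (j x)) ` {f \<in> F. 0 < f (j x)})" by (rule countable_image)
    moreover have "{f \<in> F'. 0 < f x} = (\<lambda>f x. f (j x)) ` {f \<in> F. 0 < f (j x)}"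
      unfolding F'_def by auto
    ultimately show "countable {f \<in> F'. 0 < f x}" by simp
  next
    fix U x assume U: "openin X U" and xU: "x \<in> U"
    have UX: "U \<subseteq> topspace X" using U by (rule openin_subset)
    have "openin (subtopology K S) (j ` U)"
      using homeomorphic_map_openness[OF j UX] U by blast
    then obtain V where V: "openin K V" "j ` U = V \<inter> S" unfolding openin_subtopology by blast
    then have "j x \<in> V" using xU by blast
    have "\<exists>G e. finite G \<and> G \<subseteq> F \<and> 0 < e \<and> (\<forall>z\<in>topspace K. (\<forall>f\<in>G. \<bar>f z - f (j x)\<bar> < (e::real)) \<longrightarrow> z \<in> V)"
      using K cont sep V(1) \<open>j x \<in> V\<close> by (rule compact_space_initial)
    then obtain G and e :: real where G: "finite G" "G \<subseteq> F" "0 < e"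
        "\<forall>z\<in>topspace K. (\<forall>f\<in>G. \<bar>f z - f (j x)\<bar> < e) \<longrightarrow> z \<in> V"
      by (elim exE conjE) (rule that)
    have "z \<in> U" if z: "z \<in> topspace X" and le: "\<forall>f\<in>(\<lambda>f x. f (j x)) ` G. \<bar>f z - f x\<bar> < e" for z
    proof -
      have "j z \<in> V" using G(4) jK[OF z] le by auto
      then have "j z \<in> j ` U" using V(2) jS[OF z] by blast
      then show ?thesis using inj z UX by (meson inj_on_image_mem_iff)
    qed
    then show "\<exists>G e. finite G \<and> G \<subseteq> F' \<and> 0 < e \<and> (\<forall>z\<in>topspace X. (\<forall>f\<in>G. \<bar>f z - f x\<bar> < e) \<longrightarrow> z \<in> U)"
      using G(1-3) unfolding F'_def by (intro exI[of _ "(\<lambda>f x. f (j x)) ` G"] exI[of _ e]) auto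
  qed
  moreover have "{{x \<in> topspace X. q < f x} | f q. f \<in> F' \<and> q \<in> \<rat> \<and> 0 < q} =
      (\<Union>q\<in>\<rat> \<inter> {0<..}. superlevel_sets X j F q)"
  proof (intro equalityI subsetI)
    fix S assume "S \<in> {{x \<in> topspace X. q < f x} | f q. f \<in> F' \<and> q \<in> \<rat> \<and> 0 < q}"
    then obtain g q where "g \<in> F" "q \<in> \<rat>" "0 < q" "S = {x \<in> topspace X. q < g (j x)}"
      unfolding F'_def by auto
    then show "S \<in> (\<Union>q\<in>\<rat> \<inter> {0<..}. superlevel_sets X j F q)"
      by (intro UN_I[of q]) (auto simp: superlevel_sets_def)
  next
    fix S assume "S \<in> (\<Union>q\<in>\<rat> \<inter> {0<..}. superlevel_sets X j F q)"
    then obtain g q where "g \<in> F" "q \<in> \<rat>" "0 < q" "S = {x \<in> topspace X. q < g (j x)}"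
      unfolding superlevel_sets_def by auto
    then show "S \<in> {{x \<in> topspace X. q < f x} | f q. f \<in> F' \<and> q \<in> \<rat> \<and> 0 < q}"
      unfolding F'_def by (intro CollectI exI[of _ "\<lambda>x. g (j x)"] exI[of _ q]) auto
  qed
  ultimately show ?thesis using jK by (intro exI[of _ j]) simp
qed

text \<open>The strict inequalities hold at points of \<open>X\<close> for finitely many members at
  a time. Weakened to closed conditions on \<open>K\<close> they have the finite intersection
  property, and a point of \<open>K\<close>, not necessarily from \<open>X\<close>, satisfies all of
  them.\<close>

lemma superlevel_sets_fip:
  assumes K: "compact_space K" and j: "\<And>x. x \<in> topspace X \<Longrightarrow> j x \<in> topspace K"
    and G: "G \<noteq> {}" "\<And>W. W \<in> G \<Longrightarrow> continuous_map K euclideanreal (f W)"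
      "\<And>W. W \<in> G \<Longrightarrow> W = {x \<in> topspace X. q W < f W (j x)}"
    and fip: "\<And>H. finite H \<Longrightarrow> H \<subseteq> G \<Longrightarrow> \<Inter>H \<noteq> {}"
  shows "\<exists>z\<in>topspace K. \<forall>W\<in>G. q W \<le> f W z"
proof -
  define C where "C W = {z \<in> topspace K. f W z \<in> {q W..}}" for W
  have closed: "closedin K (C W)" if "W \<in> G" for W
    unfolding C_def using G(2)[OF that] by (rule closedin_continuous_map_preimage) auto
  have inter: "\<Inter>\<F> \<noteq> {}" if F: "finite \<F>" "\<F> \<subseteq> C ` G" for \<F>
  proof -
    obtain H where H: "finite H" "H \<subseteq> G" "\<F> = C ` H" using finite_subset_image[OF F] by blast
    show ?thesis
    proof (cases "H = {}")
      case False
      obtain x where x: "\<And>W. W \<in> H \<Longrightarrow> x \<in> W" using fip[OF H(1,2)] by blast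
      have "j x \<in> C W" if "W \<in> H" for W
      proof -
        have "W = {x \<in> topspace X. q W < f W (j x)}" using G(3) H(2) that by blast
        then have "x \<in> topspace X \<and> q W < f W (j x)" using x[OF that] by blast
        then show ?thesis unfolding C_def using j by auto
      qed
      then show ?thesis using H(3) by blast
    qed (use H in simp)
  qed
  have "(\<forall>D\<in>C ` G. closedin K D) \<and> (\<forall>\<F>. finite \<F> \<and> \<F> \<subseteq> C ` G \<longrightarrow> \<Inter>\<F> \<noteq> {})"
    using closed inter by simp
  then have "\<Inter>(C ` G) \<noteq> {}"
    by (rule K[unfolded compact_space_fip, THEN spec, THEN mp])
  then obtain z where "\<And>W. W \<in> G \<Longrightarrow> z \<in> C W" by blast
  then show ?thesis using G(1) unfolding C_def by auto
qed

lemma ordIso_natLeq_imp_infinite: "|A| =o natLeq \<Longrightarrow> infinite A"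
  unfolding infinite_iff_card_of_nat
  by (rule ordIso_imp_ordLeq[OF ordIso_transitive[OF card_of_nat ordIso_symmetric]])

lemma ordIso_cardSuc_natLeq_imp_uncountable: "|A| =o cardSuc natLeq \<Longrightarrow> uncountable A"
  unfolding countable_card_le_natLeq
  by (meson cardSuc_greater natLeq_Card_order not_ordLess_ordLeq ordIso_ordLeq_trans ordIso_symmetric)

lemma strongly_point_finite_superlevel_sets:
  assumes K: "compact_space K" and j: "\<And>x. x \<in> topspace X \<Longrightarrow> j x \<in> topspace K"
    and cont: "\<And>f. f \<in> F \<Longrightarrow> continuous_map K euclideanreal f"
    and fin: "\<And>x e. x \<in> topspace K \<Longrightarrow> 0 < e \<Longrightarrow> finite {f \<in> F. e < f x}" and q: "0 < q"
  shows "strongly_point_finite (superlevel_sets X j F q)"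
  unfolding strongly_point_finite_def
proof (intro allI impI, rule ccontr)
  fix G assume G: "G \<subseteq> superlevel_sets X j F q" "|G| =o natLeq"
    and no: "\<not> (\<exists>H\<subseteq>G. finite H \<and> \<Inter>H = {})"
  have inf: "infinite G" using G(2) by (rule ordIso_natLeq_imp_infinite)
  have "\<forall>W\<in>G. \<exists>f. f \<in> F \<and> W = {x \<in> topspace X. q < f (j x)}"
    using G(1) unfolding superlevel_sets_def by blast
  then obtain f where f: "\<And>W. W \<in> G \<Longrightarrow> f W \<in> F" "\<And>W. W \<in> G \<Longrightarrow> W = {x \<in> topspace X. q < f W (j x)}"
    by metis
  have "\<exists>z\<in>topspace K. \<forall>W\<in>G. q \<le> f W z"
    using inf no f cont by (intro superlevel_sets_fip[OF K j]) auto
  then obtain z where z: "z \<in> topspace K" "\<And>W. W \<in> G \<Longrightarrow> q \<le> f W z" by blast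
  \<comment> \<open>The common point satisfies only \<open>q \<le> f W z\<close>, whereas
    \<open>fin\<close> counts strict inequalities: hence \<open>q / 2\<close>.\<close>
  have "f ` G \<subseteq> {f \<in> F. q / 2 < f z}" using f(1) z(2) q by (force intro: less_le_trans[of "q / 2" q])
  then have "finite (f ` G)" using fin[OF z(1), of "q / 2"] q finite_subset by auto
  moreover have "inj_on f G"
  proof (rule inj_onI)
    fix W W' assume W: "W \<in> G" "W' \<in> G" "f W = f W'"
    have "W = {x \<in> topspace X. q < f W (j x)}" using f(2)[OF W(1)] .
    also have "\<dots> = W'" unfolding W(3) using f(2)[OF W(2)] by (rule sym)
    finally show "W = W'" .
  qed
  ultimately show False using inf finite_imageD by blast
qed

text \<open>The thresholds vary here, so a member is coded by a pair \<open>(f, q)\<close>. At the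
  common point \<open>0 < q \<le> f z\<close>, which leaves countably many \<open>f\<close> and
  rational \<open>q\<close>.\<close>

lemma strongly_point_countable_superlevel_sets:
  assumes K: "compact_space K" and j: "\<And>x. x \<in> topspace X \<Longrightarrow> j x \<in> topspace K"
    and cont: "\<And>f. f \<in> F \<Longrightarrow> continuous_map K euclideanreal f"
    and count: "\<And>x. x \<in> topspace K \<Longrightarrow> countable {f \<in> F. 0 < f x}"
  shows "strongly_point_countable (\<Union>q\<in>\<rat> \<inter> {0<..}. superlevel_sets X j F q)"
  unfolding strongly_point_countable_def
proof (intro allI impI, rule ccontr)
  fix G assume G: "G \<subseteq> (\<Union>q\<in>\<rat> \<inter> {0<..}. superlevel_sets X j F q)" "|G| =o cardSuc natLeq"
    and no: "\<not> (\<exists>H\<subseteq>G. finite H \<and> \<Inter>H = {})"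
  have unc: "uncountable G" using G(2) by (rule ordIso_cardSuc_natLeq_imp_uncountable)
  have "\<forall>W\<in>G. \<exists>p. fst p \<in> F \<and> snd p \<in> \<rat> \<and> 0 < snd p \<and> W = {x \<in> topspace X. snd p < fst p (j x)}"
  proof
    fix W assume "W \<in> G"
    then obtain q f where "f \<in> F" "q \<in> \<rat>" "0 < q" "W = {x \<in> topspace X. q < f (j x)}"
      using G(1) unfolding superlevel_sets_def by blast
    then show "\<exists>p. fst p \<in> F \<and> snd p \<in> \<rat> \<and> 0 < snd p \<and> W = {x \<in> topspace X. snd p < fst p (j x)}"
      by (intro exI[of _ "(f, q)"]) simp
  qed
  from bchoice[OF this] obtain p where p: "\<And>W. W \<in> G \<Longrightarrow> fst (p W) \<in> F \<and> snd (p W) \<in> \<rat> \<and> 0 < snd (p W)"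
      "\<And>W. W \<in> G \<Longrightarrow> W = {x \<in> topspace X. snd (p W) < fst (p W) (j x)}"
    by blast
  have "\<exists>z\<in>topspace K. \<forall>W\<in>G. snd (p W) \<le> fst (p W) z"
    using unc no p cont by (intro superlevel_sets_fip[OF K j]) auto
  then obtain z where z: "z \<in> topspace K" "\<And>W. W \<in> G \<Longrightarrow> snd (p W) \<le> fst (p W) z" by blast
  have "p ` G \<subseteq> {f \<in> F. 0 < f z} \<times> \<rat>"
  proof
    fix r assume "r \<in> p ` G"
    then obtain W where W: "W \<in> G" "r = p W" by blast
    have "0 < fst (p W) z" using p(1)[OF W(1)] z(2)[OF W(1)] by linarith
    then show "r \<in> {f \<in> F. 0 < f z} \<times> \<rat>" using p(1)[OF W(1)] W(2) by (auto simp: mem_Times_iff)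
  qed
  moreover have "countable ({f \<in> F. 0 < f z} \<times> (\<rat> :: real set))"
    using count[OF z(1)] by (intro countable_SIGMA) (auto simp: countable_rat)
  ultimately have "countable (p ` G)" by (rule countable_subset)
  moreover have "inj_on p G"
  proof (rule inj_onI)
    fix W W' assume W: "W \<in> G" "W' \<in> G" "p W = p W'"
    have "W = {x \<in> topspace X. snd (p W) < fst (p W) (j x)}" using p(2)[OF W(1)] .
    also have "\<dots> = W'" unfolding W(3) using p(2)[OF W(2)] by (rule sym)
    finally show "W = W'" .
  qed
  ultimately show False using unc countable_image_inj_on by blast
qed

lemma m_boundedly_point_finite_superlevel_sets:
  assumes j: "\<And>x. x \<in> topspace X \<Longrightarrow> j x \<in> topspace K"
    and bound: "\<And>x. x \<in> topspace K \<Longrightarrow> finite {f \<in> F. q < f x} \<and> card {f \<in> F. q < f x} \<le> m"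
  shows "m_boundedly_point_finite m (superlevel_sets X j F q)"
  unfolding m_boundedly_point_finite_def
proof
  fix x
  show "finite {U \<in> superlevel_sets X j F q. x \<in> U} \<and> card {U \<in> superlevel_sets X j F q. x \<in> U} \<le> m"
  proof (cases "x \<in> topspace X")
    case True
    have sub: "{U \<in> superlevel_sets X j F q. x \<in> U} \<subseteq>
        (\<lambda>f. {x \<in> topspace X. q < f (j x)}) ` {f \<in> F. q < f (j x)}"
      unfolding superlevel_sets_def by auto
    have "finite {f \<in> F. q < f (j x)}" "card {f \<in> F. q < f (j x)} \<le> m"
      using bound[OF j[OF True]] by auto
    then show ?thesis
      using sub by (meson card_image_le card_mono finite_imageI finite_subset le_trans)
  next
    case False
    then have empty: "{U \<in> superlevel_sets X j F q. x \<in> U} = {}" unfolding superlevel_sets_def by auto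
    show ?thesis unfolding empty by simp
  qed
qed

lemma countable_positive_support:
  fixes \<Phi> :: "'i::countable \<Rightarrow> ('k \<Rightarrow> real) set"
  assumes "\<And>i e. 0 < e \<Longrightarrow> countable {f \<in> \<Phi> i. e < f x}"
  shows "countable {f \<in> (\<Union>i. \<Phi> i). 0 < f x}"
proof -
  have "{f \<in> (\<Union>i. \<Phi> i). 0 < f x} \<subseteq> (\<Union>i. \<Union>n. {f \<in> \<Phi> i. 1 / real (Suc n) < f x})"
  proof
    fix f assume f: "f \<in> {f \<in> (\<Union>i. \<Phi> i). 0 < f x}"
    then obtain n where "1 / real (Suc n) < f x" using nat_approx_posE[of "f x"] by blast
    then show "f \<in> (\<Union>i. \<Union>n. {f \<in> \<Phi> i. 1 / real (Suc n) < f x})" using f by blast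
  qed
  moreover have "countable (\<Union>i. \<Union>n. {f \<in> \<Phi> i. 1 / real (Suc n) < f x})"
    using assms by (intro countable_UN) auto
  ultimately show ?thesis by (rule countable_subset)
qed

lemma sigma_almost_subbase:
  fixes \<Phi> :: "'i::countable \<Rightarrow> ('k \<Rightarrow> real) set"
  assumes K: "compact_space K" and X: "embeds_in X K"
    and cont: "\<And>i f. f \<in> \<Phi> i \<Longrightarrow> continuous_map K euclideanreal f"
    and nonneg: "\<And>i f x. f \<in> \<Phi> i \<Longrightarrow> x \<in> topspace K \<Longrightarrow> 0 \<le> f x"
    and sep: "\<And>x y. x \<in> topspace K \<Longrightarrow> y \<in> topspace K \<Longrightarrow> \<forall>i. \<forall>f\<in>\<Phi> i. f x = f y \<Longrightarrow> x = y"
    and fin: "\<And>i x e. x \<in> topspace K \<Longrightarrow> 0 < e \<Longrightarrow> finite {f \<in> \<Phi> i. e < f x}"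
    and P: "\<And>i j q. (\<And>x. x \<in> topspace X \<Longrightarrow> j x \<in> topspace K) \<Longrightarrow> 0 < q \<Longrightarrow> P (superlevel_sets X j (\<Phi> i) q)"
  shows "\<exists>\<alpha>. almost_subbase X \<alpha> \<and> sigma_family P \<alpha>"
proof -
  define F where "F = (\<Union>i. \<Phi> i)"
  have "\<exists>j. (\<forall>x\<in>topspace X. j x \<in> topspace K) \<and> almost_subbase X (\<Union>q\<in>\<rat> \<inter> {0<..}. superlevel_sets X j F q)"
  proof (rule embeds_in_almost_subbase[OF K X])
    show "countable {f \<in> F. 0 < f x}" if "x \<in> topspace K" for x
      unfolding F_def using fin[OF that] by (intro countable_positive_support countable_finite)
  qed (use cont nonneg sep in \<open>auto simp: F_def\<close>)
  then obtain j where j: "\<And>x. x \<in> topspace X \<Longrightarrow> j x \<in> topspace K"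
      "almost_subbase X (\<Union>q\<in>\<rat> \<inter> {0<..}. superlevel_sets X j F q)"
    by blast
  define I where "I = (UNIV :: 'i set) \<times> (\<rat> \<inter> {0::real<..})"
  have "(\<Union>q\<in>\<rat> \<inter> {0<..}. superlevel_sets X j F q) = (\<Union>p\<in>I. superlevel_sets X j (\<Phi> (fst p)) (snd p))"
    unfolding F_def superlevel_sets_def I_def by fastforce
  moreover have "sigma_family P (\<Union>p\<in>I. superlevel_sets X j (\<Phi> (fst p)) (snd p))"
  proof (rule sigma_familyI)
    show "countable I" unfolding I_def by (intro countable_SIGMA) (auto intro: countable_subset[OF _ countable_rat])
    have "(undefined, 1) \<in> I" unfolding I_def by simp
    then show "I \<noteq> {}" by blast
    show "P (superlevel_sets X j (\<Phi> (fst p)) (snd p))" if "p \<in> I" for p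
      using that j(1) unfolding I_def by (intro P) auto
  qed
  ultimately show ?thesis using j(2) by auto
qed

section \<open>Subspaces of the four kinds of compacta\<close>

text \<open>Superlevel sets with positive thresholds call for nonnegative functions, so each
  function is split into its positive and negative part, indexed by a boolean. A part exceeds a
  positive \<open>e\<close> only where \<open>\<bar>f\<bar>\<close> does, and distinct functions may
  have equal parts, hence the cardinality bound as an inequality.\<close>

lemma sigma_almost_subbase_signed:
  fixes \<Phi> :: "nat \<Rightarrow> ('k \<Rightarrow> real) set"
  assumes K: "compact_space K" and X: "embeds_in X K"
    and cont: "\<And>i f. f \<in> \<Phi> i \<Longrightarrow> continuous_map K euclideanreal f"
    and sep: "\<And>x y. x \<in> topspace K \<Longrightarrow> y \<in> topspace K \<Longrightarrow> \<forall>i. \<forall>f\<in>\<Phi> i. f x = f y \<Longrightarrow> x = y"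
    and fin: "\<And>i x e. x \<in> topspace K \<Longrightarrow> 0 < e \<Longrightarrow> finite {f \<in> \<Phi> i. e < \<bar>f x\<bar>}"
    and P: "\<And>i \<Psi> j q. (\<And>x. x \<in> topspace X \<Longrightarrow> j x \<in> topspace K) \<Longrightarrow> 0 < q \<Longrightarrow>
      (\<And>f. f \<in> \<Psi> \<Longrightarrow> continuous_map K euclideanreal f) \<Longrightarrow>
      (\<And>x e. x \<in> topspace K \<Longrightarrow> 0 < e \<Longrightarrow> finite {f \<in> \<Psi>. e < f x} \<and>
        card {f \<in> \<Psi>. e < f x} \<le> card {f \<in> \<Phi> i. e < \<bar>f x\<bar>}) \<Longrightarrow> P (superlevel_sets X j \<Psi> q)"
  shows "\<exists>\<alpha>. almost_subbase X \<alpha> \<and> sigma_family P \<alpha>"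
proof -
  define part :: "bool \<Rightarrow> ('k \<Rightarrow> real) \<Rightarrow> 'k \<Rightarrow> real" where "part s f = (\<lambda>x. max 0 (if s then f x else - f x))" for s f
  define \<Psi> where "\<Psi> p = part (snd p) ` \<Phi> (fst p)" for p
  have \<Psi>_cont: "continuous_map K euclideanreal f" if "f \<in> \<Psi> p" for f p
  proof -
    obtain g where g: "g \<in> \<Phi> (fst p)" "f = part (snd p) g" using \<open>f \<in> \<Psi> p\<close> unfolding \<Psi>_def by blast
    have "continuous_map K euclideanreal (\<lambda>x. - g x)"
      using cont[OF g(1)] by (rule continuous_map_minus)
    then show ?thesis
      using cont[OF g(1)] unfolding g(2) part_def by (cases "snd p") (simp_all add: continuous_map_real_max)
  qed
  have \<Psi>_fin: "finite {f \<in> \<Psi> p. e < f x} \<and> card {f \<in> \<Psi> p. e < f x} \<le> card {f \<in> \<Phi> (fst p). e < \<bar>f x\<bar>}"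
    if x: "x \<in> topspace K" and e: "0 < e" for p x e
  proof -
    have sub: "{f \<in> \<Psi> p. e < f x} \<subseteq> part (snd p) ` {f \<in> \<Phi> (fst p). e < \<bar>f x\<bar>}"
      unfolding \<Psi>_def part_def using e by (auto simp: less_max_iff_disj split: if_splits)
    have "finite {f \<in> \<Phi> (fst p). e < \<bar>f x\<bar>}" using fin[OF x e] .
    then show ?thesis using sub by (meson card_image_le card_mono finite_imageI finite_subset le_trans)
  qed
  show ?thesis
  proof (rule sigma_almost_subbase[OF K X, of \<Psi>])
    show "0 \<le> f x" if "f \<in> \<Psi> p" for f p x using that unfolding \<Psi>_def part_def by auto
    show "x = y" if xy: "x \<in> topspace K" "y \<in> topspace K" and eq: "\<forall>p. \<forall>f\<in>\<Psi> p. f x = f y" for x y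
    proof (rule sep[OF xy], intro allI ballI)
      fix i f assume f: "f \<in> \<Phi> i"
      have "part s f x = part s f y" for s
        using bspec[OF spec[OF eq, of "(i, s)"], of "part s f"] f unfolding \<Psi>_def by auto
      from this[of True] this[of False] show "f x = f y" unfolding part_def by (auto simp: max_def split: if_splits)
    qed
    show "P (superlevel_sets X j (\<Psi> p) q)" if "\<And>x. x \<in> topspace X \<Longrightarrow> j x \<in> topspace K" "0 < q" for p j q
      using that(1) that(2) \<Psi>_cont \<Psi>_fin by (rule P)
  qed (use \<Psi>_cont \<Psi>_fin in auto)
qed

lemma E_space_of_functions:
  fixes \<Phi> :: "nat \<Rightarrow> ('k \<Rightarrow> real) set"
  assumes t0: "t0_space X" and K: "compact_space K" and X: "embeds_in X K"
    and cont: "\<And>i f. f \<in> \<Phi> i \<Longrightarrow> continuous_map K euclideanreal f"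
    and sep: "\<And>x y. x \<in> topspace K \<Longrightarrow> y \<in> topspace K \<Longrightarrow> \<forall>i. \<forall>f\<in>\<Phi> i. f x = f y \<Longrightarrow> x = y"
    and fin: "\<And>i x e. x \<in> topspace K \<Longrightarrow> 0 < e \<Longrightarrow> finite {f \<in> \<Phi> i. e < \<bar>f x\<bar>}"
  shows "E_space X"
proof -
  have "\<exists>\<alpha>. almost_subbase X \<alpha> \<and> sigma_family strongly_point_finite \<alpha>"
    by (rule sigma_almost_subbase_signed[OF K X cont sep fin])
      (auto intro: strongly_point_finite_superlevel_sets[OF K])
  then show ?thesis using t0 unfolding E_space_def by blast
qed

lemma m_boundedly_point_finite_mono:
  "m_boundedly_point_finite m \<F> \<Longrightarrow> m \<le> m' \<Longrightarrow> m_boundedly_point_finite m' \<F>"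
  unfolding m_boundedly_point_finite_def using le_trans by blast

lemma UE_space_of_functions:
  fixes \<Phi> :: "nat \<Rightarrow> ('k \<Rightarrow> real) set"
  assumes t0: "t0_space X" and K: "compact_space K" and X: "embeds_in X K"
    and cont: "\<And>i f. f \<in> \<Phi> i \<Longrightarrow> continuous_map K euclideanreal f"
    and sep: "\<And>x y. x \<in> topspace K \<Longrightarrow> y \<in> topspace K \<Longrightarrow> \<forall>i. \<forall>f\<in>\<Phi> i. f x = f y \<Longrightarrow> x = y"
    and fin: "\<And>i e. 0 < e \<Longrightarrow> \<exists>m. \<forall>x\<in>topspace K. finite {f \<in> \<Phi> i. e < \<bar>f x\<bar>} \<and> card {f \<in> \<Phi> i. e < \<bar>f x\<bar>} \<le> m"
  shows "UE_space X"
proof -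
  have "\<exists>\<alpha>. almost_subbase X \<alpha> \<and> sigma_family boundedly_point_finite \<alpha>"
  proof (rule sigma_almost_subbase_signed[OF K X cont sep])
    show "finite {f \<in> \<Phi> i. e < \<bar>f x\<bar>}" if "x \<in> topspace K" "0 < e" for i x e
      using fin[OF that(2), of i] that(1) by blast
    fix i \<Psi> j and q :: real
    assume j: "\<And>x. x \<in> topspace X \<Longrightarrow> j x \<in> topspace K" and q: "0 < q"
      and \<Psi>: "\<And>x e. x \<in> topspace K \<Longrightarrow> 0 < e \<Longrightarrow> finite {f \<in> \<Psi>. e < f x} \<and>
        card {f \<in> \<Psi>. e < f x} \<le> card {f \<in> \<Phi> i. e < \<bar>f x\<bar>}"
    obtain m where m: "\<And>x. x \<in> topspace K \<Longrightarrow> card {f \<in> \<Phi> i. q < \<bar>f x\<bar>} \<le> m"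
      using fin[OF q, of i] by blast
    have "m_boundedly_point_finite m (superlevel_sets X j \<Psi> q)"
      using \<Psi>[OF _ q] m by (intro m_boundedly_point_finite_superlevel_sets[of X j K]) (auto intro: le_trans j)
    then have "m_boundedly_point_finite (max 1 m) (superlevel_sets X j \<Psi> q)"
      by (rule m_boundedly_point_finite_mono) simp
    then show "boundedly_point_finite (superlevel_sets X j \<Psi> q)"
      unfolding boundedly_point_finite_def by (intro exI[of _ "max 1 m"]) simp
  qed
  then show ?thesis using t0 unfolding UE_space_def by blast
qed

text \<open>Choose functions \<open>f U\<close> with cozero sets \<open>U\<close>. For positive
  \<open>q\<close> the set where \<open>f U\<close> exceeds \<open>q\<close> is contained in
  \<open>U\<close>, so the bound \<open>n + 1\<close> survives unchanged, and a set \<open>U\<close>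
  that contains just one of two points gives a function distinguishing them.\<close>

lemma n_uniform_eberlein_compact_imp_n_UE_space:
  assumes t0: "t0_space X" and K: "n_uniform_eberlein_compact n K" and X: "embeds_in X K"
  shows "n_UE_space n X"
proof -
  have cpt: "compact_space K" using K unfolding n_uniform_eberlein_compact_def by blast
  obtain \<gamma> where \<gamma>: "\<gamma> \<subseteq> cozero_sets K" "sigma_family (m_boundedly_point_finite (n + 1)) \<gamma>" "T0_separating K \<gamma>"
    using K unfolding n_uniform_eberlein_compact_def by blast
  obtain \<G> :: "nat \<Rightarrow> 'b set set" where \<G>: "\<gamma> = (\<Union>i. \<G> i)" "\<And>i. m_boundedly_point_finite (n + 1) (\<G> i)"
    using \<gamma>(2) unfolding sigma_family_def by blast
  have "\<forall>U\<in>\<gamma>. \<exists>f. continuous_map K (top_of_set {0..1::real}) f \<and> U = topspace K - {x \<in> topspace K. f x = 0}"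
    using \<gamma>(1) unfolding cozero_sets_def by auto
  from bchoice[OF this] obtain f where f: "\<And>U. U \<in> \<gamma> \<Longrightarrow> continuous_map K (top_of_set {0..1::real}) (f U)"
      "\<And>U. U \<in> \<gamma> \<Longrightarrow> U = topspace K - {x \<in> topspace K. f U x = 0}"
    by blast
  have f_nonneg: "0 \<le> f U x" if "U \<in> \<gamma>" "x \<in> topspace K" for U x
    using f(1)[OF that(1)] that(2) unfolding continuous_map_in_subtopology by (auto simp: Pi_iff)
  have f_pos: "x \<in> U \<longleftrightarrow> f U x \<noteq> 0" if "U \<in> \<gamma>" "x \<in> topspace K" for U x
    using f(2)[OF that(1)] that(2) by blast
  define \<Phi> where "\<Phi> i = f ` \<G> i" for i
  have bound: "finite {g \<in> \<Phi> i. e < g x} \<and> card {g \<in> \<Phi> i. e < g x} \<le> n + 1"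
    if x: "x \<in> topspace K" and e: "0 < e" for i x e
  proof -
    have "x \<in> U" if "U \<in> \<G> i" "e < f U x" for U
      using f_pos[of U x] x e that \<G>(1) by auto
    then have sub: "{g \<in> \<Phi> i. e < g x} \<subseteq> f ` {U \<in> \<G> i. x \<in> U}"
      unfolding \<Phi>_def by auto
    have "finite {U \<in> \<G> i. x \<in> U}" "card {U \<in> \<G> i. x \<in> U} \<le> n + 1"
      using \<G>(2)[of i] unfolding m_boundedly_point_finite_def by auto
    then show ?thesis using sub by (meson card_image_le card_mono finite_imageI finite_subset le_trans)
  qed
  have "\<exists>\<alpha>. almost_subbase X \<alpha> \<and> sigma_family (m_boundedly_point_finite (n + 1)) \<alpha>"
  proof (rule sigma_almost_subbase[OF cpt X, of \<Phi>])
    show "continuous_map K euclideanreal g" if g: "g \<in> \<Phi> i" for i g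
    proof -
      obtain U where U: "U \<in> \<gamma>" "g = f U" using g \<G>(1) unfolding \<Phi>_def by blast
      show ?thesis using f(1)[OF U(1)] U(2) by (simp add: continuous_map_in_subtopology)
    qed
    show "0 \<le> g x" if "g \<in> \<Phi> i" "x \<in> topspace K" for i g x
      using that f_nonneg \<G>(1) unfolding \<Phi>_def by auto
    show "finite {g \<in> \<Phi> i. e < g x}" if "x \<in> topspace K" "0 < e" for i x e
      using bound[OF that] by blast
    show "m_boundedly_point_finite (n + 1) (superlevel_sets X j (\<Phi> i) q)"
      if "\<And>x. x \<in> topspace X \<Longrightarrow> j x \<in> topspace K" "0 < q" for i j q
      using that(1) bound[OF _ that(2)] by (rule m_boundedly_point_finite_superlevel_sets)
    show "x = y" if xy: "x \<in> topspace K" "y \<in> topspace K" and eq: "\<forall>i. \<forall>g\<in>\<Phi> i. g x = g y" for x y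
    proof (rule ccontr)
      assume "x \<noteq> y"
      then obtain U where U: "U \<in> \<gamma>" "card (U \<inter> {x, y}) = 1"
        using \<gamma>(3) xy unfolding T0_separating_def by blast
      then obtain i where "U \<in> \<G> i" using \<G>(1) by blast
      then have "f U x = f U y" using bspec[OF spec[OF eq, of i], of "f U"] unfolding \<Phi>_def by blast
      then have "x \<in> U \<longleftrightarrow> y \<in> U" using f_pos[OF U(1)] xy by simp
      then have "U \<inter> {x, y} = {} \<or> U \<inter> {x, y} = {x, y}" by auto
      then show False using U(2) \<open>x \<noteq> y\<close> by auto
    qed
  qed
  then show ?thesis using t0 unfolding n_UE_space_def by blast
qed

section \<open>Functions on Corson, Eberlein and uniform Eberlein compacta\<close>

lemma homeomorphic_subtopologyE:
  assumes "K homeomorphic_space subtopology T S"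
  obtains h where "continuous_map K T h" "inj_on h (topspace K)"
    "\<And>x. x \<in> topspace K \<Longrightarrow> h x \<in> topspace T \<inter> S"
proof -
  obtain h where h: "homeomorphic_map K (subtopology T S) h"
    using assms by (auto simp: homeomorphic_space)
  show thesis
  proof (rule that)
    show "continuous_map K T h"
      using homeomorphic_imp_continuous_map[OF h] by (simp add: continuous_map_in_subtopology)
    show "inj_on h (topspace K)" by (rule homeomorphic_imp_injective_map[OF h])
    show "h x \<in> topspace T \<inter> S" if "x \<in> topspace K" for x
      using homeomorphic_imp_surjective_map[OF h] that by (auto simp: topspace_subtopology)
  qed
qed

lemma corson_compact_imp_C_space:
  assumes t0: "t0_space X" and K: "corson_compact TYPE('g) K" and X: "embeds_in X K"
  shows "C_space X"
proof -
  have cpt: "compact_space K" using K unfolding corson_compact_def by blast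
  obtain \<Gamma> :: "'g set" and S where hom: "K homeomorphic_space subtopology (Sigma_product \<Gamma>) S"
    using K unfolding corson_compact_def by blast
  obtain h where h: "continuous_map K (Sigma_product \<Gamma>) h" "inj_on h (topspace K)"
      "\<And>x. x \<in> topspace K \<Longrightarrow> h x \<in> topspace (Sigma_product \<Gamma>) \<inter> S"
    by (rule homeomorphic_subtopologyE[OF hom]) (rule that)
  have hc: "continuous_map K (product_topology (\<lambda>_. top_of_set {0..1}) \<Gamma>) h"
    using h(1) unfolding Sigma_product_def by (simp add: continuous_map_in_subtopology)
  have hx: "h x \<in> (\<Pi>\<^sub>E i\<in>\<Gamma>. {0..1})" "countable {\<gamma> \<in> \<Gamma>. h x \<gamma> > 0}" if "x \<in> topspace K" for x
    using h(3)[OF that] unfolding Sigma_product_def by auto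
  define F where "F = (\<lambda>\<gamma> x. h x \<gamma>) ` \<Gamma>"
  have cont: "continuous_map K euclideanreal f" if f: "f \<in> F" for f
  proof -
    obtain \<gamma> where \<gamma>: "\<gamma> \<in> \<Gamma>" "f = (\<lambda>x. h x \<gamma>)" using f unfolding F_def by blast
    have "continuous_map K (top_of_set {0..1}) (\<lambda>x. h x \<gamma>)"
      using hc \<gamma>(1) unfolding continuous_map_componentwise by blast
    then show ?thesis using \<gamma>(2) by (simp add: continuous_map_in_subtopology)
  qed
  have count: "countable {f \<in> F. 0 < f x}" if "x \<in> topspace K" for x
  proof -
    have "{f \<in> F. 0 < f x} \<subseteq> (\<lambda>\<gamma> x. h x \<gamma>) ` {\<gamma> \<in> \<Gamma>. h x \<gamma> > 0}" unfolding F_def by auto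
    then show ?thesis using hx(2)[OF that] by (meson countable_image countable_subset)
  qed
  have "\<exists>j. (\<forall>x\<in>topspace X. j x \<in> topspace K) \<and> almost_subbase X (\<Union>q\<in>\<rat> \<inter> {0<..}. superlevel_sets X j F q)"
  proof (rule embeds_in_almost_subbase[OF cpt X cont _ _ count])
    show "0 \<le> f x" if "f \<in> F" "x \<in> topspace K" for f x
      using hx(1)[OF that(2)] that(1) unfolding F_def by (auto simp: PiE_iff)
    show "x = y" if xy: "x \<in> topspace K" "y \<in> topspace K" and eq: "\<forall>f\<in>F. f x = f y" for x y
    proof -
      have "h x \<gamma> = h y \<gamma>" if "\<gamma> \<in> \<Gamma>" for \<gamma> using eq that unfolding F_def by auto
      then have "h x = h y" using hx(1)[OF xy(1)] hx(1)[OF xy(2)] by (rule PiE_ext[rotated 2])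
      then show ?thesis using h(2) xy by (meson inj_onD)
    qed
  qed
  then obtain j where j: "\<And>x. x \<in> topspace X \<Longrightarrow> j x \<in> topspace K"
      "almost_subbase X (\<Union>q\<in>\<rat> \<inter> {0<..}. superlevel_sets X j F q)"
    by blast
  have "strongly_point_countable (\<Union>q\<in>\<rat> \<inter> {0<..}. superlevel_sets X j F q)"
    using cpt j(1) cont count by (rule strongly_point_countable_superlevel_sets)
  then show ?thesis using t0 j(2) unfolding C_space_def by blast
qed

lemma topspace_weak_topology [simp]: "topspace (weak_topology :: 'v::real_normed_vector topology) = UNIV"
proof -
  have "(\<lambda>x::'v. 0::real) -` UNIV \<in> {f -` W | f W. bounded_linear (f :: 'v \<Rightarrow> real) \<and> open W}"
    by (intro CollectI exI[of _ "\<lambda>x. 0"] exI[of _ UNIV]) auto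
  then have "UNIV \<subseteq> \<Union>{f -` W | f W. bounded_linear (f :: 'v \<Rightarrow> real) \<and> open W}" by auto
  then show ?thesis unfolding weak_topology_def topology_generated_by_topspace by auto
qed

lemma continuous_map_weak_topology:
  fixes f :: "'v::real_normed_vector \<Rightarrow> real"
  assumes "bounded_linear f"
  shows "continuous_map weak_topology euclideanreal f"
  unfolding continuous_map_def
proof (intro conjI allI impI)
  fix U :: "real set" assume "openin euclideanreal U"
  then have "f -` U \<in> {f -` W | f W. bounded_linear (f :: 'v \<Rightarrow> real) \<and> open W}"
    using assms by auto
  then have "openin weak_topology (f -` U)"
    unfolding weak_topology_def by (rule topology_generated_by_Basis)
  then show "openin weak_topology {x \<in> topspace weak_topology. f x \<in> U}"
    by (simp add: vimage_def)
qed simp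

text \<open>Points with equal values under all bounded functionals lie in the same generating sets
  and so in the same weakly open sets. Hausdorffness of the compactum thus supplies the separating
  functional in place of the Hahn-Banach theorem.\<close>

lemma weak_topology_separation:
  fixes u v :: "'v::real_normed_vector"
  assumes "Hausdorff_space (subtopology weak_topology S)" "u \<in> S" "v \<in> S" "u \<noteq> v"
  shows "\<exists>f :: 'v \<Rightarrow> real. bounded_linear f \<and> f u \<noteq> f v"
proof (rule ccontr)
  assume no: "\<not> ?thesis"
  have indist: "u \<in> U \<longleftrightarrow> v \<in> U" if "openin weak_topology U" for U
  proof -
    have "generate_topology_on {f -` W | f W. bounded_linear (f :: 'v \<Rightarrow> real) \<and> open W} U"
      using that unfolding weak_topology_def by (rule openin_topology_generated_by)
    then show ?thesis
    proof induction
      case (Basis s)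
      then show ?case using no by auto
    qed auto
  qed
  obtain U V where "openin weak_topology U" "u \<in> U" "openin weak_topology V" "v \<in> V" "U \<inter> V \<inter> S = {}"
  proof -
    obtain U V where UV: "openin (subtopology weak_topology S) U" "openin (subtopology weak_topology S) V"
        "u \<in> U" "v \<in> V" "disjnt U V"
    proof -
      have "\<exists>U. openin (subtopology weak_topology S) U \<and>
          (\<exists>V. openin (subtopology weak_topology S) V \<and> u \<in> U \<and> v \<in> V \<and> disjnt U V)"
        using assms unfolding Hausdorff_space_def by simp
      then show thesis by (elim exE conjE) (rule that)
    qed
    obtain U' where U': "openin weak_topology U'" "U = U' \<inter> S" using UV(1) by (auto simp: openin_subtopology)
    obtain V' where V': "openin weak_topology V'" "V = V' \<inter> S" using UV(2) by (auto simp: openin_subtopology)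
    show thesis using that[of U' V'] U' V' UV(3-5) by (auto simp: disjnt_def)
  qed
  then show False using indist assms(2) by blast
qed

text \<open>The Banach-Alaoglu theorem: inside the compact product of the intervals
  \<open>cball 0 (norm x)\<close>, additivity and homogeneity are closed conditions. The topology of
  pointwise convergence makes the pairing with vectors continuous in the functional.\<close>

lemma compactin_dual_ball:
  defines "L \<equiv> {g :: 'v::real_normed_vector \<Rightarrow> real. bounded_linear g \<and> (\<forall>x. \<bar>g x\<bar> \<le> norm x)}"
  shows "compactin (product_topology (\<lambda>_. euclideanreal) UNIV) L"
proof -
  let ?T = "product_topology (\<lambda>_. euclideanreal) (UNIV :: 'v set)"
  have "compactin ?T (\<Pi>\<^sub>E x\<in>UNIV. cball 0 (norm x))"
    by (simp add: compactin_PiE)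
  moreover have "closedin ?T {g \<in> topspace ?T. \<forall>p\<in>UNIV. g (fst p + snd p) - (g (fst p) + g (snd p)) = 0}"
    by (intro closedin_Collect_eq_zero continuous_map_diff continuous_map_add continuous_map_product_projection) auto
  moreover have "closedin ?T {g \<in> topspace ?T. \<forall>p\<in>UNIV. g (fst p *\<^sub>R snd p) - fst p * g (snd p) = 0}"
    by (intro closedin_Collect_eq_zero continuous_map_diff continuous_map_real_mult_left continuous_map_product_projection) auto
  ultimately have "compactin ?T ((\<Pi>\<^sub>E x\<in>UNIV. cball 0 (norm x)) \<inter>
      ({g \<in> topspace ?T. \<forall>p\<in>UNIV. g (fst p + snd p) - (g (fst p) + g (snd p)) = 0} \<inter>
       {g \<in> topspace ?T. \<forall>p\<in>UNIV. g (fst p *\<^sub>R snd p) - fst p * g (snd p) = 0}))"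
    by (intro compact_Int_closedin closedin_Int)
  moreover have "L = (\<Pi>\<^sub>E x\<in>UNIV. cball 0 (norm x)) \<inter>
      ({g \<in> topspace ?T. \<forall>p\<in>UNIV. g (fst p + snd p) - (g (fst p) + g (snd p)) = 0} \<inter>
       {g \<in> topspace ?T. \<forall>p\<in>UNIV. g (fst p *\<^sub>R snd p) - fst p * g (snd p) = 0})" (is "_ = ?R")
  proof (intro equalityI subsetI)
    fix g assume "g \<in> L"
    then have g: "bounded_linear g" "\<And>x. \<bar>g x\<bar> \<le> norm x" unfolding L_def by auto
    then show "g \<in> ?R"
      by (auto simp: PiE_iff linear_add linear_scale bounded_linear.linear)
  next
    fix g assume g: "g \<in> ?R"
    have le: "\<bar>g x\<bar> \<le> norm x" for x using g by (auto simp: PiE_iff)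
    have "g (x + y) = g x + g y" for x y using g by (auto simp: PiE_iff)
    moreover have "g (c *\<^sub>R x) = c *\<^sub>R g x" for c x using g by (auto simp: PiE_iff)
    ultimately have "bounded_linear g" using le by (intro bounded_linear_intro[of g 1]) auto
    then show "g \<in> L" unfolding L_def using le by auto
  qed
  ultimately show ?thesis by simp
qed

lemma eberlein_compact_imp_E_space:
  assumes t0: "t0_space X" and K: "eberlein_compact TYPE('v::banach) K" and X: "embeds_in X K"
  shows "E_space X"
proof -
  have cpt: "compact_space K" and haus: "Hausdorff_space K" using K unfolding eberlein_compact_def by blast+
  obtain S :: "'v set" where S: "K homeomorphic_space subtopology weak_topology S"
    using K unfolding eberlein_compact_def by blast
  obtain h where hc: "continuous_map K weak_topology h" and inj: "inj_on h (topspace K)"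
      and hS: "\<And>x. x \<in> topspace K \<Longrightarrow> h x \<in> topspace weak_topology \<inter> S"
    by (rule homeomorphic_subtopologyE[OF S]) (rule that)
  have hausS: "Hausdorff_space (subtopology weak_topology S)"
    using homeomorphic_Hausdorff_space[OF S] haus by blast
  define L where "L = {g :: 'v \<Rightarrow> real. bounded_linear g \<and> (\<forall>x. \<bar>g x\<bar> \<le> norm x)}"
  define Y where "Y = subtopology (product_topology (\<lambda>_. euclideanreal) UNIV) L"
  have cptY: "compact_space Y"
    using compactin_dual_ball[where 'v = 'v] unfolding Y_def L_def by (rule compact_space_subtopology)
  have topY: "topspace Y = L" unfolding Y_def by simp
  interpret separating_pairing K Y "\<lambda>x g. g (h x)"
  proof
    show "compact_space K" "compact_space Y" by (rule cpt, rule cptY)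
    show "continuous_map K euclideanreal (\<lambda>x. g (h x))" if "g \<in> topspace Y" for g
    proof -
      have "bounded_linear g" using that unfolding topY L_def by blast
      then show ?thesis
        using continuous_map_compose[OF hc continuous_map_weak_topology] by (simp add: comp_def)
    qed
    show "continuous_map Y euclideanreal (\<lambda>g. g (h x))" for x
      unfolding Y_def by (intro continuous_map_from_subtopology continuous_map_product_projection) simp
    show "x = x'" if x: "x \<in> topspace K" "x' \<in> topspace K" and eq: "\<forall>g\<in>topspace Y. g (h x) = g (h x')" for x x'
    proof (rule ccontr)
      assume "x \<noteq> x'"
      then have "h x \<noteq> h x'"
        using inj x by (meson inj_onD)
      then obtain f :: "'v \<Rightarrow> real" where f: "bounded_linear f" "f (h x) \<noteq> f (h x')"
        using weak_topology_separation[OF hausS, of "h x" "h x'"] hS[OF x(1)] hS[OF x(2)] by auto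
      obtain C where C: "0 < C" "\<And>v. norm (f v) \<le> norm v * C"
        using bounded_linear.pos_bounded[OF f(1)] by blast
      define g where "g v = (1 / C) * f v" for v
      have "bounded_linear g" unfolding g_def using f(1) by (rule bounded_linear_const_mult)
      moreover have "\<bar>g v\<bar> \<le> norm v" for v
        unfolding g_def using C by (simp add: abs_mult field_simps)
      ultimately have "g \<in> topspace Y" unfolding topY L_def by blast
      then have "g (h x) = g (h x')" using eq by blast
      then show False using f(2) C(1) unfolding g_def by simp
    qed
  qed
  obtain \<Phi> :: "nat \<Rightarrow> ('b \<Rightarrow> real) set" where \<Phi>: "\<forall>n. \<forall>\<mu>\<in>\<Phi> n. continuous_map K euclideanreal \<mu>"
      "\<forall>n. \<forall>x\<in>topspace K. \<forall>e>0. finite {\<mu> \<in> \<Phi> n. \<bar>\<mu> x\<bar> > e}"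
      "\<forall>x\<in>topspace K. \<forall>x'\<in>topspace K. (\<forall>n. \<forall>\<mu>\<in>\<Phi> n. \<mu> x = \<mu> x') \<longrightarrow> x = x'"
    using sigma_point_finite_separating_functions by (elim exE conjE) (rule that)
  show ?thesis
    using \<Phi> by (intro E_space_of_functions[OF t0 cpt X, of \<Phi>]) auto
qed

text \<open>The uniform boundedness principle. For fixed \<open>z\<close> weak compactness bounds
  \<open>inner x z\<close> over \<open>S\<close>, so the closed sets \<open>C n\<close> cover the
  space, and Baire's theorem puts a ball into one of them.\<close>

lemma weakly_compact_imp_bounded:
  fixes S :: "'h::{real_inner, complete_space} set"
  assumes S: "compactin weak_topology S"
  shows "\<exists>R>0. \<forall>x\<in>S. norm x \<le> R"
proof -
  define C where "C n = {z. \<forall>x\<in>S. \<bar>inner x z\<bar> \<le> real n}" for n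
  have closed: "closed (C n)" for n
  proof -
    have "C n = (\<Inter>x\<in>S. {z. \<bar>inner x z\<bar> \<le> real n})" unfolding C_def by auto
    moreover have "closed {z. \<bar>inner x z\<bar> \<le> real n}" for x
      by (intro closed_Collect_le continuous_intros)
    ultimately show ?thesis by auto
  qed
  have UN: "(\<Union>n. C n) = UNIV"
  proof -
    have "\<exists>n. z \<in> C n" for z
    proof -
      have "compactin euclideanreal ((\<lambda>x. inner x z) ` S)"
        using S continuous_map_weak_topology[OF bounded_linear_inner_left] by (rule image_compactin)
      then have "bounded ((\<lambda>x. inner x z) ` S)" by (simp add: compact_imp_bounded)
      then obtain b where b: "\<And>x. x \<in> S \<Longrightarrow> \<bar>inner x z\<bar> \<le> b" unfolding bounded_iff by auto
      obtain n where "b \<le> real n" using real_arch_simple by blast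
      then show ?thesis unfolding C_def using b by (intro exI[of _ n]) force
    qed
    then show ?thesis by blast
  qed
  have "\<exists>n. interior (C n) \<noteq> {}"
  proof (rule ccontr)
    assume "\<nexists>n. interior (C n) \<noteq> {}"
    then have "euclidean interior_of \<Union>(range C) = ({} :: 'h set)"
      using closed completely_metrizable_space_euclidean[where 'a = 'h]
      by (intro Baire_category_alt) auto
    then show False unfolding UN by simp
  qed
  then obtain n z r where r: "0 < r" "ball z r \<subseteq> C n"
    unfolding ex_in_conv[symmetric] mem_interior by blast
  \<comment> \<open>Moving from the centre by \<open>r / 2\<close> in the direction of
    \<open>x\<close> changes the inner product by \<open>(r / 2) * norm x\<close>, which is at most
    \<open>2 * n\<close>; the added 1 makes the bound positive.\<close>
  have "norm x \<le> 4 * real n / r + 1" if x: "x \<in> S" for x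
  proof (cases "x = 0")
    case True
    then show ?thesis using r by simp
  next
    case False
    define w where "w = (r / (2 * norm x)) *\<^sub>R x"
    have "norm w = r / 2" unfolding w_def using False r by simp
    then have "z + w \<in> C n" "z \<in> C n" using r by (auto simp: dist_norm)
    then have *: "\<bar>inner x (z + w)\<bar> \<le> real n" "\<bar>inner x z\<bar> \<le> real n" unfolding C_def using x by auto
    have "inner x w = (r / 2) * norm x"
      unfolding w_def using False by (simp add: dot_square_norm power2_eq_square)
    then have "(r / 2) * norm x \<le> 2 * real n"
      using * by (simp add: inner_add_right)
    then have "norm x \<le> 4 * real n / r" using r by (simp add: field_simps)
    then show ?thesis by simp
  qed
  moreover have "0 < 4 * real n / r + 1" using r(1) by (simp add: add_nonneg_pos)
  ultimately show ?thesis by blast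
qed

lemma bessel_inequality:
  fixes x :: "'h::real_inner"
  assumes "finite F" "\<And>e. e \<in> F \<Longrightarrow> norm e = 1" "pairwise orthogonal F"
  shows "(\<Sum>e\<in>F. (inner x e)\<^sup>2) \<le> (norm x)\<^sup>2"
proof -
  define p where "p = (\<Sum>e\<in>F. inner x e *\<^sub>R e)"
  have "pairwise (\<lambda>i j. orthogonal (inner x i *\<^sub>R i) (inner x j *\<^sub>R j)) F"
    using assms(3) by (auto simp: pairwise_def orthogonal_def)
  then have "(norm p)\<^sup>2 = (\<Sum>e\<in>F. (norm (inner x e *\<^sub>R e))\<^sup>2)"
    unfolding p_def using assms(1) by (intro norm_sum_Pythagorean)
  also have "\<dots> = (\<Sum>e\<in>F. (inner x e)\<^sup>2)" using assms(2) by (intro sum.cong) auto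
  finally have pp: "(norm p)\<^sup>2 = (\<Sum>e\<in>F. (inner x e)\<^sup>2)" .
  have xp: "inner x p = (\<Sum>e\<in>F. (inner x e)\<^sup>2)"
    unfolding p_def by (simp add: inner_sum_right power2_eq_square)
  have "0 \<le> (norm (x - p))\<^sup>2" by simp
  also have "\<dots> = (norm x)\<^sup>2 - 2 * inner x p + (norm p)\<^sup>2"
    by (simp add: power2_norm_eq_inner inner_diff_left inner_diff_right inner_commute algebra_simps)
  finally show ?thesis unfolding xp pp by simp
qed

lemma ex_maximal_orthonormal:
  "\<exists>M :: 'h::real_inner set. pairwise orthogonal M \<and> (\<forall>e\<in>M. norm e = 1) \<and>
    (\<forall>u. (\<forall>e\<in>M. inner u e = 0) \<longrightarrow> u = 0)"
proof -
  define \<A> where "\<A> = {B :: 'h set. pairwise orthogonal B \<and> (\<forall>e\<in>B. norm e = 1)}"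
  have "\<exists>M\<in>\<A>. \<forall>B\<in>\<A>. M \<subseteq> B \<longrightarrow> B = M"
  proof (rule subset_Zorn')
    fix \<C> assume "subset.chain \<A> \<C>"
    then have C: "\<C> \<subseteq> \<A>" "\<And>A B. A \<in> \<C> \<Longrightarrow> B \<in> \<C> \<Longrightarrow> A \<subseteq> B \<or> B \<subseteq> A"
      by (auto simp: subset_chain_def)
    have "orthogonal u v" if uv: "u \<in> \<Union>\<C>" "v \<in> \<Union>\<C>" "u \<noteq> v" for u v
    proof -
      obtain A B where AB: "A \<in> \<C>" "B \<in> \<C>" "u \<in> A" "v \<in> B" using uv by blast
      then have "\<exists>D\<in>\<C>. u \<in> D \<and> v \<in> D" using C(2)[OF AB(1,2)] by blast
      then show ?thesis using C(1) uv(3) unfolding \<A>_def pairwise_def by blast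
    qed
    then show "\<Union>\<C> \<in> \<A>" using C(1) unfolding \<A>_def pairwise_def by auto
  qed
  then obtain M where M: "M \<in> \<A>" "\<And>B. B \<in> \<A> \<Longrightarrow> M \<subseteq> B \<Longrightarrow> B = M" by blast
  have "u = 0" if u: "\<forall>e\<in>M. inner u e = 0" for u
  proof (rule ccontr)
    assume "u \<noteq> 0"
    define v where "v = (1 / norm u) *\<^sub>R u"
    have v: "norm v = 1" "\<forall>e\<in>M. orthogonal v e" "\<forall>e\<in>M. orthogonal e v"
      unfolding v_def using \<open>u \<noteq> 0\<close> u by (auto simp: orthogonal_def inner_commute)
    then have "insert v M \<in> \<A>" using M(1) unfolding \<A>_def by (auto simp: pairwise_insert)
    then have "v \<in> M" using M(2) by blast
    then have "inner v v = 0" using v(2) by (simp add: orthogonal_def)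
    then show False using v(1) by auto
  qed
  then show ?thesis using M(1) unfolding \<A>_def by blast
qed

text \<open>The coordinates with respect to a maximal orthonormal set separate points. By Bessel's
  inequality and the bound \<open>R\<close> on norms, at most \<open>R\<^sup>2 / q\<^sup>2\<close>
  of them exceed \<open>q\<close> in absolute value, independently of the point.\<close>

lemma uniform_eberlein_compact_imp_UE_space:
  assumes t0: "t0_space X" and K: "uniform_eberlein_compact TYPE('h::{real_inner, complete_space}) K"
    and X: "embeds_in X K"
  shows "UE_space X"
proof -
  have cpt: "compact_space K" using K unfolding uniform_eberlein_compact_def by blast
  obtain S :: "'h set" where S: "compactin weak_topology S" "K homeomorphic_space subtopology weak_topology S"
    using K unfolding uniform_eberlein_compact_def by blast
  obtain h where hc: "continuous_map K weak_topology h" and inj: "inj_on h (topspace K)"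
      and hS: "\<And>x. x \<in> topspace K \<Longrightarrow> h x \<in> topspace weak_topology \<inter> S"
    by (rule homeomorphic_subtopologyE[OF S(2)]) (rule that)
  obtain R where R: "0 < R" "\<And>x. x \<in> S \<Longrightarrow> norm x \<le> R"
    using weakly_compact_imp_bounded[OF S(1)] by blast
  obtain M :: "'h set" where M: "pairwise orthogonal M" "\<forall>e\<in>M. norm e = 1"
      "\<forall>u. (\<forall>e\<in>M. inner u e = 0) \<longrightarrow> u = 0"
    using ex_maximal_orthonormal by (elim exE conjE) (rule that)
  define \<Phi> :: "nat \<Rightarrow> ('b \<Rightarrow> real) set" where "\<Phi> n = (\<lambda>e x. inner (h x) e) ` M" for n
  show ?thesis
  proof (rule UE_space_of_functions[OF t0 cpt X, of \<Phi>])
    show "continuous_map K euclideanreal f" if f: "f \<in> \<Phi> i" for f i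
    proof -
      obtain e where "f = (\<lambda>x. inner (h x) e)" using f unfolding \<Phi>_def by blast
      then show ?thesis
        using continuous_map_compose[OF hc continuous_map_weak_topology[OF bounded_linear_inner_left[of e]]]
        by (simp add: comp_def)
    qed
    show "x = y" if xy: "x \<in> topspace K" "y \<in> topspace K" and eq: "\<forall>i. \<forall>f\<in>\<Phi> i. f x = f y" for x y
    proof -
      have "inner (h x) e = inner (h y) e" if "e \<in> M" for e
        using eq that unfolding \<Phi>_def by auto
      then have "\<forall>e\<in>M. inner (h x - h y) e = 0" by (simp add: inner_diff_left)
      then have "h x - h y = 0" using M(3) by blast
      then show ?thesis using inj xy by (simp add: inj_onD)
    qed
    fix i and q :: real assume q: "0 < q"
    define m where "m = nat \<lfloor>R\<^sup>2 / q\<^sup>2\<rfloor>"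
    show "\<exists>m. \<forall>x\<in>topspace K. finite {f \<in> \<Phi> i. q < \<bar>f x\<bar>} \<and> card {f \<in> \<Phi> i. q < \<bar>f x\<bar>} \<le> m"
    proof (intro exI ballI)
      fix x assume x: "x \<in> topspace K"
      have "finite {e \<in> M. q < \<bar>inner (h x) e\<bar>} \<and> card {e \<in> M. q < \<bar>inner (h x) e\<bar>} \<le> m"
      proof (rule finite_if_finite_subsets_card_bdd)
        fix F assume F: "F \<subseteq> {e \<in> M. q < \<bar>inner (h x) e\<bar>}" "finite F"
        have "real (card F) * q\<^sup>2 = (\<Sum>e\<in>F. q\<^sup>2)" by simp
        also have "\<dots> \<le> (\<Sum>e\<in>F. (inner (h x) e)\<^sup>2)"
        proof (rule sum_mono)
          fix e assume "e \<in> F"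
          then have "q \<le> \<bar>inner (h x) e\<bar>" using F(1) by auto
          then have "q\<^sup>2 \<le> \<bar>inner (h x) e\<bar>\<^sup>2" using q by (intro power_mono) auto
          then show "q\<^sup>2 \<le> (inner (h x) e)\<^sup>2" by simp
        qed
        also have "\<dots> \<le> (norm (h x))\<^sup>2"
          using F M(1,2) by (intro bessel_inequality) (auto intro: pairwise_subset)
        also have "\<dots> \<le> R\<^sup>2" using R(2) hS[OF x] by (intro power_mono) auto
        finally have "real (card F) \<le> R\<^sup>2 / q\<^sup>2" using q by (simp add: field_simps)
        then show "card F \<le> m" unfolding m_def by (simp add: le_nat_floor)
      qed
      moreover have "{f \<in> \<Phi> i. q < \<bar>f x\<bar>} = (\<lambda>e x. inner (h x) e) ` {e \<in> M. q < \<bar>inner (h x) e\<bar>}"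
        unfolding \<Phi>_def by auto
      ultimately show "finite {f \<in> \<Phi> i. q < \<bar>f x\<bar>} \<and> card {f \<in> \<Phi> i. q < \<bar>f x\<bar>} \<le> m"
        by (simp add: le_trans[OF card_image_le])
    qed
  qed
qed

section \<open>Compactifications from almost subbases\<close>

text \<open>The Urysohn quotient \<open>b / (a + b)\<close> of functions with zero set
  \<open>Z\<close> and cozero set \<open>C\<close>. The denominator has no zeros, because
  \<open>b\<close> is nonzero wherever \<open>a\<close> vanishes.\<close>

lemma zero_cozero_function:
  assumes "Z \<in> zero_sets X" "C \<in> cozero_sets X" "Z \<subseteq> C"
  shows "\<exists>g :: 'a \<Rightarrow> real. continuous_map X euclideanreal g \<and> (\<forall>x\<in>topspace X. 0 \<le> g x \<and> g x \<le> 1) \<and>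
    Z = {x \<in> topspace X. g x = 1} \<and> C = {x \<in> topspace X. 0 < g x}"
proof -
  obtain a where a: "continuous_map X (top_of_set {0..1::real}) a" "Z = {x \<in> topspace X. a x = 0}"
    using assms(1) unfolding zero_sets_def by auto
  obtain b where b: "continuous_map X (top_of_set {0..1::real}) b" "C = topspace X - {x \<in> topspace X. b x = 0}"
    using assms(2) unfolding cozero_sets_def by auto
  have ab: "0 \<le> a x" "0 \<le> b x" if "x \<in> topspace X" for x
    using a(1) b(1) that unfolding continuous_map_in_subtopology by (auto simp: Pi_iff)
  have c: "continuous_map X euclideanreal a" "continuous_map X euclideanreal b"
    using a(1) b(1) by (simp_all add: continuous_map_in_subtopology)
  have pos: "0 < a x + b x" if x: "x \<in> topspace X" for x
  proof (rule ccontr)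
    assume "\<not> ?thesis"
    then have "a x = 0" "b x = 0" using ab[OF x] by linarith+
    then show False using assms(3) x a(2) b(2) by auto
  qed
  define g where "g x = b x / (a x + b x)" for x
  have "continuous_map X euclideanreal g"
    unfolding g_def using pos by (intro continuous_map_real_divide continuous_map_add c) force
  moreover have "0 \<le> g x \<and> g x \<le> 1" if "x \<in> topspace X" for x
    unfolding g_def using ab[OF that] pos[OF that] by (simp add: field_simps)
  moreover have "g x = 1 \<longleftrightarrow> a x = 0" if "x \<in> topspace X" for x
    unfolding g_def using pos[OF that] by (simp add: field_simps)
  then have "Z = {x \<in> topspace X. g x = 1}" unfolding a(2) by auto
  moreover have "0 < g x \<longleftrightarrow> b x \<noteq> 0" if "x \<in> topspace X" for x
    unfolding g_def using pos[OF that] ab[OF that] by (auto simp: zero_less_divide_iff less_le)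
  then have "C = {x \<in> topspace X. 0 < g x}" unfolding b(2) by auto
  ultimately show ?thesis by blast
qed

text \<open>Function \<open>k\<close> comes from the zero set \<open>U (2 * k + 1)\<close> and the
  cozero set \<open>U (2 * k + 2)\<close> around it, so numbering from 0 covers the indices from 1
  on; the even terms alone exhaust \<open>V\<close>.\<close>

lemma U_representation_functions:
  assumes "U_representation X V U"
  shows "\<exists>g :: nat \<Rightarrow> 'a \<Rightarrow> real. (\<forall>k. continuous_map X euclideanreal (g k)) \<and>
    (\<forall>k. \<forall>x\<in>topspace X. 0 \<le> g k x \<and> g k x \<le> 1) \<and>
    (\<forall>k. U (2 * k + 1) = {x \<in> topspace X. g k x = 1}) \<and> V = {x \<in> topspace X. \<exists>k. 0 < g k x}"
proof -
  have V: "V = (\<Union>k\<in>{1..}. U k)" and U: "\<And>k. 1 \<le> k \<Longrightarrow> U k \<subseteq> U (k + 1)"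
      "\<And>k. 1 \<le> k \<Longrightarrow> U (2 * k - 1) \<in> zero_sets X" "\<And>k. 1 \<le> k \<Longrightarrow> U (2 * k) \<in> cozero_sets X"
    using assms unfolding U_representation_def by auto
  have "\<exists>g :: 'a \<Rightarrow> real. continuous_map X euclideanreal g \<and> (\<forall>x\<in>topspace X. 0 \<le> g x \<and> g x \<le> 1) \<and>
    U (2 * k + 1) = {x \<in> topspace X. g x = 1} \<and> U (2 * k + 2) = {x \<in> topspace X. 0 < g x}" for k
    using U(1)[of "2 * k + 1"] U(2)[of "Suc k"] U(3)[of "Suc k"] by (intro zero_cozero_function) simp_all
  then have "\<forall>k. \<exists>g :: 'a \<Rightarrow> real. continuous_map X euclideanreal g \<and> (\<forall>x\<in>topspace X. 0 \<le> g x \<and> g x \<le> 1) \<and>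
    U (2 * k + 1) = {x \<in> topspace X. g x = 1} \<and> U (2 * k + 2) = {x \<in> topspace X. 0 < g x}" by blast
  from choice[OF this] obtain g :: "nat \<Rightarrow> 'a \<Rightarrow> real"
    where g: "\<forall>k. continuous_map X euclideanreal (g k) \<and> (\<forall>x\<in>topspace X. 0 \<le> g k x \<and> g k x \<le> 1) \<and>
      U (2 * k + 1) = {x \<in> topspace X. g k x = 1} \<and> U (2 * k + 2) = {x \<in> topspace X. 0 < g k x}" ..
  have "V = (\<Union>k. U (2 * k + 2))"
  proof (intro equalityI subsetI)
    fix x assume "x \<in> V"
    then obtain k where k: "1 \<le> k" "x \<in> U k" using V by auto
    define m where "m = (k - 1) div 2"
    have "k = 2 * m + 1 \<or> k = 2 * m + 2" unfolding m_def using k(1) by presburger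
    then have "x \<in> U (2 * m + 2)" using k(2) U(1)[of "2 * m + 1"] by auto
    then show "x \<in> (\<Union>k. U (2 * k + 2))" by blast
  qed (use V in auto)
  also have "\<dots> = {x \<in> topspace X. \<exists>k. 0 < g k x}" using g by auto
  finally have "V = {x \<in> topspace X. \<exists>k. 0 < g k x}" .
  then show ?thesis using g by (intro exI[of _ g]) auto
qed

text \<open>Coordinate \<open>(V, k)\<close> is positive for some \<open>k\<close> exactly on
  \<open>V\<close>, and less than 1 exactly off \<open>U V (2 * k + 1)\<close>. Both kinds of
  members of the subbase are therefore preimages of open sets, which makes \<open>e\<close> open
  onto its image; the \<open>T\<^sub>0\<close> property makes it injective. Coordinates of sets
  outside \<open>\<alpha>\<close> are 0.\<close>

lemma almost_subbase_cube_embedding: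
  fixes X :: "'a topology"
  assumes t0: "t0_space X" and \<alpha>: "almost_subbase X \<alpha>"
  shows "\<exists>e :: 'a \<Rightarrow> 'a set \<times> nat \<Rightarrow> real. (\<forall>x\<in>topspace X. \<forall>p. 0 \<le> e x p \<and> e x p \<le> 1) \<and>
    (\<forall>x\<in>topspace X. \<forall>p. 0 < e x p \<longrightarrow> fst p \<in> \<alpha> \<and> x \<in> fst p) \<and>
    X homeomorphic_space subtopology euclidean (e ` topspace X)"
proof -
  obtain U :: "'a set \<Rightarrow> nat \<Rightarrow> 'a set" where U: "\<And>V. V \<in> \<alpha> \<Longrightarrow> U_representation X V (U V)"
      "is_subbase X (\<alpha> \<union> {topspace X - U V (2 * k - 1) | V k. V \<in> \<alpha> \<and> k \<ge> 1})"
    using \<alpha> unfolding almost_subbase_def by auto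
  have "\<forall>V\<in>\<alpha>. \<exists>g :: nat \<Rightarrow> 'a \<Rightarrow> real. (\<forall>k. continuous_map X euclideanreal (g k)) \<and>
    (\<forall>k. \<forall>x\<in>topspace X. 0 \<le> g k x \<and> g k x \<le> 1) \<and>
    (\<forall>k. U V (2 * k + 1) = {x \<in> topspace X. g k x = 1}) \<and> V = {x \<in> topspace X. \<exists>k. 0 < g k x}"
    using U_representation_functions[OF U(1)] by blast
  from bchoice[OF this] obtain g :: "'a set \<Rightarrow> nat \<Rightarrow> 'a \<Rightarrow> real" where
    g: "\<forall>V\<in>\<alpha>. (\<forall>k. continuous_map X euclideanreal (g V k)) \<and>
    (\<forall>k. \<forall>x\<in>topspace X. 0 \<le> g V k x \<and> g V k x \<le> 1) \<and>
    (\<forall>k. U V (2 * k + 1) = {x \<in> topspace X. g V k x = 1}) \<and> V = {x \<in> topspace X. \<exists>k. 0 < g V k x}" ..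
  define e where "e x p = (if fst p \<in> \<alpha> then g (fst p) (snd p) x else 0)" for x p
  have e_cont: "continuous_map X euclideanreal (\<lambda>x. e x p)" for p
    using g unfolding e_def by (cases "fst p \<in> \<alpha>") simp_all
  have e_cont': "continuous_map X euclidean e"
    unfolding euclidean_product_topology[symmetric] continuous_map_componentwise_UNIV using e_cont by blast
  have e_pos: "fst p \<in> \<alpha> \<and> x \<in> fst p" if "x \<in> topspace X" "0 < e x p" for x p
  proof -
    have "fst p \<in> \<alpha>" "0 < g (fst p) (snd p) x" using that(2) unfolding e_def by (auto split: if_splits)
    moreover have "fst p = {x \<in> topspace X. \<exists>k. 0 < g (fst p) k x}" using g calculation(1) by blast
    ultimately show ?thesis using that(1) by blast
  qed
  have open_pre: "\<exists>W. open W \<and> S = {x \<in> topspace X. e x \<in> W}"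
    if S: "S \<in> \<alpha> \<union> {topspace X - U V (2 * k - 1) | V k. V \<in> \<alpha> \<and> k \<ge> 1}" for S
  proof -
    consider "S \<in> \<alpha>" | V k where "V \<in> \<alpha>" "k \<ge> 1" "S = topspace X - U V (2 * k - 1)" using S by blast
    then show ?thesis
    proof cases
      case 1
      define W where "W = (\<Union>k. {y :: 'a set \<times> nat \<Rightarrow> real. 0 < y (S, k)})"
      have "open W" unfolding W_def
        by (intro open_UN ballI open_Collect_less continuous_on_const continuous_on_product_coordinates)
      moreover have "S = {x \<in> topspace X. \<exists>k. 0 < g S k x}" using g 1 by blast
      then have "S = {x \<in> topspace X. e x \<in> W}" unfolding W_def e_def using 1 by simp
      ultimately show ?thesis by blast
    next
      case 2
      define W where "W = {y :: 'a set \<times> nat \<Rightarrow> real. y (V, k - 1) < 1}"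
      have "open W" unfolding W_def
        by (intro open_Collect_less continuous_on_const continuous_on_product_coordinates)
      have *: "U V (2 * (k - 1) + 1) = {x \<in> topspace X. g V (k - 1) x = 1}"
          "\<forall>x\<in>topspace X. g V (k - 1) x \<le> 1" using g 2(1) by blast+
      have "2 * k - 1 = 2 * (k - 1) + 1" using 2(2) by simp
      then have "S = {x \<in> topspace X. e x \<in> W}"
        unfolding W_def e_def 2(3) using 2(1) * by (auto simp: less_le)
      then show ?thesis using \<open>open W\<close> by blast
    qed
  qed
  have open_pre': "\<exists>W. open W \<and> S = {x \<in> topspace X. e x \<in> W}" if "openin X S" for S
  proof -
    \<comment> \<open>The preimages of open sets form a topology that contains the subbase, hence
      all open sets of \<open>X\<close>.\<close>
    define T where "T = pullback_topology (topspace X) e euclidean"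
    have topT: "topspace T = topspace X" unfolding T_def by (simp add: topspace_pullback_topology)
    have "openin T S'" if "S' \<in> \<alpha> \<union> {topspace X - U V (2 * k - 1) | V k. V \<in> \<alpha> \<and> k \<ge> 1}" for S'
      using open_pre[OF that] unfolding T_def openin_pullback_topology by (auto simp: vimage_def Int_def)
    moreover have "openin T (topspace X)" using topT openin_topspace[of T] by simp
    moreover have "openin (topology (arbitrary union_of (finite intersection_of
        (\<lambda>U'. U' \<in> \<alpha> \<union> {topspace X - U V (2 * k - 1) | V k. V \<in> \<alpha> \<and> k \<ge> 1}) relative_to topspace X))) S"
      using that U(2) unfolding is_subbase_def by simp
    ultimately have "openin T S" by (rule minimal_topology_subbase)
    then show ?thesis unfolding T_def openin_pullback_topology by (auto simp: vimage_def Int_def)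
  qed
  have inj: "inj_on e (topspace X)"
  proof (rule inj_onI, rule ccontr)
    fix x y assume xy: "x \<in> topspace X" "y \<in> topspace X" "e x = e y" "x \<noteq> y"
    then obtain S where S: "openin X S" "(x \<in> S) \<noteq> (y \<in> S)" using t0 unfolding t0_space_def by blast
    obtain W where W: "S = {x \<in> topspace X. e x \<in> W}" using open_pre'[OF S(1)] by blast
    show False using S(2) xy unfolding W by simp
  qed
  have "homeomorphic_map X (subtopology euclidean (e ` topspace X)) e"
  proof (rule bijective_open_imp_homeomorphic_map)
    show "continuous_map X (subtopology euclidean (e ` topspace X)) e"
      using e_cont' by (simp add: continuous_map_in_subtopology image_subset_iff_funcset)
    show "open_map X (subtopology euclidean (e ` topspace X)) e"
      unfolding open_map_def
    proof (intro allI impI)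
      fix S assume S: "openin X S"
      obtain W where W: "open W" "S = {x \<in> topspace X. e x \<in> W}" using open_pre'[OF S] by blast
      have "e ` S = e ` topspace X \<inter> W" unfolding W(2) by auto
      then show "openin (subtopology euclidean (e ` topspace X)) (e ` S)"
        using W(1) by (simp add: openin_open_Int)
    qed
  qed (use inj in auto)
  then have "X homeomorphic_space subtopology euclidean (e ` topspace X)"
    by (rule homeomorphic_map_imp_homeomorphic_space)
  moreover have "0 \<le> e x p \<and> e x p \<le> 1" if "x \<in> topspace X" for x p
    using g that unfolding e_def by auto
  ultimately show ?thesis using e_pos by blast
qed

text \<open>The last property is what the later proofs know of limit points. For a singleton
  \<open>H\<close> it says that coordinates of sets outside \<open>\<alpha>\<close> vanish on
  \<open>C\<close>; for larger \<open>H\<close> at one level \<open>k\<close> it transports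
  intersection properties of \<open>\<alpha>\<close> from \<open>X\<close> to
  \<open>C\<close>.\<close>

lemma almost_subbase_compactification:
  fixes X :: "'a topology"
  assumes t0: "t0_space X" and \<alpha>: "almost_subbase X \<alpha>"
  obtains C :: "('a set \<times> nat \<Rightarrow> real) set" where "compact C" "embeds_in X (top_of_set C)"
    "\<And>y p. y \<in> C \<Longrightarrow> 0 \<le> y p \<and> y p \<le> 1"
    "\<And>y H k. y \<in> C \<Longrightarrow> finite H \<Longrightarrow> \<forall>V\<in>H. 0 < y (V, k) \<Longrightarrow> H \<subseteq> \<alpha> \<and> \<Inter>H \<noteq> {}"
proof -
  obtain e :: "'a \<Rightarrow> 'a set \<times> nat \<Rightarrow> real" where e: "\<And>x p. x \<in> topspace X \<Longrightarrow> 0 \<le> e x p \<and> e x p \<le> 1"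
      "\<And>x p. x \<in> topspace X \<Longrightarrow> 0 < e x p \<Longrightarrow> fst p \<in> \<alpha> \<and> x \<in> fst p"
      "X homeomorphic_space subtopology euclidean (e ` topspace X)"
    using almost_subbase_cube_embedding[OF t0 \<alpha>] by blast
  define C where "C = closure (e ` topspace X)"
  have cube: "compact (UNIV \<rightarrow>\<^sub>E {0..1} :: ('a set \<times> nat \<Rightarrow> real) set)"
    using compactin_PiE[of "\<lambda>_. euclideanreal" "UNIV :: ('a set \<times> nat) set" "\<lambda>_. {0..1}"]
    unfolding euclidean_product_topology by simp
  have "e ` topspace X \<subseteq> UNIV \<rightarrow>\<^sub>E {0..1}" using e(1) by auto
  moreover have "closed (UNIV \<rightarrow>\<^sub>E {0..1} :: ('a set \<times> nat \<Rightarrow> real) set)"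
  proof -
    have "(UNIV \<rightarrow>\<^sub>E {0..1}) = (\<Inter>p. {y :: 'a set \<times> nat \<Rightarrow> real. 0 \<le> y p} \<inter> {y. y p \<le> 1})"
      by (auto simp: PiE_iff)
    then show ?thesis
      by (auto intro!: closed_INT closed_Int closed_Collect_le continuous_on_const continuous_on_product_coordinates)
  qed
  ultimately have C_sub: "C \<subseteq> UNIV \<rightarrow>\<^sub>E {0..1}" unfolding C_def by (rule closure_minimal)
  have f1: "compact C" using compact_Int_closed[OF cube, of C] C_sub unfolding C_def by (simp add: Int_absorb1)
  have f2: "embeds_in X (top_of_set C)"
    unfolding embeds_in_def
  proof (intro exI conjI)
    have sub: "e ` topspace X \<subseteq> C" unfolding C_def by (rule closure_subset)
    then show "e ` topspace X \<subseteq> topspace (top_of_set C)" by simp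
    show "X homeomorphic_space subtopology (top_of_set C) (e ` topspace X)"
      using e(3) sub by (simp add: subtopology_subtopology Int_absorb1)
  qed
  have f3: "0 \<le> y p \<and> y p \<le> 1" if "y \<in> C" for y p
    using subsetD[OF C_sub that] by (cases p) (auto simp: PiE_iff)
  have f4: "H \<subseteq> \<alpha> \<and> \<Inter>H \<noteq> {}"
    if y: "y \<in> C" and H: "finite H" "\<forall>V\<in>H. 0 < y (V, k)" for y H k
  proof -
    define W where "W = (\<Inter>V\<in>H. {z :: 'a set \<times> nat \<Rightarrow> real. 0 < z (V, k)})"
    have "open W" unfolding W_def using H(1)
      by (intro open_INT ballI open_Collect_less continuous_on_const continuous_on_product_coordinates)
    moreover have "y \<in> W" unfolding W_def using H(2) by blast
    ultimately have "W \<inter> e ` topspace X \<noteq> {}"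
      using y unfolding C_def by (auto simp: closure_iff_nhds_not_empty)
    then obtain x where x: "x \<in> topspace X" "\<And>V. V \<in> H \<Longrightarrow> 0 < e x (V, k)" unfolding W_def by blast
    have "V \<in> \<alpha> \<and> x \<in> V" if "V \<in> H" for V using e(2)[OF x(1) x(2)[OF that]] by simp
    then show ?thesis by blast
  qed
  show thesis using f1 f2 f3 f4 by (rule that)
qed

section \<open>Corson and n-uniform Eberlein compactifications\<close>

lemma Hausdorff_space_function_space: "Hausdorff_space (euclidean :: ('i \<Rightarrow> real) topology)"
  unfolding euclidean_product_topology[symmetric] by (simp add: Hausdorff_space_product_topology)

text \<open>Strong point-finiteness speaks of subfamilies of cardinality exactly
  \<open>natLeq\<close>, so an infinite set of positive coordinates is first cut down to
  size.\<close>

lemma infinite_imp_ordIso_natLeq_subset: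
  assumes "infinite A"
  shows "\<exists>G\<subseteq>A. |G| =o natLeq"
proof -
  have "|UNIV :: nat set| \<le>o |A|" using assms infinite_iff_card_of_nat by blast
  then obtain G where G: "G \<subseteq> A" "|UNIV :: nat set| =o |G|"
    using internalize_card_of_ordLeq2[of "UNIV :: nat set" A] by blast
  have "|G| =o natLeq" using ordIso_transitive[OF ordIso_symmetric[OF G(2)] card_of_nat] .
  then show ?thesis using G(1) by blast
qed

lemma uncountable_imp_ordIso_cardSuc_natLeq_subset:
  assumes "uncountable A"
  shows "\<exists>G\<subseteq>A. |G| =o cardSuc natLeq"
proof -
  have "natLeq <o |A|"
    using assms unfolding countable_card_le_natLeq
    by (simp add: not_ordLeq_iff_ordLess[OF natLeq_Well_order card_of_Well_order])
  then have "cardSuc natLeq \<le>o |A|"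
    by (simp add: cardSuc_ordLess_ordLeq natLeq_Card_order card_of_Card_order)
  moreover have iso: "|Field (cardSuc natLeq)| =o cardSuc natLeq"
    by (intro card_of_Field_ordIso cardSuc_Card_order natLeq_Card_order)
  ultimately have "|Field (cardSuc natLeq)| \<le>o |A|" by (meson ordIso_ordLeq_trans)
  from internalize_card_of_ordLeq2[THEN iffD1, OF this]
  obtain G where "G \<subseteq> A" "|Field (cardSuc natLeq)| =o |G|" by blast
  then show ?thesis using iso by (meson ordIso_symmetric ordIso_transitive)
qed

text \<open>No rescaling is involved: a point of \<open>C\<close> with uncountably many positive
  coordinates at one level would yield a subfamily of \<open>\<alpha>\<close> of cardinality
  \<open>cardSuc natLeq\<close> all of whose finite subfamilies have common points. So
  \<open>C\<close> itself lies in the Sigma-product.\<close>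

lemma C_space_imp_corson_compact:
  fixes X :: "'a topology"
  assumes "C_space X"
  shows "\<exists>K :: ('a set \<times> nat \<Rightarrow> real) topology. corson_compact TYPE('a set \<times> nat) K \<and> embeds_in X K"
proof -
  obtain \<alpha> where \<alpha>: "t0_space X" "almost_subbase X \<alpha>" "strongly_point_countable \<alpha>"
    using assms unfolding C_space_def by blast
  obtain C :: "('a set \<times> nat \<Rightarrow> real) set" where C: "compact C" "embeds_in X (top_of_set C)"
      "\<And>y p. y \<in> C \<Longrightarrow> 0 \<le> y p \<and> y p \<le> 1"
      "\<And>y H k. y \<in> C \<Longrightarrow> finite H \<Longrightarrow> \<forall>V\<in>H. 0 < y (V, k) \<Longrightarrow> H \<subseteq> \<alpha> \<and> \<Inter>H \<noteq> {}"
    by (rule almost_subbase_compactification[OF \<alpha>(1,2)]) (rule that)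
  have "countable {p. 0 < y p}" if y: "y \<in> C" for y
  proof -
    have "countable {V. 0 < y (V, k)}" for k
    proof (rule ccontr)
      assume "uncountable {V. 0 < y (V, k)}"
      then obtain G where G: "G \<subseteq> {V. 0 < y (V, k)}" "|G| =o cardSuc natLeq"
        using uncountable_imp_ordIso_cardSuc_natLeq_subset by blast
      have "V \<in> \<alpha>" if "V \<in> G" for V
        using C(4)[OF y, of "{V}" k] that G(1) by auto
      then have "G \<subseteq> \<alpha>" by blast
      from \<alpha>(3)[unfolded strongly_point_countable_def, rule_format, OF this G(2)]
      obtain H where H: "H \<subseteq> G" "finite H" "\<Inter>H = {}" by blast
      have "\<forall>V\<in>H. 0 < y (V, k)" using H(1) G(1) by blast
      then show False using C(4)[OF y H(2)] H(3) by blast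
    qed
    then have "countable (\<Union>k. (\<lambda>V. (V, k)) ` {V. 0 < y (V, k)})" by (intro countable_UN countable_image) auto
    moreover have "{p. 0 < y p} = (\<Union>k. (\<lambda>V. (V, k)) ` {V. 0 < y (V, k)})" by auto
    ultimately show ?thesis by simp
  qed
  then have sub: "(UNIV \<rightarrow>\<^sub>E {0..1}) \<inter> {x. countable {\<gamma> \<in> UNIV. 0 < x \<gamma>}} \<inter> C = C"
    using C(3) by auto
  have "subtopology (Sigma_product UNIV) C = top_of_set C"
    unfolding Sigma_product_def subtopology_product_topology[symmetric] euclidean_product_topology
      subtopology_subtopology sub ..
  then have "top_of_set C homeomorphic_space subtopology (Sigma_product UNIV) C"
    by (simp add: homeomorphic_space_refl)
  then have "corson_compact TYPE('a set \<times> nat) (top_of_set C)"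
    unfolding corson_compact_def using C(1) by (auto simp: compact_space_subtopology)
  then show ?thesis using C(2) by blast
qed

text \<open>Finitely many sets with positive coordinates at \<open>y\<close> have a common point
  \<open>x\<close>, and the bound at \<open>x\<close> limits their number. Thus bounds transfer from
  points of \<open>X\<close> to limit points with the same constant.\<close>

lemma card_positive_coordinates_le:
  fixes y :: "'a set \<times> nat \<Rightarrow> real"
  assumes fip: "\<And>H. finite H \<Longrightarrow> \<forall>V\<in>H. 0 < y (V, k) \<Longrightarrow> \<Inter>H \<noteq> {}"
    and \<G>: "m_boundedly_point_finite m \<G>"
  shows "finite {V \<in> \<G>. 0 < y (V, k)} \<and> card {V \<in> \<G>. 0 < y (V, k)} \<le> m"
proof (rule finite_if_finite_subsets_card_bdd)
  fix H assume H: "H \<subseteq> {V \<in> \<G>. 0 < y (V, k)}" "finite H"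
  then obtain x where "x \<in> \<Inter>H" using fip by blast
  then have "H \<subseteq> {U \<in> \<G>. x \<in> U}" using H(1) by blast
  moreover have "finite {U \<in> \<G>. x \<in> U}" "card {U \<in> \<G>. x \<in> U} \<le> m"
    using \<G> unfolding m_boundedly_point_finite_def by auto
  ultimately show "card H \<le> m" by (meson card_mono le_trans)
qed

text \<open>The separating family consists of the sets \<open>q < y (V, k)\<close>. For a fixed
  index \<open>(i, k, q)\<close> those containing \<open>y\<close> come from
  \<open>V \<in> \<G> i\<close> with positive coordinate, at most \<open>n + 1\<close> many; a
  rational \<open>q\<close> between two differing coordinates separates.\<close>

lemma n_UE_space_imp_n_uniform_eberlein_compact:
  fixes X :: "'a topology"
  assumes "n_UE_space n X"
  shows "\<exists>K :: ('a set \<times> nat \<Rightarrow> real) topology. n_uniform_eberlein_compact n K \<and> embeds_in X K"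
proof -
  obtain \<alpha> where \<alpha>: "t0_space X" "almost_subbase X \<alpha>" "sigma_family (m_boundedly_point_finite (n + 1)) \<alpha>"
    using assms unfolding n_UE_space_def by blast
  obtain \<G> :: "nat \<Rightarrow> 'a set set" where \<G>: "\<alpha> = (\<Union>i. \<G> i)" "\<And>i. m_boundedly_point_finite (n + 1) (\<G> i)"
    using sigma_familyE[OF \<alpha>(3)] by blast
  obtain C :: "('a set \<times> nat \<Rightarrow> real) set" where C: "compact C" "embeds_in X (top_of_set C)"
      "\<And>y p. y \<in> C \<Longrightarrow> 0 \<le> y p \<and> y p \<le> 1"
      "\<And>y H k. y \<in> C \<Longrightarrow> finite H \<Longrightarrow> \<forall>V\<in>H. 0 < y (V, k) \<Longrightarrow> H \<subseteq> \<alpha> \<and> \<Inter>H \<noteq> {}"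
    by (rule almost_subbase_compactification[OF \<alpha>(1,2)]) (rule that)
  define I where "I = (UNIV :: nat set) \<times> (UNIV :: nat set) \<times> (\<rat> \<inter> {0::real<..})"
  define S where "S k q V = {y \<in> C. q < y (V, k)}" for k V and q :: real
  define \<H> where "\<H> = (\<lambda>(i, k, q). S k q ` \<G> i)"
  define \<gamma> where "\<gamma> = (\<Union>p\<in>I. \<H> p)"
  have "U \<in> cozero_sets (top_of_set C)" if U: "U \<in> \<gamma>" for U
  proof -
    obtain k q V where "U = S k q V" using U unfolding \<gamma>_def \<H>_def by auto
    then have eq: "U = {y \<in> topspace (top_of_set C). max 0 (y (V, k) - q) \<noteq> 0}"
      unfolding S_def by (auto simp: max_def)
    have "continuous_map (top_of_set C) euclideanreal (\<lambda>y. max 0 (y (V, k) - q))"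
      unfolding continuous_map_iff_continuous
      by (intro continuous_on_max continuous_on_diff continuous_on_const
          continuous_on_subset[OF continuous_on_product_coordinates]) simp
    from cozero_setI[OF this] show ?thesis unfolding eq .
  qed
  moreover have "sigma_family (m_boundedly_point_finite (n + 1)) \<gamma>"
    unfolding \<gamma>_def
  proof (rule sigma_familyI)
    show "countable I" unfolding I_def by (intro countable_SIGMA) (auto intro: countable_subset[OF _ countable_rat])
    have "(0, 0, 1) \<in> I" unfolding I_def by simp
    then show "I \<noteq> {}" by blast
    fix p assume "p \<in> I"
    then obtain i k q where p: "p = (i, k, q)" "0 < q" unfolding I_def by auto
    show "m_boundedly_point_finite (n + 1) (\<H> p)"
      unfolding m_boundedly_point_finite_def
    proof
      fix y
      show "finite {U \<in> \<H> p. y \<in> U} \<and> card {U \<in> \<H> p. y \<in> U} \<le> n + 1"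
      proof (cases "y \<in> C")
        case True
        have fin: "finite {V \<in> \<G> i. 0 < y (V, k)} \<and> card {V \<in> \<G> i. 0 < y (V, k)} \<le> n + 1"
          using C(4)[OF True] \<G>(2) by (intro card_positive_coordinates_le) blast+
        have "{U \<in> \<H> p. y \<in> U} \<subseteq> S k q ` {V \<in> \<G> i. 0 < y (V, k)}"
          unfolding \<H>_def p(1) S_def using p(2) by auto
        then show ?thesis
          using fin by (meson card_image_le card_mono finite_imageI finite_subset le_trans)
      next
        case False
        then have empty: "{U \<in> \<H> p. y \<in> U} = {}" unfolding \<H>_def S_def p(1) by auto
        show ?thesis unfolding empty by simp
      qed
    qed
  qed
  moreover have "T0_separating (top_of_set C) \<gamma>"
  proof -
    have sep: "\<exists>U\<in>\<gamma>. y \<in> U \<and> z \<notin> U" if yz: "y \<in> C" "z \<in> C" "z p < y p" for y z p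
    proof -
      obtain q where q: "q \<in> \<rat>" "z p < q" "q < y p" using Rats_dense_in_real[OF yz(3)] by blast
      have "0 \<le> z p" using C(3)[OF yz(2)] by blast
      then have "0 < q" "0 < y p" using q by linarith+
      then have "fst p \<in> \<alpha>" using C(4)[OF yz(1), of "{fst p}" "snd p"] by auto
      then obtain i where "fst p \<in> \<G> i" using \<G>(1) by blast
      then have "S (snd p) q (fst p) \<in> \<gamma>"
        unfolding \<gamma>_def using q(1) \<open>0 < q\<close> by (intro UN_I[of "(i, snd p, q)"]) (auto simp: \<H>_def I_def)
      moreover have "y \<in> S (snd p) q (fst p)" "z \<notin> S (snd p) q (fst p)"
        unfolding S_def using q yz by auto
      ultimately show ?thesis by blast
    qed
    have "\<exists>U\<in>\<gamma>. card (U \<inter> {y, z}) = 1" if yz: "y \<in> C" "z \<in> C" "y \<noteq> z" for y z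
    proof -
      obtain p where p: "y p \<noteq> z p" using yz(3) by blast
      have "\<exists>U\<in>\<gamma>. U \<inter> {y, z} = {y} \<or> U \<inter> {y, z} = {z}"
      proof (cases "z p < y p")
        case True
        then show ?thesis using sep[OF yz(1,2)] by blast
      next
        case False
        then have "y p < z p" using p by simp
        then show ?thesis using sep[OF yz(2,1)] by blast
      qed
      then show ?thesis by (metis card_1_singleton_iff One_nat_def)
    qed
    then show ?thesis unfolding T0_separating_def by simp
  qed
  ultimately have "n_uniform_eberlein_compact n (top_of_set C)"
    unfolding n_uniform_eberlein_compact_def
    using C(1) Hausdorff_space_subtopology[OF Hausdorff_space_function_space, of C]
    by (intro conjI exI[of _ \<gamma>]) (auto simp: compact_space_subtopology)
  then show ?thesis using C(2) by blast
qed

text \<open>Continuity into the weak topology is tested on functionals, and the inverse of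
  \<open>T\<close> divides the coordinate functionals by the scaling factors \<open>c i\<close>.
  This reduces the sup-norm case and the Hilbert case alike to the continuity of
  \<open>f (T y)\<close> in \<open>y\<close>.\<close>

lemma homeomorphic_weak_image:
  fixes T :: "('i \<Rightarrow> real) \<Rightarrow> 'v::real_normed_vector" and coord :: "'i \<Rightarrow> 'v \<Rightarrow> real"
  assumes C: "compact C" and T: "\<And>f :: 'v \<Rightarrow> real. bounded_linear f \<Longrightarrow> continuous_on C (\<lambda>y. f (T y))"
    and coord: "\<And>i. bounded_linear (coord i)" and c: "\<And>i. c i \<noteq> 0"
    and eq: "\<And>i y. y \<in> C \<Longrightarrow> coord i (T y) = c i * y i"
  shows "compactin weak_topology (T ` C)"
    and "top_of_set C homeomorphic_space subtopology weak_topology (T ` C)"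
proof -
  have cont: "continuous_map (top_of_set C) weak_topology T"
    unfolding weak_topology_def
  proof (rule continuous_on_generated_topo)
    fix U assume "U \<in> {f -` W | f W. bounded_linear (f :: 'v \<Rightarrow> real) \<and> open W}"
    then obtain f :: "'v \<Rightarrow> real" and W where f: "bounded_linear f" "open W" "U = f -` W" by auto
    have "openin (top_of_set C) (C \<inter> (\<lambda>y. f (T y)) -` W)"
      using T[OF f(1)] f(2) by (rule continuous_openin_preimage_gen)
    moreover have "T -` U \<inter> topspace (top_of_set C) = C \<inter> (\<lambda>y. f (T y)) -` W"
      unfolding f(3) by auto
    ultimately show "openin (top_of_set C) (T -` U \<inter> topspace (top_of_set C))" by simp
  next
    have "topspace (weak_topology :: 'v topology) = UNIV" by simp
    then have "\<Union>{f -` W | f W. bounded_linear (f :: 'v \<Rightarrow> real) \<and> open W} = UNIV"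
      unfolding weak_topology_def topology_generated_by_topspace .
    then show "T ` topspace (top_of_set C) \<subseteq> \<Union>{f -` W | f W. bounded_linear (f :: 'v \<Rightarrow> real) \<and> open W}"
      by (simp only: subset_UNIV)
  qed
  have "compactin (top_of_set C) C" using C by (simp add: compactin_subtopology)
  then show "compactin weak_topology (T ` C)" using cont by (rule image_compactin)
  define T' where "T' v = (\<lambda>i. coord i v / c i)" for v
  have T'T: "T' (T y) = y" if "y \<in> C" for y unfolding T'_def using eq[OF that] c by auto
  have "continuous_map weak_topology euclidean T'"
    unfolding euclidean_product_topology[symmetric] continuous_map_componentwise_UNIV T'_def
    using continuous_map_weak_topology[OF coord] c by (intro allI continuous_map_real_divide) auto
  then have "continuous_map (subtopology weak_topology (T ` C)) (top_of_set C) T'"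
    using T'T by (auto simp: continuous_map_in_subtopology continuous_map_from_subtopology)
  moreover have "continuous_map (top_of_set C) (subtopology weak_topology (T ` C)) T"
    using cont by (auto simp: continuous_map_in_subtopology)
  ultimately have "homeomorphic_maps (top_of_set C) (subtopology weak_topology (T ` C)) T T'"
    unfolding homeomorphic_maps_def using T'T by auto
  then show "top_of_set C homeomorphic_space subtopology weak_topology (T ` C)"
    unfolding homeomorphic_space_def by blast
qed

text \<open>\<open>f (T y)\<close> is a uniform limit of finite combinations of coordinates. The
  expansion of \<open>T y\<close> may use a set \<open>J\<close> depending on \<open>y\<close>; the
  uniform smallness of the tails of \<open>f\<close> replaces it by one \<open>F\<close> for all
  \<open>y\<close>.\<close>

lemma continuous_on_functional_of_expansion:
  fixes T :: "('i \<Rightarrow> real) \<Rightarrow> 'v::real_normed_vector" and f :: "'v \<Rightarrow> real"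
  assumes f: "bounded_linear f"
    and approx: "\<And>y F \<delta>. y \<in> C \<Longrightarrow> finite F \<Longrightarrow> 0 < \<delta> \<Longrightarrow>
      \<exists>J. finite J \<and> F \<subseteq> J \<and> norm (T y - (\<Sum>i\<in>J. (c i * y i) *\<^sub>R b i)) \<le> \<delta>"
    and tails: "\<And>\<epsilon>. 0 < \<epsilon> \<Longrightarrow> \<exists>F. finite F \<and> (\<forall>y\<in>C. \<forall>J. finite J \<longrightarrow> J \<inter> F = {} \<longrightarrow>
      \<bar>\<Sum>i\<in>J. c i * y i * f (b i)\<bar> \<le> \<epsilon>)"
  shows "continuous_on C (\<lambda>y. f (T y))"
proof -
  obtain M where M: "0 < M" "\<And>v. norm (f v) \<le> norm v * M"
    using bounded_linear.pos_bounded[OF f] by blast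
  have f_sum: "f (\<Sum>i\<in>J. (c i * y i) *\<^sub>R b i) = (\<Sum>i\<in>J. c i * y i * f (b i))" for J y
    using bounded_linear.linear[OF f] by (simp add: linear_sum linear_scale)
  have "\<exists>F. finite F \<and> (\<forall>y\<in>C. \<bar>f (T y) - (\<Sum>i\<in>F. c i * y i * f (b i))\<bar> < \<epsilon>)" if \<epsilon>: "0 < \<epsilon>" for \<epsilon>
  proof -
    obtain F where F: "finite F"
        "\<forall>y\<in>C. \<forall>J. finite J \<longrightarrow> J \<inter> F = {} \<longrightarrow> \<bar>\<Sum>i\<in>J. c i * y i * f (b i)\<bar> \<le> \<epsilon> / 3"
      using tails[of "\<epsilon> / 3"] \<epsilon> by auto
    have "\<bar>f (T y) - (\<Sum>i\<in>F. c i * y i * f (b i))\<bar> < \<epsilon>" if y: "y \<in> C" for y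
    proof -
      \<comment> \<open>The norm accuracy \<open>\<epsilon> / (3 * M)\<close> becomes
        \<open>\<epsilon> / 3\<close> under \<open>f\<close>; the terms outside \<open>F\<close>
        cost another \<open>\<epsilon> / 3\<close>, which leaves room for the strict
        inequality.\<close>
      obtain J where J: "finite J" "F \<subseteq> J" "norm (T y - (\<Sum>i\<in>J. (c i * y i) *\<^sub>R b i)) \<le> \<epsilon> / (3 * M)"
        using approx[OF y F(1), of "\<epsilon> / (3 * M)"] \<epsilon> M(1) by auto
      have "\<bar>f (T y) - (\<Sum>i\<in>J. c i * y i * f (b i))\<bar> = norm (f (T y - (\<Sum>i\<in>J. (c i * y i) *\<^sub>R b i)))"
        using bounded_linear.linear[OF f] f_sum[of y J] by (simp add: linear_diff)
      also have "\<dots> \<le> \<epsilon> / (3 * M) * M"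
        using M(2) J(3) M(1) by (meson mult_right_mono less_imp_le order_trans)
      also have "\<dots> = \<epsilon> / 3" using M(1) by simp
      finally have 1: "\<bar>f (T y) - (\<Sum>i\<in>J. c i * y i * f (b i))\<bar> \<le> \<epsilon> / 3" .
      have 2: "\<bar>\<Sum>i\<in>J - F. c i * y i * f (b i)\<bar> \<le> \<epsilon> / 3" using F(2) y J(1) by blast
      have 3: "(\<Sum>i\<in>J. c i * y i * f (b i)) = (\<Sum>i\<in>J - F. c i * y i * f (b i)) + (\<Sum>i\<in>F. c i * y i * f (b i))"
        using J(1,2) by (rule sum.subset_diff[rotated])
      have "\<bar>u - w\<bar> < \<epsilon>" if "\<bar>u - v\<bar> \<le> \<epsilon> / 3" "\<bar>s\<bar> \<le> \<epsilon> / 3" "v = s + w" for u v s w :: real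
      proof -
        have "\<bar>u - w\<bar> \<le> \<bar>u - v\<bar> + \<bar>s\<bar>" using abs_triangle_ineq[of "u - v" s] that(3) by simp
        moreover have "a < \<epsilon>" if "a \<le> b + c" "b \<le> \<epsilon> / 3" "c \<le> \<epsilon> / 3" for a b c :: real
          using that \<epsilon> by linarith
        ultimately show ?thesis using that(1,2) by blast
      qed
      from this[OF 1 2 3] show ?thesis .
    qed
    then show ?thesis using F(1) by blast
  qed
  then have "\<forall>n. \<exists>F. finite F \<and> (\<forall>y\<in>C. \<bar>f (T y) - (\<Sum>i\<in>F. c i * y i * f (b i))\<bar> < 1 / real (Suc n))"
    by simp
  from choice[OF this] obtain F where
    F: "\<forall>n. finite (F n) \<and> (\<forall>y\<in>C. \<bar>f (T y) - (\<Sum>i\<in>F n. c i * y i * f (b i))\<bar> < 1 / real (Suc n))" ..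
  have "uniform_limit C (\<lambda>n y. \<Sum>i\<in>F n. c i * y i * f (b i)) (\<lambda>y. f (T y)) sequentially"
  proof (rule uniform_limitI)
    fix e :: real assume "0 < e"
    then obtain N where N: "1 / real (Suc N) < e" using nat_approx_posE by blast
    have "dist (\<Sum>i\<in>F n. c i * y i * f (b i)) (f (T y)) < e" if "N \<le> n" "y \<in> C" for n y
    proof -
      have "1 / real (Suc n) \<le> 1 / real (Suc N)" using that(1) by (intro divide_left_mono) auto
      moreover have "\<bar>f (T y) - (\<Sum>i\<in>F n. c i * y i * f (b i))\<bar> < 1 / real (Suc n)" using F that(2) by blast
      ultimately show ?thesis using N by (simp add: dist_real_def abs_minus_commute)
    qed
    then show "\<forall>\<^sub>F n in sequentially. \<forall>y\<in>C. dist (\<Sum>i\<in>F n. c i * y i * f (b i)) (f (T y)) < e"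
      unfolding eventually_sequentially by blast
  qed
  moreover have "continuous_on C (\<lambda>y. \<Sum>i\<in>F n. c i * y i * f (b i))" for n
    by (intro continuous_on_sum continuous_on_mult continuous_on_const
        continuous_on_subset[OF continuous_on_product_coordinates]) simp
  ultimately show ?thesis by (intro uniform_limit_theorem) auto
qed

text \<open>A finite set whose sum comes within \<open>e\<close> of the supremum of all finite sums
  leaves at most \<open>e\<close> for any disjoint set.\<close>

lemma small_tails:
  fixes g :: "'i \<Rightarrow> real"
  assumes nonneg: "\<And>i. 0 \<le> g i" and bound: "\<And>J. finite J \<Longrightarrow> sum g J \<le> M" and e: "0 < e"
  shows "\<exists>F. finite F \<and> (\<forall>J. finite J \<longrightarrow> J \<inter> F = {} \<longrightarrow> sum g J \<le> e)"
proof -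
  define A where "A = sum g ` {J. finite J}"
  have bdd: "bdd_above A" unfolding A_def using bound by (intro bdd_aboveI2[of _ _ M]) auto
  have "A \<noteq> {}" unfolding A_def by blast
  then obtain s where s: "s \<in> A" "Sup A - e < s" using less_cSupD[of A "Sup A - e"] e by auto
  then obtain F where F: "finite F" "s = sum g F" unfolding A_def by auto
  have "sum g J \<le> e" if J: "finite J" "J \<inter> F = {}" for J
  proof -
    have "sum g (J \<union> F) \<le> Sup A"
      using bdd J F unfolding A_def by (intro cSup_upper) auto
    moreover have "sum g (J \<union> F) = sum g J + sum g F" by (rule sum.union_disjoint[OF J(1) F(1) J(2)])
    ultimately show ?thesis using s(2) F(2) by linarith
  qed
  then show ?thesis using F(1) by blast
qed

section \<open>Eberlein compactifications in the space of bounded functions\<close>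

lemma linear_apply_bcontfun_discrete: "bounded_linear (\<lambda>v :: 'g linf. apply_bcontfun v d)"
proof (rule bounded_linear_intro[where K = 1])
  show "norm (apply_bcontfun v d) \<le> norm v * 1" for v :: "'g linf"
    using norm_bounded[of v d] by simp
qed simp_all

lemma bounded_discrete_bcontfun:
  fixes h :: "'g discrete \<Rightarrow> real"
  assumes "\<And>d. \<bar>h d\<bar> \<le> B"
  shows "apply_bcontfun (Bcontfun h) = h"
proof -
  have "continuous_on UNIV h" by (auto simp: continuous_on_open_vimage open_discrete)
  then have "h \<in> bcontfun" using assms by (intro bcontfun_normI[where b = B]) auto
  then show ?thesis by (rule Bcontfun_inverse)
qed

definition linf_unit :: "'g \<Rightarrow> 'g linf" where
  "linf_unit p = Bcontfun (\<lambda>d. if of_discrete d = p then 1 else 0)"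

lemma apply_linf_unit: "apply_bcontfun (linf_unit p) d = (if of_discrete d = p then 1 else 0)"
  unfolding linf_unit_def by (subst bounded_discrete_bcontfun[where B = 1]) auto

lemma apply_linf_sum:
  assumes "finite J"
  shows "apply_bcontfun (\<Sum>p\<in>J. a p *\<^sub>R linf_unit p) d = (if of_discrete d \<in> J then a (of_discrete d) else 0)"
proof -
  have "apply_bcontfun (\<Sum>p\<in>J. a p *\<^sub>R linf_unit p) d = (\<Sum>p\<in>J. a p * (if of_discrete d = p then 1 else 0))"
    using linear_sum[OF bounded_linear.linear[OF linear_apply_bcontfun_discrete[of d]], of "\<lambda>p. a p *\<^sub>R linf_unit p" J]
    by (simp add: apply_linf_unit)
  also have "\<dots> = (\<Sum>p\<in>J. if of_discrete d = p then a p else 0)" by (intro sum.cong) auto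
  finally show ?thesis using assms by (simp add: sum.delta')
qed

lemma E_space_imp_eberlein_compact:
  fixes X :: "'a topology"
  assumes "E_space X"
  shows "\<exists>K :: ('a set \<times> nat \<Rightarrow> real) topology. eberlein_compact TYPE(('a set \<times> nat) linf) K \<and> embeds_in X K"
proof -
  obtain \<alpha> where \<alpha>: "t0_space X" "almost_subbase X \<alpha>" "sigma_family strongly_point_finite \<alpha>"
    using assms unfolding E_space_def by blast
  obtain \<G> :: "nat \<Rightarrow> 'a set set" where \<G>: "\<alpha> = (\<Union>i. \<G> i)" "\<And>i. strongly_point_finite (\<G> i)"
    using sigma_familyE[OF \<alpha>(3)] by blast
  obtain C :: "('a set \<times> nat \<Rightarrow> real) set" where C: "compact C" "embeds_in X (top_of_set C)"
      "\<And>y p. y \<in> C \<Longrightarrow> 0 \<le> y p \<and> y p \<le> 1"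
      "\<And>y H k. y \<in> C \<Longrightarrow> finite H \<Longrightarrow> \<forall>V\<in>H. 0 < y (V, k) \<Longrightarrow> H \<subseteq> \<alpha> \<and> \<Inter>H \<noteq> {}"
    by (rule almost_subbase_compactification[OF \<alpha>(1,2)]) (rule that)
  \<comment> \<open>The families may overlap; the least index assigns each set to one of them, and
    together with the level \<open>k\<close> this splits the coordinates into countably many
    blocks.\<close>
  define idx where "idx V = (LEAST i. V \<in> \<G> i)" for V
  have idx: "V \<in> \<G> (idx V)" if "V \<in> \<alpha>" for V
    unfolding idx_def using that \<G>(1) by (auto intro: LeastI)
  \<comment> \<open>The weight depends on the block only. Weights above \<open>\<delta>\<close>
    occur in finitely many blocks, and a point of \<open>C\<close> has finitely many positive
    coordinates in each, so the rescaled point lies in \<open>c\<^sub>0\<close>.\<close>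
  define c :: "'a set \<times> nat \<Rightarrow> real" where "c p = (1/2) ^ (idx (fst p) + snd p)" for p
  have c: "0 < c p" "c p \<le> 1" for p unfolding c_def by (simp_all add: power_le_one)
  have fin: "finite {V \<in> \<G> i. 0 < y (V, k)}" if y: "y \<in> C" for y i k
  proof (rule ccontr)
    assume "infinite {V \<in> \<G> i. 0 < y (V, k)}"
    then obtain G where G: "G \<subseteq> {V \<in> \<G> i. 0 < y (V, k)}" "|G| =o natLeq"
      using infinite_imp_ordIso_natLeq_subset by blast
    then have "G \<subseteq> \<G> i" by blast
    from \<G>(2)[unfolded strongly_point_finite_def, rule_format, OF this G(2)]
    obtain H where H: "H \<subseteq> G" "finite H" "\<Inter>H = {}" by blast
    have "\<forall>V\<in>H. 0 < y (V, k)" using H(1) G(1) by blast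
    then show False using C(4)[OF y H(2)] H(3) by blast
  qed
  have fin_c: "finite {p. \<delta> < c p * y p}" if y: "y \<in> C" and \<delta>: "0 < \<delta>" for y \<delta>
  proof -
    obtain N where N: "(1/2 :: real) ^ N < \<delta>" using real_arch_pow_inv[OF \<delta>, of "1/2"] by auto
    have "{p. \<delta> < c p * y p} \<subseteq> (\<Union>i<N. \<Union>k<N. (\<lambda>V. (V, k)) ` {V \<in> \<G> i. 0 < y (V, k)})"
    proof
      fix p assume "p \<in> {p. \<delta> < c p * y p}"
      then have p: "\<delta> < c p * y p" by simp
      have "0 < c p * y p" using p \<delta> by (rule less_trans[rotated])
      then have pos: "0 < y p" using c(1)[of p] by (simp add: zero_less_mult_iff)
      have "c p * y p \<le> c p" using C(3)[OF y, of p] c(1)[of p] by (simp add: mult_left_le)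
      then have "(1/2 :: real) ^ N < (1/2) ^ (idx (fst p) + snd p)"
        using p N unfolding c_def by linarith
      then have "idx (fst p) + snd p < N"
        using power_strict_decreasing_iff[of "1/2 :: real" N "idx (fst p) + snd p"] by simp
      moreover have "fst p \<in> \<G> (idx (fst p))" using C(4)[OF y, of "{fst p}" "snd p"] pos by (intro idx) auto
      ultimately show "p \<in> (\<Union>i<N. \<Union>k<N. (\<lambda>V. (V, k)) ` {V \<in> \<G> i. 0 < y (V, k)})"
        using pos by (intro UN_I[of "idx (fst p)"] UN_I[of "snd p"] image_eqI[of _ _ "fst p"]) auto
    qed
    moreover have "finite (\<Union>i<N. \<Union>k<N. (\<lambda>V. (V, k)) ` {V \<in> \<G> i. 0 < y (V, k)})"
      using fin[OF y] by blast
    ultimately show ?thesis by (rule finite_subset)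
  qed
  define T :: "('a set \<times> nat \<Rightarrow> real) \<Rightarrow> ('a set \<times> nat) linf"
    where "T y = Bcontfun (\<lambda>d. c (of_discrete d) * y (of_discrete d))" for y
  have cy: "0 \<le> c p * y p" "c p * y p \<le> 1" if "y \<in> C" for y p
    using c[of p] C(3)[OF that, of p] by (auto simp: mult_le_one)
  have T: "apply_bcontfun (T y) d = c (of_discrete d) * y (of_discrete d)" if "y \<in> C" for y d
    unfolding T_def using cy[OF that] by (subst bounded_discrete_bcontfun[where B = 1]) auto
  have cont: "continuous_on C (\<lambda>y. f (T y))" if f: "bounded_linear f" for f :: "('a set \<times> nat) linf \<Rightarrow> real"
  proof (rule continuous_on_functional_of_expansion[OF f, where c = c and b = linf_unit])
    fix y and F :: "('a set \<times> nat) set" and \<delta> :: real assume y: "y \<in> C" and F: "finite F" and \<delta>: "0 < \<delta>"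
    \<comment> \<open>Outside \<open>J\<close> all rescaled coordinates are at most
      \<open>\<delta>\<close>, which bounds the sup norm of the remainder.\<close>
    define J where "J = F \<union> {p. \<delta> < c p * y p}"
    have J: "finite J" unfolding J_def using F fin_c[OF y \<delta>] by simp
    have "norm (T y - (\<Sum>p\<in>J. (c p * y p) *\<^sub>R linf_unit p)) \<le> \<delta>"
    proof (rule norm_bound)
      fix d
      have "c (of_discrete d) * y (of_discrete d) \<le> \<delta>" if "of_discrete d \<notin> J"
        using that unfolding J_def by auto
      then show "norm (apply_bcontfun (T y - (\<Sum>p\<in>J. (c p * y p) *\<^sub>R linf_unit p)) d) \<le> \<delta>"
        using \<delta> cy[OF y, of "of_discrete d"] by (simp add: T[OF y] apply_linf_sum[OF J])
    qed
    then show "\<exists>J. finite J \<and> F \<subseteq> J \<and> norm (T y - (\<Sum>p\<in>J. (c p * y p) *\<^sub>R linf_unit p)) \<le> \<delta>"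
      using J by (intro exI[of _ J]) (auto simp: J_def)
  next
    fix \<epsilon> :: real assume \<epsilon>: "0 < \<epsilon>"
    obtain M where M: "0 < M" "\<And>v. norm (f v) \<le> norm v * M"
      using bounded_linear.pos_bounded[OF f] by blast
    have "(\<Sum>p\<in>J. \<bar>f (linf_unit p)\<bar>) \<le> M" if J: "finite J" for J
    proof -
      \<comment> \<open>The functional is tested on the sum of unit vectors with the signs of its
        values. This has sup norm at most 1, so the values are absolutely summable with bound
        \<open>M\<close>, as for a functional on \<open>c\<^sub>0\<close>.\<close>
      define v where "v = (\<Sum>p\<in>J. sgn (f (linf_unit p)) *\<^sub>R linf_unit p)"
      have "norm v \<le> 1"
        by (rule norm_bound) (simp add: v_def apply_linf_sum[OF J] sgn_if)
      have "(\<Sum>p\<in>J. \<bar>f (linf_unit p)\<bar>) = f v"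
        unfolding v_def using bounded_linear.linear[OF f]
        by (simp add: linear_sum linear_scale abs_sgn mult.commute)
      also have "\<dots> \<le> norm v * M" using M(2)[of v] by simp
      also have "\<dots> \<le> M" using \<open>norm v \<le> 1\<close> M(1) by (simp add: mult_left_le_one_le)
      finally show ?thesis .
    qed
    then obtain F where F: "finite F"
        "\<And>J. finite J \<Longrightarrow> J \<inter> F = {} \<Longrightarrow> (\<Sum>p\<in>J. \<bar>f (linf_unit p)\<bar>) \<le> \<epsilon>"
      using small_tails[of "\<lambda>p. \<bar>f (linf_unit p)\<bar>" M \<epsilon>] \<epsilon> by auto
    have "\<bar>\<Sum>p\<in>J. c p * y p * f (linf_unit p)\<bar> \<le> \<epsilon>" if "y \<in> C" "finite J" "J \<inter> F = {}" for y J
    proof -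
      have "\<bar>\<Sum>p\<in>J. c p * y p * f (linf_unit p)\<bar> \<le> (\<Sum>p\<in>J. \<bar>c p * y p * f (linf_unit p)\<bar>)" by (rule sum_abs)
      also have "\<dots> \<le> (\<Sum>p\<in>J. \<bar>f (linf_unit p)\<bar>)"
      proof (rule sum_mono)
        fix p
        have "\<bar>c p * y p\<bar> * \<bar>f (linf_unit p)\<bar> \<le> 1 * \<bar>f (linf_unit p)\<bar>"
          using cy[OF that(1), of p] by (intro mult_right_mono) auto
        then show "\<bar>c p * y p * f (linf_unit p)\<bar> \<le> \<bar>f (linf_unit p)\<bar>" by (simp only: abs_mult mult_1)
      qed
      also have "\<dots> \<le> \<epsilon>" using F(2) that(2,3) .
      finally show ?thesis .
    qed
    then show "\<exists>F. finite F \<and> (\<forall>y\<in>C. \<forall>J. finite J \<longrightarrow> J \<inter> F = {} \<longrightarrow>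
        \<bar>\<Sum>p\<in>J. c p * y p * f (linf_unit p)\<bar> \<le> \<epsilon>)"
      using F(1) by blast
  qed
  have "compactin weak_topology (T ` C)" "top_of_set C homeomorphic_space subtopology weak_topology (T ` C)"
    using C(1) cont linear_apply_bcontfun_discrete less_imp_neq[OF c(1), symmetric]
    by (rule homeomorphic_weak_image[where coord = "\<lambda>p v. apply_bcontfun v (discrete p)" and c = c];
        simp add: T discrete_inverse)+
  then have "eberlein_compact TYPE(('a set \<times> nat) linf) (top_of_set C)"
    unfolding eberlein_compact_def
    using C(1) Hausdorff_space_subtopology[OF Hausdorff_space_function_space, of C]
    by (auto simp: compact_space_subtopology)
  then show ?thesis using C(2) by blast
qed

section \<open>Uniform Eberlein compactifications in the Hilbert space\<close>

lemma ell2_fun_Abs: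
  assumes "(\<lambda>i. (f i)\<^sup>2) summable_on UNIV"
  shows "ell2_fun (Abs_ell2 f) = f"
  using assms by (simp add: Abs_ell2_inverse)

definition ell2_unit :: "'g \<Rightarrow> 'g ell2" where
  "ell2_unit p = Abs_ell2 (\<lambda>i. if i = p then 1 else 0)"

lemma ell2_fun_unit: "ell2_fun (ell2_unit p) i = (if i = p then 1 else 0)"
proof -
  have "finite {i. (if i = p then 1 else 0 :: real)\<^sup>2 \<noteq> 0}" by simp
  then have "(\<lambda>i. (if i = p then 1 else 0 :: real)\<^sup>2) summable_on UNIV"
    by (intro finite_nonzero_values_imp_summable_on) simp
  then show ?thesis unfolding ell2_unit_def by (simp add: ell2_fun_Abs)
qed

lemma bounded_linear_ell2_fun: "bounded_linear (\<lambda>v :: 'g ell2. ell2_fun v i)"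
proof (rule bounded_linear_intro[where K = 1])
  show "ell2_fun (v + w) i = ell2_fun v i + ell2_fun w i" for v w :: "'g ell2"
    by (simp add: plus_ell2.rep_eq)
  show "ell2_fun (r *\<^sub>R v) i = r *\<^sub>R ell2_fun v i" for r and v :: "'g ell2"
    by (simp add: scaleR_ell2.rep_eq)
  show "norm (ell2_fun v i) \<le> norm v * 1" for v :: "'g ell2"
  proof -
    have "\<bar>ell2_fun v i\<bar>\<^sup>2 \<le> (norm v)\<^sup>2" using ell2_finite_sum_le[of "{i}" v] by simp
    then show ?thesis using power2_le_imp_le[of "\<bar>ell2_fun v i\<bar>" "norm v"] by simp
  qed
qed

lemma ell2_fun_sum:
  assumes "finite J"
  shows "ell2_fun (\<Sum>p\<in>J. a p *\<^sub>R ell2_unit p) i = (if i \<in> J then a i else 0)"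
proof -
  have "ell2_fun (\<Sum>p\<in>J. a p *\<^sub>R ell2_unit p) i = (\<Sum>p\<in>J. a p * (if i = p then 1 else 0))"
    using linear_sum[OF bounded_linear.linear[OF bounded_linear_ell2_fun[of i]], of "\<lambda>p. a p *\<^sub>R ell2_unit p" J]
    by (simp add: scaleR_ell2.rep_eq ell2_fun_unit)
  also have "\<dots> = (\<Sum>p\<in>J. if i = p then a p else 0)" by (intro sum.cong) auto
  finally show ?thesis using assms by (simp add: sum.delta')
qed

text \<open>A finite \<open>Q\<close> fits into a square, where the sum is the product of two
  geometric sums, each at most 2.\<close>

lemma sum_half_powers_le:
  assumes "finite Q"
  shows "(\<Sum>q\<in>Q. (1/2 :: real) ^ (fst q + snd q)) \<le> 4"
proof -
  have "finite (fst ` Q \<union> snd ` Q)" using assms by simp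
  then obtain N :: nat where N: "\<forall>n\<in>fst ` Q \<union> snd ` Q. n < N" unfolding finite_nat_set_iff_bounded by blast
  have sub: "Q \<subseteq> {..<N} \<times> {..<N}"
  proof
    fix q assume "q \<in> Q"
    then have "fst q \<in> fst ` Q \<union> snd ` Q" "snd q \<in> fst ` Q \<union> snd ` Q" by auto
    then show "q \<in> {..<N} \<times> {..<N}" using N by (simp add: mem_Times_iff)
  qed
  have geo: "(\<Sum>i<N. (1/2 :: real) ^ i) = 2 - 2 * (1/2) ^ N" by (induction N) auto
  have "(\<Sum>q\<in>Q. (1/2 :: real) ^ (fst q + snd q)) \<le> (\<Sum>q\<in>{..<N} \<times> {..<N}. (1/2) ^ (fst q + snd q))"
    using sub by (intro sum_mono2) auto
  also have "\<dots> = (\<Sum>i<N. \<Sum>k<N. (1/2) ^ (i + k))"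
    by (simp add: sum.cartesian_product case_prod_unfold)
  also have "\<dots> = (\<Sum>i<N. (1/2) ^ i) * (\<Sum>k<N. (1/2) ^ k)"
    by (simp add: sum_product power_add)
  also have "\<dots> \<le> 2 * 2"
    unfolding geo by (intro mult_mono) (simp_all add: power_le_one)
  finally show ?thesis by simp
qed

text \<open>With \<open>s\<close> the finite sum of squares and \<open>v\<close> the combination of
  unit vectors with coefficients \<open>f (ell2_unit p)\<close>, one has \<open>s = f v\<close> and
  \<open>f v \<le> sqrt s * M\<close>, hence \<open>s \<le> M\<^sup>2\<close>.\<close>

lemma ell2_functional_square_summable:
  fixes f :: "'g ell2 \<Rightarrow> real"
  assumes f: "bounded_linear f"
  shows "\<exists>M. \<forall>J. finite J \<longrightarrow> (\<Sum>p\<in>J. (f (ell2_unit p))\<^sup>2) \<le> M"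
proof -
  obtain M where M: "0 < M" "\<And>v. norm (f v) \<le> norm v * M"
    using bounded_linear.pos_bounded[OF f] by blast
  have "(\<Sum>p\<in>J. (f (ell2_unit p))\<^sup>2) \<le> M\<^sup>2" if J: "finite J" for J
  proof -
    define s where "s = (\<Sum>p\<in>J. (f (ell2_unit p))\<^sup>2)"
    have s: "0 \<le> s" unfolding s_def by (intro sum_nonneg) simp
    define v where "v = (\<Sum>p\<in>J. f (ell2_unit p) *\<^sub>R ell2_unit p)"
    have "norm v \<le> sqrt s"
    proof (rule ell2_norm_leI)
      fix G :: "'g set" assume G: "finite G"
      have "(\<Sum>i\<in>G. (ell2_fun v i)\<^sup>2) = (\<Sum>i\<in>G. if i \<in> J then (f (ell2_unit i))\<^sup>2 else 0)"
        unfolding v_def ell2_fun_sum[OF J] by (intro sum.cong) auto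
      also have "\<dots> = (\<Sum>i\<in>G \<inter> J. (f (ell2_unit i))\<^sup>2)" using G by (simp add: sum.inter_restrict)
      also have "\<dots> \<le> s" unfolding s_def using J by (intro sum_mono2) auto
      finally show "(\<Sum>i\<in>G. (ell2_fun v i)\<^sup>2) \<le> (sqrt s)\<^sup>2" using s by simp
    qed (use s in simp)
    have "s = f v"
      using linear_sum[OF bounded_linear.linear[OF f], of "\<lambda>p. f (ell2_unit p) *\<^sub>R ell2_unit p" J]
      unfolding v_def s_def by (simp add: linear_scale[OF bounded_linear.linear[OF f]] power2_eq_square)
    also have "\<dots> \<le> norm v * M" using M(2)[of v] by simp
    also have "\<dots> \<le> sqrt s * M" using \<open>norm v \<le> sqrt s\<close> M(1) by (intro mult_right_mono) auto
    finally have "s \<le> sqrt s * M" .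
    then have "sqrt s * sqrt s \<le> sqrt s * M" using s by simp
    have "sqrt s \<le> M"
    proof (cases "s = 0")
      case False
      then have "0 < sqrt s" using s by simp
      then show ?thesis using \<open>sqrt s * sqrt s \<le> sqrt s * M\<close> mult_le_cancel_left_pos by blast
    qed (use M(1) in simp)
    then have "(sqrt s)\<^sup>2 \<le> M\<^sup>2" using s by (intro power_mono) auto
    then show ?thesis using s unfolding s_def[symmetric] by simp
  qed
  then show ?thesis by blast
qed

lemma UE_space_imp_uniform_eberlein_compact:
  fixes X :: "'a topology"
  assumes "UE_space X"
  shows "\<exists>K :: ('a set \<times> nat \<Rightarrow> real) topology.
    uniform_eberlein_compact TYPE(('a set \<times> nat) ell2) K \<and> embeds_in X K"
proof -
  obtain \<alpha> where \<alpha>: "t0_space X" "almost_subbase X \<alpha>" "sigma_family boundedly_point_finite \<alpha>"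
    using assms unfolding UE_space_def by blast
  obtain \<G> :: "nat \<Rightarrow> 'a set set" where \<G>: "\<alpha> = (\<Union>i. \<G> i)" "\<And>i. boundedly_point_finite (\<G> i)"
    using sigma_familyE[OF \<alpha>(3)] by blast
  have "\<forall>i. \<exists>m\<ge>1. m_boundedly_point_finite m (\<G> i)"
    using \<G>(2) unfolding boundedly_point_finite_def by blast
  then obtain m :: "nat \<Rightarrow> nat" where m: "\<And>i. 1 \<le> m i" "\<And>i. m_boundedly_point_finite (m i) (\<G> i)"
    by metis
  obtain C :: "('a set \<times> nat \<Rightarrow> real) set" where C: "compact C" "embeds_in X (top_of_set C)"
      "\<And>y p. y \<in> C \<Longrightarrow> 0 \<le> y p \<and> y p \<le> 1"
      "\<And>y H k. y \<in> C \<Longrightarrow> finite H \<Longrightarrow> \<forall>V\<in>H. 0 < y (V, k) \<Longrightarrow> H \<subseteq> \<alpha> \<and> \<Inter>H \<noteq> {}"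
    by (rule almost_subbase_compactification[OF \<alpha>(1,2)]) (rule that)
  define idx where "idx V = (LEAST i. V \<in> \<G> i)" for V
  have idx: "V \<in> \<G> (idx V)" if "V \<in> \<alpha>" for V
    unfolding idx_def using that \<G>(1) by (auto intro: LeastI)
  \<comment> \<open>A block has at most \<open>m (fst q)\<close> positive coordinates at a point of
    \<open>C\<close>, so dividing by this number lets the whole block contribute at most
    \<open>(1/2) ^ (fst q + snd q)\<close>; all blocks together give at most 4. The scaling factor
    is the square root of the weight because squares are summed.\<close>
  define w where "w q = (1/2 :: real) ^ (fst q + snd q) / real (m (fst q))" for q :: "nat \<times> nat"
  have w: "0 < w q" for q unfolding w_def using m(1)[of "fst q"] by simp
  define \<pi> :: "'a set \<times> nat \<Rightarrow> nat \<times> nat" where "\<pi> p = (idx (fst p), snd p)" for p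
  define c where "c p = sqrt (w (\<pi> p))" for p
  have c: "0 < c p" "(c p)\<^sup>2 = w (\<pi> p)" for p unfolding c_def using w[of "\<pi> p"] by simp_all
  have bound: "(\<Sum>p\<in>J. (c p * y p)\<^sup>2) \<le> 4" if y: "y \<in> C" and J: "finite J" for y J
  proof -
    define J' where "J' = {p \<in> J. 0 < y p}"
    have J': "finite J'" unfolding J'_def using J by simp
    have "(\<Sum>p\<in>J. (c p * y p)\<^sup>2) = (\<Sum>p\<in>J'. (c p * y p)\<^sup>2)"
      unfolding J'_def using J C(3)[OF y] by (intro sum.mono_neutral_right) (auto simp: less_le)
    also have "\<dots> \<le> (\<Sum>p\<in>J'. w (\<pi> p))"
    proof (rule sum_mono)
      fix p
      have "(y p)\<^sup>2 \<le> 1" using C(3)[OF y, of p] by (simp add: power_le_one)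
      then have "(c p)\<^sup>2 * (y p)\<^sup>2 \<le> (c p)\<^sup>2 * 1" by (rule mult_left_mono) simp
      then show "(c p * y p)\<^sup>2 \<le> w (\<pi> p)" by (simp add: power_mult_distrib c(2))
    qed
    also have "\<dots> = (\<Sum>q\<in>\<pi> ` J'. \<Sum>p\<in>{p \<in> J'. \<pi> p = q}. w (\<pi> p))"
      using J' by (rule sum.image_gen)
    also have "\<dots> \<le> (\<Sum>q\<in>\<pi> ` J'. (1/2) ^ (fst q + snd q))"
    proof (rule sum_mono)
      fix q :: "nat \<times> nat"
      have fip: "\<Inter>H \<noteq> {}" if "finite H" "\<forall>V\<in>H. 0 < y (V, snd q)" for H
        using C(4)[OF y that] by blast
      have fin: "finite {V \<in> \<G> (fst q). 0 < y (V, snd q)} \<and> card {V \<in> \<G> (fst q). 0 < y (V, snd q)} \<le> m (fst q)"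
        using fip m(2) by (rule card_positive_coordinates_le)
      have "fst p \<in> \<G> (fst q) \<and> 0 < y (fst p, snd q)" if p: "p \<in> J'" "\<pi> p = q" for p
      proof -
        have "fst p \<in> \<alpha>" using C(4)[OF y, of "{fst p}" "snd p"] p(1) unfolding J'_def by auto
        then have "fst p \<in> \<G> (idx (fst p))" by (rule idx)
        then show ?thesis using p unfolding \<pi>_def J'_def by auto
      qed
      then have "fst ` {p \<in> J'. \<pi> p = q} \<subseteq> {V \<in> \<G> (fst q). 0 < y (V, snd q)}" by blast
      moreover have "inj_on fst {p \<in> J'. \<pi> p = q}" unfolding \<pi>_def by (auto intro!: inj_onI prod_eqI)
      ultimately have card: "card {p \<in> J'. \<pi> p = q} \<le> m (fst q)"
        using fin by (meson card_inj_on_le le_trans)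
      have "(\<Sum>p\<in>{p \<in> J'. \<pi> p = q}. w (\<pi> p)) = (\<Sum>p\<in>{p \<in> J'. \<pi> p = q}. w q)"
        by (intro sum.cong) auto
      also have "\<dots> = real (card {p \<in> J'. \<pi> p = q}) * w q" by simp
      also have "\<dots> \<le> real (m (fst q)) * w q"
        using card w[of q] by (intro mult_right_mono) auto
      also have "\<dots> = (1/2) ^ (fst q + snd q)" unfolding w_def using m(1)[of "fst q"] by simp
      finally show "(\<Sum>p\<in>{p \<in> J'. \<pi> p = q}. w (\<pi> p)) \<le> (1/2) ^ (fst q + snd q)" .
    qed
    also have "\<dots> \<le> 4" using J' by (intro sum_half_powers_le) simp
    finally show ?thesis .
  qed
  define T :: "('a set \<times> nat \<Rightarrow> real) \<Rightarrow> ('a set \<times> nat) ell2" where "T y = Abs_ell2 (\<lambda>p. c p * y p)" for y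
  have T: "ell2_fun (T y) p = c p * y p" if y: "y \<in> C" for y p
  proof -
    have "(\<lambda>p. (c p * y p)\<^sup>2) summable_on UNIV"
      using bound[OF y] by (intro nonneg_bdd_above_summable_on bdd_aboveI2[of _ _ 4]) auto
    then show ?thesis unfolding T_def by (simp add: ell2_fun_Abs)
  qed
  have cont: "continuous_on C (\<lambda>y. f (T y))" if f: "bounded_linear f" for f :: "('a set \<times> nat) ell2 \<Rightarrow> real"
  proof (rule continuous_on_functional_of_expansion[OF f, where c = c and b = ell2_unit])
    fix y and F :: "('a set \<times> nat) set" and \<delta> :: real assume y: "y \<in> C" and F: "finite F" and \<delta>: "0 < \<delta>"
    have "\<exists>F'. finite F' \<and> (\<forall>J. finite J \<longrightarrow> J \<inter> F' = {} \<longrightarrow> (\<Sum>p\<in>J. (c p * y p)\<^sup>2) \<le> \<delta>\<^sup>2)"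
      using bound[OF y] \<delta> by (intro small_tails[of _ 4]) auto
    then obtain F' where F': "finite F'"
        "\<And>J. finite J \<Longrightarrow> J \<inter> F' = {} \<Longrightarrow> (\<Sum>p\<in>J. (c p * y p)\<^sup>2) \<le> \<delta>\<^sup>2" by blast
    define J where "J = F \<union> F'"
    have J: "finite J" unfolding J_def using F F'(1) by simp
    have "norm (T y - (\<Sum>p\<in>J. (c p * y p) *\<^sub>R ell2_unit p)) \<le> \<delta>"
    proof (rule ell2_norm_leI)
      fix G :: "('a set \<times> nat) set" assume G: "finite G"
      have "(\<Sum>i\<in>G. (ell2_fun (T y - (\<Sum>p\<in>J. (c p * y p) *\<^sub>R ell2_unit p)) i)\<^sup>2) =
          (\<Sum>i\<in>G. if i \<in> - J then (c i * y i)\<^sup>2 else 0)"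
        by (intro sum.cong) (auto simp: minus_ell2.rep_eq T[OF y] ell2_fun_sum[OF J])
      also have "\<dots> = (\<Sum>i\<in>G \<inter> - J. (c i * y i)\<^sup>2)" using G by (rule sum.inter_restrict[symmetric])
      also have "\<dots> \<le> \<delta>\<^sup>2" using G by (intro F'(2)) (auto simp: J_def)
      finally show "(\<Sum>i\<in>G. (ell2_fun (T y - (\<Sum>p\<in>J. (c p * y p) *\<^sub>R ell2_unit p)) i)\<^sup>2) \<le> \<delta>\<^sup>2" .
    qed (use \<delta> in simp)
    then show "\<exists>J. finite J \<and> F \<subseteq> J \<and> norm (T y - (\<Sum>p\<in>J. (c p * y p) *\<^sub>R ell2_unit p)) \<le> \<delta>"
      using J by (intro exI[of _ J]) (auto simp: J_def)
  next
    fix \<epsilon> :: real assume \<epsilon>: "0 < \<epsilon>"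
    obtain M where M: "\<And>J. finite J \<Longrightarrow> (\<Sum>p\<in>J. (f (ell2_unit p))\<^sup>2) \<le> M"
      using ell2_functional_square_summable[OF f] by blast
    \<comment> \<open>The Cauchy-Schwarz inequality pairs these tails with sums of squared rescaled
      coordinates, bounded by 4, and
      \<open>4 * (\<epsilon> / 2)\<^sup>2 = \<epsilon>\<^sup>2\<close>.\<close>
    have "\<exists>F. finite F \<and> (\<forall>J. finite J \<longrightarrow> J \<inter> F = {} \<longrightarrow> (\<Sum>p\<in>J. (f (ell2_unit p))\<^sup>2) \<le> (\<epsilon> / 2)\<^sup>2)"
      using M \<epsilon> by (intro small_tails[of _ M]) auto
    then obtain F where F: "finite F"
        "\<And>J. finite J \<Longrightarrow> J \<inter> F = {} \<Longrightarrow> (\<Sum>p\<in>J. (f (ell2_unit p))\<^sup>2) \<le> (\<epsilon> / 2)\<^sup>2" by blast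
    have "\<bar>\<Sum>p\<in>J. c p * y p * f (ell2_unit p)\<bar> \<le> \<epsilon>" if "y \<in> C" "finite J" "J \<inter> F = {}" for y J
    proof -
      have "(\<Sum>p\<in>J. c p * y p * f (ell2_unit p))\<^sup>2 \<le>
          (\<Sum>p\<in>J. (c p * y p)\<^sup>2) * (\<Sum>p\<in>J. (f (ell2_unit p))\<^sup>2)"
        by (rule Cauchy_Schwarz_ineq_sum)
      also have "\<dots> \<le> 4 * (\<epsilon> / 2)\<^sup>2"
        using bound[OF that(1,2)] F(2)[OF that(2,3)] by (intro mult_mono) (auto intro: sum_nonneg)
      also have "\<dots> = \<epsilon>\<^sup>2" by (simp add: power_divide)
      finally have "\<bar>\<Sum>p\<in>J. c p * y p * f (ell2_unit p)\<bar>\<^sup>2 \<le> \<epsilon>\<^sup>2" by simp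
      then show ?thesis by (rule power2_le_imp_le) (use \<epsilon> in simp)
    qed
    then show "\<exists>F. finite F \<and> (\<forall>y\<in>C. \<forall>J. finite J \<longrightarrow> J \<inter> F = {} \<longrightarrow>
        \<bar>\<Sum>p\<in>J. c p * y p * f (ell2_unit p)\<bar> \<le> \<epsilon>)"
      using F(1) by blast
  qed
  have "compactin weak_topology (T ` C)" "top_of_set C homeomorphic_space subtopology weak_topology (T ` C)"
    using C(1) cont bounded_linear_ell2_fun less_imp_neq[OF c(1), symmetric]
    by (rule homeomorphic_weak_image[where coord = "\<lambda>p v. ell2_fun v p" and c = c]; simp add: T)+
  then have "uniform_eberlein_compact TYPE(('a set \<times> nat) ell2) (top_of_set C)"
    unfolding uniform_eberlein_compact_def
    using C(1) Hausdorff_space_subtopology[OF Hausdorff_space_function_space, of C]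
    by (auto simp: compact_space_subtopology)
  then show ?thesis using C(2) by blast
qed

text \<open>Quantification over types is expressed by pairs: concrete types bear the constructed
  compactum, arbitrary types cover every compactum that could be given.\<close>

theorem corollary3p7:
  fixes n :: nat and X :: "'a topology"
  assumes "t0_space X"
  shows
    "((\<exists>K :: ('a set \<times> nat \<Rightarrow> real) topology.
          eberlein_compact TYPE(('a set \<times> nat) linf) K \<and> embeds_in X K) \<longleftrightarrow> E_space X) \<and>
     ((\<exists>K :: 'k topology.
          eberlein_compact TYPE('v::banach) K \<and> embeds_in X K) \<longrightarrow> E_space X) \<and>

     ((\<exists>K :: ('a set \<times> nat \<Rightarrow> real) topology.
          corson_compact TYPE('a set \<times> nat) K \<and> embeds_in X K) \<longleftrightarrow> C_space X) \<and>
     ((\<exists>K :: 'k topology.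
          corson_compact TYPE('g) K \<and> embeds_in X K) \<longrightarrow> C_space X) \<and>

     ((\<exists>K :: ('a set \<times> nat \<Rightarrow> real) topology.
          uniform_eberlein_compact TYPE(('a set \<times> nat) ell2) K \<and> embeds_in X K) \<longleftrightarrow> UE_space X) \<and>
     ((\<exists>K :: 'k topology.
          uniform_eberlein_compact TYPE('h::{real_inner, complete_space}) K \<and> embeds_in X K)
        \<longrightarrow> UE_space X) \<and>

     ((\<exists>K :: ('a set \<times> nat \<Rightarrow> real) topology.
          n_uniform_eberlein_compact n K \<and> embeds_in X K) \<longleftrightarrow> n_UE_space n X) \<and>
     ((\<exists>K :: 'k topology.
          n_uniform_eberlein_compact n K \<and> embeds_in X K) \<longrightarrow> n_UE_space n X)"
  by (intro conjI iffI impI;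
      (rule E_space_imp_eberlein_compact C_space_imp_corson_compact
          UE_space_imp_uniform_eberlein_compact n_UE_space_imp_n_uniform_eberlein_compact
        | elim exE conjE, rule eberlein_compact_imp_E_space[OF assms] corson_compact_imp_C_space[OF assms]
          uniform_eberlein_compact_imp_UE_space[OF assms] n_uniform_eberlein_compact_imp_n_UE_space[OF assms]);
      assumption)

end
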